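(* Let $Y$ be an order continuous Banach lattice with weak units, and let $X=Y^*$. For any proper convex functional $\rho:X\to(-\infty,\infty]$, the following statements are equivalent: (1) $\rho(x)=\sup_{y\in Y}\big(\langle x,y\rangle-\rho^*(y)\big)$ for any $x\in X$, where $\rho^*(y)=\sup_{x\in X}\big(\langle x,y\rangle-\rho(x)\big)$ for any $y\in Y$; (2) $\rho(x)\le\liminf_\alpha\rho(x_\alpha)$ for any norm bounded net $(x_\alpha)$ in $X$ uo-converging to $x\in X$; (3) $\rho(x)\le\liminf_n\rho(x_n)$ for any norm bounded sequence $(x_n)$ in $X$ uo-converging to $x\in X$.
   Context: A net $(x_\alpha)$ in a vector lattice $X$ order converges to $x\in X$ ($x_\alpha\xrightarrow{o}x$) if there is a net $(y_\gamma)$ in $X$ (possibly with a different index set) with $y_\gamma\downarrow 0$ such that for every $\gamma$ there is $\alpha_0$ with $|x_\alpha-x|\le y_\gamma$ for all $\alpha\ge\alpha_0$. The net uo-converges to $x$ if $|x_\alpha-x|\wedge y\xrightarrow{o}0$ for every $y\in X_+$. A Banach lattice is order continuous if every net order converging to $0$ converges to $0$ in norm. A weak unit of $Y$ is an element $e\in Y_+$ such that $|y|\wedge e=0$ implies $y=0$ for every $y\in Y$. A functional $\rho$ is proper if it is not identically $\infty$. Here $\langle x,y\rangle=x(y)$ for $x\in X=Y^*$, $y\in Y$. *)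

theory Defs
  imports "HOL-Analysis.Analysis" "HOL-Library.Lattice_Algebras"
begin

section \<open>Vector lattices and Banach lattices\<close>

class vector_lattice = ordered_real_vector + lattice_ab_group_add_abs

class banach_lattice = banach + vector_lattice +
  assumes norm_mono_abs: "\<bar>x\<bar> \<le> \<bar>y\<bar> \<Longrightarrow> norm x \<le> norm y"


section \<open>Nets and their convergence\<close>

text \<open>
  A net is a family \<open>xs\<close> restricted to an index set \<open>A\<close> that is directed by \<open>r\<close>, where
  \<open>r a b\<close> means that \<open>b\<close> is at least \<open>a\<close>.
\<close>

definition directed_by :: "'i set \<Rightarrow> ('i \<Rightarrow> 'i \<Rightarrow> bool) \<Rightarrow> bool" where
  "directed_by A r \<longleftrightarrow> A \<noteq> {} \<and> (\<forall>a\<in>A. r a a) \<and>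
     (\<forall>a\<in>A. \<forall>b\<in>A. \<forall>c\<in>A. r a b \<longrightarrow> r b c \<longrightarrow> r a c) \<and>
     (\<forall>a\<in>A. \<forall>b\<in>A. \<exists>c\<in>A. r a c \<and> r b c)"

lemma directed_byD:
  assumes "directed_by A r"
  shows "A \<noteq> {}" "\<forall>a\<in>A. r a a" "\<forall>a\<in>A. \<forall>b\<in>A. \<exists>c\<in>A. r a c \<and> r b c"
  using assms unfolding directed_by_def by - (elim conjE, assumption)+

definition decreases_to_zero ::
    "'g set \<Rightarrow> ('g \<Rightarrow> 'g \<Rightarrow> bool) \<Rightarrow> ('g \<Rightarrow> 'x::vector_lattice) \<Rightarrow> bool" where
  "decreases_to_zero G s y \<longleftrightarrow>
     (\<forall>c\<in>G. \<forall>d\<in>G. s c d \<longrightarrow> y d \<le> y c) \<and>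
     (\<forall>c\<in>G. 0 \<le> y c) \<and> (\<forall>z. (\<forall>c\<in>G. z \<le> y c) \<longrightarrow> z \<le> 0)"

text \<open>
  The dominating net \<open>y\<close> is indexed by a subset of the vector lattice itself, because a
  definition cannot quantify over the type of the index set. This loses nothing: see
  \<open>order_convergesI\<close>, where the index type is arbitrary.
\<close>

definition order_converges ::
    "'i set \<Rightarrow> ('i \<Rightarrow> 'i \<Rightarrow> bool) \<Rightarrow> ('i \<Rightarrow> 'x::vector_lattice) \<Rightarrow> 'x \<Rightarrow> bool" where
  "order_converges A r xs x \<longleftrightarrow>
     (\<exists>(G :: 'x set) s y. directed_by G s \<and> decreases_to_zero G s y \<and>
        (\<forall>c\<in>G. \<exists>a\<in>A. \<forall>b\<in>A. r a b \<longrightarrow> \<bar>xs b - x\<bar> \<le> y c))"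

lemma order_convergesI:
  fixes G :: "'g set" and y :: "'g \<Rightarrow> 'x::vector_lattice"
  assumes "directed_by G s" "decreases_to_zero G s y"
    and "\<And>c. c \<in> G \<Longrightarrow> \<exists>a\<in>A. \<forall>b\<in>A. r a b \<longrightarrow> \<bar>xs b - x\<bar> \<le> y c"
  shows "order_converges A r xs x"
proof -
  have "\<exists>w\<in>y ` G. w \<le> y c \<and> w \<le> y d" if "c \<in> G" "d \<in> G" for c d
  proof -
    have "\<exists>e\<in>G. s c e \<and> s d e"
      using directed_byD(3)[OF assms(1)] that by simp
    then obtain e where e: "e \<in> G" "s c e" "s d e" by blast
    have "y e \<le> y c" "y e \<le> y d"
      using assms(2) that e by (simp_all add: decreases_to_zero_def)
    with e(1) show ?thesis by blast
  qed
  then have "\<forall>a\<in>y ` G. \<forall>b\<in>y ` G. \<exists>w\<in>y ` G. w \<le> a \<and> w \<le> b" by simp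
  moreover have "y ` G \<noteq> {}" using directed_byD(1)[OF assms(1)] by simp
  ultimately have dir: "directed_by (y ` G) (\<lambda>u v. v \<le> u)"
    unfolding directed_by_def
    by (intro conjI ballI impI order_refl) (assumption | erule (1) order_trans[rotated] | blast)+
  have dec: "decreases_to_zero (y ` G) (\<lambda>u v. v \<le> u) id"
    using assms(2) unfolding decreases_to_zero_def by simp
  have dom: "\<forall>c\<in>y ` G. \<exists>a\<in>A. \<forall>b\<in>A. r a b \<longrightarrow> \<bar>xs b - x\<bar> \<le> id c"
    using assms(3) by simp
  show ?thesis
    unfolding order_converges_def by (intro exI conjI) (rule dir, rule dec, rule dom)
qed

definition uo_converges ::
    "'i set \<Rightarrow> ('i \<Rightarrow> 'i \<Rightarrow> bool) \<Rightarrow> ('i \<Rightarrow> 'x::vector_lattice) \<Rightarrow> 'x \<Rightarrow> bool" where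
  "uo_converges A r xs x \<longleftrightarrow>
     (\<forall>y\<ge>0. order_converges A r (\<lambda>a. inf \<bar>xs a - x\<bar> y) 0)"

definition net_liminf ::
    "'i set \<Rightarrow> ('i \<Rightarrow> 'i \<Rightarrow> bool) \<Rightarrow> ('i \<Rightarrow> ereal) \<Rightarrow> ereal" where
  "net_liminf A r f = (SUP a\<in>A. INF b\<in>{b\<in>A. r a b}. f b)"


section \<open>Order continuity and weak units\<close>

text \<open>
  Again the index sets range over subsets of the space; \<open>order_continuous_normD\<close> gives the
  property for nets over any index type.
\<close>

definition order_continuous_norm :: "'y::banach_lattice itself \<Rightarrow> bool" where
  "order_continuous_norm _ \<longleftrightarrow>
     (\<forall>(A :: 'y set) r (xs :: 'y \<Rightarrow> 'y). directed_by A r \<longrightarrow> order_converges A r xs 0 \<longrightarrow>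
        (\<forall>e>0. \<exists>a\<in>A. \<forall>b\<in>A. r a b \<longrightarrow> norm (xs b) < e))"

lemma order_continuous_normD:
  fixes A :: "'i set" and xs :: "'i \<Rightarrow> 'y::banach_lattice"
  assumes oc: "order_continuous_norm TYPE('y)"
    and x: "order_converges A r xs 0" and "e > 0"
  shows "\<exists>a\<in>A. \<forall>b\<in>A. r a b \<longrightarrow> norm (xs b) < e"
proof -
  from x obtain G :: "'y set" and s y where G: "directed_by G s" "decreases_to_zero G s y"
    and dom: "\<And>c. c \<in> G \<Longrightarrow> \<exists>a\<in>A. \<forall>b\<in>A. r a b \<longrightarrow> \<bar>xs b\<bar> \<le> y c"
    unfolding order_converges_def by auto
  have pos: "0 \<le> y c" if "c \<in> G" for c
    using G(2) that by (auto simp: decreases_to_zero_def)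
  have "order_converges G s y 0"
  proof (rule order_convergesI[OF G])
    fix c assume c: "c \<in> G"
    have "\<bar>y b - 0\<bar> \<le> y c" if "b \<in> G" "s c b" for b
      using G(2) c that pos[of b] by (auto simp: decreases_to_zero_def)
    with c show "\<exists>a\<in>G. \<forall>b\<in>G. s a b \<longrightarrow> \<bar>y b - 0\<bar> \<le> y c" by blast
  qed
  then obtain c where c: "c \<in> G" "\<forall>b\<in>G. s c b \<longrightarrow> norm (y b) < e"
    using oc G(1) \<open>e > 0\<close> unfolding order_continuous_norm_def by blast
  then have yc: "norm (y c) < e"
    using directed_byD(2)[OF G(1)] by simp
  obtain a where a: "a \<in> A" "\<forall>b\<in>A. r a b \<longrightarrow> \<bar>xs b\<bar> \<le> y c"
    using dom[OF c(1)] by blast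
  have "norm (xs b) < e" if "b \<in> A" "r a b" for b
  proof -
    have "norm (xs b) \<le> norm (y c)"
      using a(2) that pos[OF c(1)] by (intro norm_mono_abs) auto
    with yc show ?thesis by simp
  qed
  with a(1) show ?thesis by blast
qed

definition weak_unit :: "'y::vector_lattice \<Rightarrow> bool" where
  "weak_unit e \<longleftrightarrow> 0 \<le> e \<and> (\<forall>y. inf \<bar>y\<bar> e = 0 \<longrightarrow> y = 0)"


section \<open>The dual Banach lattice\<close>

text \<open>
  The norm dual is a copy of the type of bounded linear functionals, with the operator norm.
  A copy is needed for the lattice order, since a type class instance cannot be declared for
  bounded linear maps into one fixed type.
\<close>

typedef (overloaded) 'a dual = "UNIV :: ('a::real_normed_vector \<Rightarrow>\<^sub>L real) set"
  morphisms blinfun_of_dual Dual ..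

lemmas dual_inverse [simp] = Dual_inverse[OF UNIV_I] blinfun_of_dual_inverse

definition pairing :: "'a::real_normed_vector dual \<Rightarrow> 'a \<Rightarrow> real" where
  "pairing x y = blinfun_apply (blinfun_of_dual x) y"

lemma dual_eqI: "(\<And>y. pairing f y = pairing g y) \<Longrightarrow> f = g"
  by (metis blinfun_eqI blinfun_of_dual_inject pairing_def)

lemma pairing_linear_simps [simp]:
  "pairing f (u + v) = pairing f u + pairing f v"
  "pairing f (u - v) = pairing f u - pairing f v"
  "pairing f (- u) = - pairing f u"
  "pairing f (c *\<^sub>R u) = c * pairing f u"
  "pairing f 0 = 0"
  by (simp_all add: pairing_def blinfun.bilinear_simps)

instantiation dual :: (real_normed_vector) real_normed_vector
begin

definition zero_dual :: "'a dual" where "zero_dual = Dual 0"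
definition plus_dual :: "'a dual \<Rightarrow> 'a dual \<Rightarrow> 'a dual" where "plus_dual f g = Dual (blinfun_of_dual f + blinfun_of_dual g)"
definition minus_dual :: "'a dual \<Rightarrow> 'a dual \<Rightarrow> 'a dual" where "minus_dual f g = Dual (blinfun_of_dual f - blinfun_of_dual g)"
definition uminus_dual :: "'a dual \<Rightarrow> 'a dual" where "uminus_dual f = Dual (- blinfun_of_dual f)"
definition scaleR_dual :: "real \<Rightarrow> 'a dual \<Rightarrow> 'a dual" where "scaleR_dual c f = Dual (c *\<^sub>R blinfun_of_dual f)"
definition norm_dual :: "'a dual \<Rightarrow> real" where "norm_dual f = norm (blinfun_of_dual f)"
definition dist_dual :: "'a dual \<Rightarrow> 'a dual \<Rightarrow> real" where "dist_dual f g = norm (f - g)"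
definition sgn_dual :: "'a dual \<Rightarrow> 'a dual" where "sgn_dual f = scaleR (inverse (norm f)) f"
definition uniformity_dual :: "('a dual \<times> 'a dual) filter" where
  "uniformity_dual = (INF e\<in>{0 <..}. principal {(x, y). dist x y < e})"
definition open_dual :: "'a dual set \<Rightarrow> bool" where
  "open_dual U \<longleftrightarrow> (\<forall>x\<in>U. \<forall>\<^sub>F (x', y) in uniformity. x' = x \<longrightarrow> y \<in> U)"

instance
proof
  fix f g :: "'a dual"
  show "norm f = 0 \<longleftrightarrow> f = 0"
    by (metis dual_inverse norm_eq_zero norm_dual_def zero_dual_def)
  show "norm (f + g) \<le> norm f + norm g"
    by (simp add: norm_dual_def plus_dual_def norm_triangle_ineq)
qed (auto simp: zero_dual_def plus_dual_def minus_dual_def uminus_dual_def scaleR_dual_def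
      norm_dual_def dist_dual_def sgn_dual_def uniformity_dual_def open_dual_def
      algebra_simps)

end

lemma pairing_simps [simp]:
  "pairing 0 y = 0"
  "pairing (f + g) y = pairing f y + pairing g y"
  "pairing (f - g) y = pairing f y - pairing g y"
  "pairing (- f) y = - pairing f y"
  "pairing (c *\<^sub>R f) y = c * pairing f y"
  by (simp_all add: pairing_def zero_dual_def plus_dual_def minus_dual_def uminus_dual_def
      scaleR_dual_def blinfun.bilinear_simps)

lemma pairing_le_norm: "\<bar>pairing f y\<bar> \<le> norm f * norm y"
  using norm_blinfun[of "blinfun_of_dual f" y] by (simp add: pairing_def norm_dual_def)

lemma norm_dual_le:
  assumes "0 \<le> c" "\<And>y. \<bar>pairing f y\<bar> \<le> c * norm y"
  shows "norm f \<le> c"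
  using assms by (auto simp: pairing_def norm_dual_def intro!: norm_blinfun_bound)

instance dual :: (real_normed_vector) banach
proof
  fix X :: "nat \<Rightarrow> 'a dual"
  assume "Cauchy X"
  then have "Cauchy (\<lambda>n. blinfun_of_dual (X n))"
    by (simp add: Cauchy_def dist_dual_def dist_norm norm_dual_def minus_dual_def)
  then obtain l where "(\<lambda>n. blinfun_of_dual (X n)) \<longlonglongrightarrow> l"
    by (auto simp: Cauchy_convergent_iff convergent_def)
  then have "X \<longlonglongrightarrow> Dual l"
    by (simp add: lim_sequentially dist_dual_def dist_norm norm_dual_def minus_dual_def)
  then show "convergent X" by (auto simp: convergent_def)
qed

text \<open>The dual is ordered by the dual cone, and the lattice operations are those of that order.\<close>

instantiation dual :: (banach_lattice) "{ord, sup, inf, abs}"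
begin

definition less_eq_dual :: "'a dual \<Rightarrow> 'a dual \<Rightarrow> bool" where
  "less_eq_dual f g \<longleftrightarrow> (\<forall>y\<ge>0. pairing f y \<le> pairing g y)"
definition less_dual :: "'a dual \<Rightarrow> 'a dual \<Rightarrow> bool" where
  "less_dual f g \<longleftrightarrow> f \<le> g \<and> \<not> g \<le> f"
definition sup_dual :: "'a dual \<Rightarrow> 'a dual \<Rightarrow> 'a dual" where
  "sup_dual f g = (THE h. f \<le> h \<and> g \<le> h \<and> (\<forall>k. f \<le> k \<longrightarrow> g \<le> k \<longrightarrow> h \<le> k))"
definition inf_dual :: "'a dual \<Rightarrow> 'a dual \<Rightarrow> 'a dual" where
  "inf_dual f g = (THE h. h \<le> f \<and> h \<le> g \<and> (\<forall>k. k \<le> f \<longrightarrow> k \<le> g \<longrightarrow> k \<le> h))"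
definition abs_dual :: "'a dual \<Rightarrow> 'a dual" where
  "abs_dual f = sup f (- f)"

instance ..

end

lemma pairing_pprt_nprt:
  fixes y :: "'a::banach_lattice"
  shows "pairing f y = pairing f (pprt y) - pairing f (- nprt y)"
  by (metis add.inverse_inverse diff_minus_eq_add pairing_linear_simps(1,3) prts)

instance dual :: (banach_lattice) ordered_real_vector
proof
  fix f g h :: "'a dual" and a b :: real
  show "f = g" if "f \<le> g" "g \<le> f"
  proof (rule dual_eqI)
    have *: "pairing f y = pairing g y" if "y \<ge> 0" for y
      using \<open>f \<le> g\<close> \<open>g \<le> f\<close> that by (auto simp: less_eq_dual_def intro: antisym)
    show "pairing f y = pairing g y" for y
      using *[of "pprt y"] *[of "- nprt y"] pairing_pprt_nprt[of f y] pairing_pprt_nprt[of g y]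
      by simp
  qed
  show "a *\<^sub>R f \<le> b *\<^sub>R f" if "a \<le> b" "0 \<le> f"
    using that by (auto simp: less_eq_dual_def intro!: mult_right_mono)
qed (auto simp: less_eq_dual_def less_dual_def intro: order_trans mult_left_mono)

text \<open>The Riesz--Kantorovich formula for the positive part of a functional, on the positive cone.\<close>

definition rk :: "'a::banach_lattice dual \<Rightarrow> 'a \<Rightarrow> real" where
  "rk f y = (SUP u\<in>{0..y}. pairing f u)"

lemma rk_bdd:
  fixes y u :: "'a::banach_lattice"
  assumes "u \<in> {0..y}"
  shows "pairing f u \<le> norm f * norm y"
proof -
  have "0 \<le> y" using assms by (auto intro: order_trans)
  then have "norm u \<le> norm y" using assms by (intro norm_mono_abs) simp
  then have "norm f * norm u \<le> norm f * norm y" by (simp add: mult_left_mono)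
  with pairing_le_norm[of f u] show ?thesis by linarith
qed

lemma rk_bdd_above: "bdd_above (pairing f ` {0..y::'a::banach_lattice})"
  using rk_bdd by (intro bdd_aboveI) blast

lemma rk_upper: "u \<in> {0..y} \<Longrightarrow> pairing f u \<le> rk f y"
  unfolding rk_def by (intro cSUP_upper rk_bdd_above)

lemma rk_least: "0 \<le> y \<Longrightarrow> (\<And>u. u \<in> {0..y} \<Longrightarrow> pairing f u \<le> c) \<Longrightarrow> rk f y \<le> c"
  unfolding rk_def by (intro cSUP_least) auto

lemma rk_nonneg: "0 \<le> y \<Longrightarrow> 0 \<le> rk f y"
  using rk_upper[of 0 y f] by simp

lemma rk_le: "0 \<le> y \<Longrightarrow> rk f y \<le> norm f * norm y"
  by (intro rk_least rk_bdd)

lemma rk_add: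
  fixes y z :: "'a::banach_lattice"
  assumes y: "0 \<le> y" and z: "0 \<le> z"
  shows "rk f (y + z) = rk f y + rk f z"
proof (rule antisym)
  show "rk f (y + z) \<le> rk f y + rk f z"
  proof (rule rk_least)
    fix w assume w: "w \<in> {0..y + z}"
    have "w - inf w y = w + sup (- w) (- y)"
      by (simp add: diff_inf_eq_sup)
    also have "\<dots> = sup 0 (w - y)"
      by (simp add: add_sup_distrib_left)
    finally have "w - inf w y \<in> {0..z}"
      using w z by (simp add: diff_le_eq add.commute)
    moreover have "inf w y \<in> {0..y}" using w y by simp
    ultimately have "pairing f (inf w y) + pairing f (w - inf w y) \<le> rk f y + rk f z"
      by (intro add_mono rk_upper)
    then show "pairing f w \<le> rk f y + rk f z"
      unfolding pairing_linear_simps by linarith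
  qed (use y z in simp)
  have "rk f y \<le> rk f (y + z) - rk f z"
  proof (rule rk_least[OF y])
    fix u assume u: "u \<in> {0..y}"
    have "rk f z \<le> rk f (y + z) - pairing f u"
    proof (rule rk_least[OF z])
      fix v assume "v \<in> {0..z}"
      with u have "u + v \<in> {0..y + z}" by (simp add: add_mono)
      from rk_upper[OF this, of f] show "pairing f v \<le> rk f (y + z) - pairing f u" by simp
    qed
    then show "pairing f u \<le> rk f (y + z) - rk f z" by simp
  qed
  then show "rk f y + rk f z \<le> rk f (y + z)" by simp
qed

lemma rk_scale_le:
  fixes y :: "'a::banach_lattice"
  assumes y: "0 \<le> y" and c: "0 < c"
  shows "rk f (c *\<^sub>R y) \<le> c * rk f y"
proof (rule rk_least)
  show "0 \<le> c *\<^sub>R y" using y c by (simp add: scaleR_nonneg_nonneg)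
  fix u assume u: "u \<in> {0..c *\<^sub>R y}"
  have "inverse c *\<^sub>R u \<le> inverse c *\<^sub>R (c *\<^sub>R y)"
    using u c by (intro scaleR_left_mono) auto
  then have "inverse c *\<^sub>R u \<in> {0..y}"
    using u c by (simp add: scaleR_nonneg_nonneg)
  from rk_upper[OF this, of f] show "pairing f u \<le> c * rk f y"
    using c by (simp add: field_simps)
qed

lemma rk_scale:
  fixes y :: "'a::banach_lattice"
  assumes y: "0 \<le> y" and c: "0 \<le> c"
  shows "rk f (c *\<^sub>R y) = c * rk f y"
proof (cases "c = 0")
  case True
  then show ?thesis by (simp add: rk_def)
next
  case False
  with c have c: "0 < c" by simp
  then have "rk f (inverse c *\<^sub>R (c *\<^sub>R y)) \<le> inverse c * rk f (c *\<^sub>R y)"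
    using y by (intro rk_scale_le) (auto simp: scaleR_nonneg_nonneg)
  then have "c * rk f y \<le> rk f (c *\<^sub>R y)"
    using c by (simp add: field_simps)
  with rk_scale_le[OF y c] show ?thesis by (rule antisym)
qed

definition dual_pos :: "'a::banach_lattice dual \<Rightarrow> 'a dual" where
  "dual_pos f = Dual (Blinfun (\<lambda>y. rk f (pprt y) - rk f (- nprt y)))"

lemma rk_diff_eq:
  fixes y :: "'a::banach_lattice"
  assumes "0 \<le> u" "0 \<le> v" "y = u - v"
  shows "rk f (pprt y) - rk f (- nprt y) = rk f u - rk f v"
proof -
  have "u - v = pprt y + nprt y"
    using prts[of y] assms(3) by metis
  then have "pprt y + v = u + - nprt y"
    by (simp add: algebra_simps)
  then have "rk f (pprt y) + rk f v = rk f u + rk f (- nprt y)"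
    using assms(1,2) by (metis neg_0_le_iff_le nprt_le_zero rk_add zero_le_pprt)
  then show ?thesis by simp
qed

lemma pairing_dual_pos:
  fixes y :: "'a::banach_lattice"
  shows "pairing (dual_pos f) y = rk f (pprt y) - rk f (- nprt y)"
proof -
  let ?h = "\<lambda>y::'a. rk f (pprt y) - rk f (- nprt y)"
  have "bounded_linear ?h"
  proof (rule bounded_linear_intro)
    fix x y :: 'a and c :: real
    have "?h (x + y) = rk f (pprt x + pprt y) - rk f (- nprt x + - nprt y)"
    proof (rule rk_diff_eq)
      show "0 \<le> pprt x + pprt y" "0 \<le> - nprt x + - nprt y"
        by (rule add_nonneg_nonneg; simp)+
      have "pprt x + pprt y - (- nprt x + - nprt y) = (pprt x + nprt x) + (pprt y + nprt y)"
        by (simp add: algebra_simps)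
      then show "x + y = pprt x + pprt y - (- nprt x + - nprt y)"
        by (simp flip: prts)
    qed
    also have "\<dots> = ?h x + ?h y"
      by (subst (1 2) rk_add) simp_all
    finally show "?h (x + y) = ?h x + ?h y" .
    show "?h (c *\<^sub>R x) = c *\<^sub>R ?h x"
    proof (cases "0 \<le> c")
      case True
      have "?h (c *\<^sub>R x) = rk f (c *\<^sub>R pprt x) - rk f (c *\<^sub>R (- nprt x))"
        using True prts[of x]
        by (intro rk_diff_eq)
          (auto simp: scaleR_nonneg_nonneg simp flip: scaleR_right_diff_distrib
            simp del: scaleR_minus_right)
      then show ?thesis using True by (simp add: rk_scale right_diff_distrib del: scaleR_minus_right)
    next
      case False
      have "?h (c *\<^sub>R x) = rk f ((- c) *\<^sub>R (- nprt x)) - rk f ((- c) *\<^sub>R pprt x)"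
      proof (rule rk_diff_eq)
        show "0 \<le> (- c) *\<^sub>R (- nprt x)" "0 \<le> (- c) *\<^sub>R pprt x"
          using False by (intro scaleR_nonneg_nonneg; simp)+
        show "c *\<^sub>R x = (- c) *\<^sub>R (- nprt x) - (- c) *\<^sub>R pprt x"
          using prts[of x] by (metis add.commute diff_minus_eq_add scaleR_minus_left
              scaleR_minus_right scaleR_right_distrib add.inverse_inverse)
      qed
      also have "\<dots> = (- c) * rk f (- nprt x) - (- c) * rk f (pprt x)"
        using False by (subst (1 2) rk_scale) auto
      finally show ?thesis by (simp add: algebra_simps)
    qed
    have "0 \<le> rk f (pprt x)" "0 \<le> rk f (- nprt x)"
      by (simp_all add: rk_nonneg)
    moreover have "rk f (pprt x) \<le> norm f * norm (pprt x)" "rk f (- nprt x) \<le> norm f * norm (- nprt x)"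
      by (intro rk_le; simp)+
    moreover have "norm (pprt x) \<le> norm x" "norm (- nprt x) \<le> norm x"
      by (rule norm_mono_abs; simp add: abs_prts)+
    then have "norm f * norm (pprt x) \<le> norm f * norm x" "norm f * norm (- nprt x) \<le> norm f * norm x"
      by (intro mult_left_mono; simp)+
    ultimately show "norm (?h x) \<le> norm x * norm f"
      unfolding real_norm_def by (simp add: mult.commute[of "norm x"] abs_le_iff)
  qed
  then show ?thesis
    by (simp add: dual_pos_def pairing_def bounded_linear_Blinfun_apply)
qed

lemma pairing_dual_pos_nonneg: "0 \<le> y \<Longrightarrow> pairing (dual_pos f) y = rk f y"
  by (subst pairing_dual_pos, subst rk_diff_eq[of y 0]) (auto simp: rk_def)

lemma dual_lub:
  fixes f g :: "'a::banach_lattice dual"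
  defines "h \<equiv> g + dual_pos (f - g)"
  shows "f \<le> h" "g \<le> h" "f \<le> k \<Longrightarrow> g \<le> k \<Longrightarrow> h \<le> k"
proof -
  show "f \<le> h"
    unfolding less_eq_dual_def
  proof safe
    fix y :: 'a assume "0 \<le> y"
    then show "pairing f y \<le> pairing h y"
      using rk_upper[of y y "f - g"] by (simp add: h_def pairing_dual_pos_nonneg)
  qed
  show "g \<le> h"
    by (simp add: less_eq_dual_def h_def pairing_dual_pos_nonneg rk_nonneg)
  assume k: "f \<le> k" "g \<le> k"
  show "h \<le> k"
    unfolding less_eq_dual_def
  proof safe
    fix y :: 'a assume y: "0 \<le> y"
    have "rk (f - g) y \<le> pairing (k - g) y"
    proof (rule rk_least[OF y])
      fix u assume u: "u \<in> {0..y}"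
      have "pairing (f - g) u \<le> pairing (k - g) u"
        using k(1) u by (simp add: less_eq_dual_def)
      also have "\<dots> \<le> pairing (k - g) u + pairing (k - g) (y - u)"
        using k(2) u unfolding less_eq_dual_def by (simp del: pairing_linear_simps)
      finally show "pairing (f - g) u \<le> pairing (k - g) y" by simp
    qed
    then show "pairing h y \<le> pairing k y"
      using y by (simp add: h_def pairing_dual_pos_nonneg)
  qed
qed

lemma sup_dual_eq: "sup f g = g + dual_pos (f - g)" for f g :: "'a::banach_lattice dual"
  unfolding sup_dual_def
proof (rule the_equality)
  show "f \<le> g + dual_pos (f - g) \<and> g \<le> g + dual_pos (f - g) \<and>
      (\<forall>k. f \<le> k \<longrightarrow> g \<le> k \<longrightarrow> g + dual_pos (f - g) \<le> k)"
    using dual_lub[where f = f and g = g] by blast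
  show "h = g + dual_pos (f - g)"
    if "f \<le> h \<and> g \<le> h \<and> (\<forall>k. f \<le> k \<longrightarrow> g \<le> k \<longrightarrow> h \<le> k)" for h
    using that dual_lub[where f = f and g = g] by (intro antisym) blast+
qed

lemma inf_dual_eq: "inf f g = - sup (- f) (- g)" for f g :: "'a::banach_lattice dual"
proof -
  let ?s = "sup (- f) (- g)"
  have s: "- f \<le> ?s" "- g \<le> ?s" "\<And>k. - f \<le> k \<Longrightarrow> - g \<le> k \<Longrightarrow> ?s \<le> k"
    unfolding sup_dual_eq by (rule dual_lub; assumption?)+
  have "- ?s \<le> f" "- ?s \<le> g"
    using s(1,2) by (simp_all add: minus_le_iff)
  moreover have "k \<le> - ?s" if "k \<le> f" "k \<le> g" for k
    using s(3)[of "- k"] that by (simp add: le_minus_iff)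
  ultimately show ?thesis
    unfolding inf_dual_def by (intro the_equality) (auto intro: antisym)
qed

instance dual :: (banach_lattice) vector_lattice
proof
  fix f g h :: "'a dual"
  show "f \<le> sup f g" "g \<le> sup f g" "g \<le> f \<Longrightarrow> h \<le> f \<Longrightarrow> sup g h \<le> f"
    unfolding sup_dual_eq by (rule dual_lub; assumption?)+
  have *: "- f \<le> sup (- f) (- g)" "- g \<le> sup (- f) (- g)"
    "- g \<le> - f \<Longrightarrow> - h \<le> - f \<Longrightarrow> sup (- g) (- h) \<le> - f"
    unfolding sup_dual_eq by (rule dual_lub; assumption?)+
  show "inf f g \<le> f" "inf f g \<le> g" "f \<le> g \<Longrightarrow> f \<le> h \<Longrightarrow> f \<le> inf g h"
    using * by (simp_all add: inf_dual_eq minus_le_iff le_minus_iff)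
qed (rule abs_dual_def)

lemma pairing_abs_le:
  fixes f :: "'a::banach_lattice dual"
  shows "\<bar>pairing f y\<bar> \<le> pairing \<bar>f\<bar> \<bar>y\<bar>"
proof -
  have *: "\<bar>pairing f u\<bar> \<le> pairing \<bar>f\<bar> u" if "0 \<le> u" for u
  proof -
    have "f \<le> \<bar>f\<bar>" "- f \<le> \<bar>f\<bar>" by (rule abs_ge_self abs_ge_minus_self)+
    with that have "pairing f u \<le> pairing \<bar>f\<bar> u" "pairing (- f) u \<le> pairing \<bar>f\<bar> u"
      unfolding less_eq_dual_def by blast+
    then show ?thesis by simp
  qed
  have "\<bar>pairing f y\<bar> \<le> \<bar>pairing f (pprt y)\<bar> + \<bar>pairing f (- nprt y)\<bar>"
    unfolding pairing_pprt_nprt[of f y] by (rule abs_triangle_ineq4)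
  also have "\<dots> \<le> (pairing \<bar>f\<bar> (pprt y)) + (pairing \<bar>f\<bar> (- nprt y))"
    by (intro add_mono *) simp_all
  also have "\<dots> = pairing \<bar>f\<bar> \<bar>y\<bar>" by (simp add: abs_prts)
  finally show ?thesis .
qed

lemma pairing_abs_bound:
  fixes f :: "'a::banach_lattice dual"
  assumes y: "0 \<le> y"
  shows "pairing \<bar>f\<bar> y \<le> norm f * norm y"
proof -
  have "rk (f - (- f)) y \<le> pairing f y + norm f * norm y"
  proof (rule rk_least[OF y])
    fix u assume u: "u \<in> {0..y}"
    have "u + u - y \<le> y" "- (u + u - y) \<le> y"
      using u by (auto simp: algebra_simps add_mono)
    then have "\<bar>u + u - y\<bar> \<le> \<bar>y\<bar>" using y by (simp add: abs_leI)
    then have "norm f * norm (u + u - y) \<le> norm f * norm y"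
      by (intro mult_left_mono norm_mono_abs) auto
    with pairing_le_norm[of f "u + u - y"]
    have "pairing f (u + u - y) \<le> norm f * norm y" by linarith
    then show "pairing (f - (- f)) u \<le> pairing f y + norm f * norm y" by simp
  qed
  moreover have "pairing \<bar>f\<bar> y = - pairing f y + rk (f - (- f)) y"
    using y by (simp only: abs_dual_def sup_dual_eq pairing_simps pairing_dual_pos_nonneg)
  ultimately show ?thesis by linarith
qed

instance dual :: (banach_lattice) banach_lattice
proof
  fix f g :: "'a dual"
  assume le: "\<bar>f\<bar> \<le> \<bar>g\<bar>"
  show "norm f \<le> norm g"
  proof (rule norm_dual_le)
    fix y :: 'a
    have "\<bar>pairing f y\<bar> \<le> pairing \<bar>f\<bar> \<bar>y\<bar>" by (rule pairing_abs_le)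
    also have "\<dots> \<le> pairing \<bar>g\<bar> \<bar>y\<bar>" using le by (simp add: less_eq_dual_def)
    also have "\<dots> \<le> norm g * norm \<bar>y\<bar>" by (rule pairing_abs_bound) simp
    also have "norm \<bar>y\<bar> = norm y" by (intro antisym norm_mono_abs) simp_all
    finally show "\<bar>pairing f y\<bar> \<le> norm g * norm y" .
  qed simp
qed


section \<open>Extended-real-valued functionals\<close>

definition proper :: "('x \<Rightarrow> ereal) \<Rightarrow> bool" where
  "proper \<rho> \<longleftrightarrow> (\<exists>x. \<rho> x \<noteq> \<infinity>)"

text \<open>In \<open>ereal\<close>, \<open>0 * \<infinity> = 0\<close>, so the inequality is also correct at \<open>t = 0\<close> and \<open>t = 1\<close>.\<close>

definition convex_functional :: "('x::real_vector \<Rightarrow> ereal) \<Rightarrow> bool" where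
  "convex_functional \<rho> \<longleftrightarrow>
     (\<forall>x y. \<forall>t\<in>{0..1}. \<rho> (t *\<^sub>R x + (1 - t) *\<^sub>R y) \<le> ereal t * \<rho> x + ereal (1 - t) * \<rho> y)"

definition conjugate :: "('y::real_normed_vector dual \<Rightarrow> ereal) \<Rightarrow> 'y \<Rightarrow> ereal" where
  "conjugate \<rho> y = (SUP x. ereal (pairing x y) - \<rho> x)"

end

theory Submission
  imports Defs "HOL-Complex_Analysis.Great_Picard"
begin

text \<open>
  Fix a weak unit \<open>e\<close> of \<open>Y\<close> and put \<open>p x = \<langle>\<bar>x\<bar>, e\<rangle>\<close> on \<open>X = Y\<^sup>*\<close>. On norm bounded sets, \<open>p\<close>
  controls every seminorm \<open>\<langle>\<bar>x\<bar>, y\<rangle>\<close>. Bounded uo-convergent nets converge weak*, because order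
  continuity yields, for \<open>y \<ge> 0\<close> and \<open>\<epsilon> > 0\<close>, some \<open>g \<in> X\<close> with \<open>\<langle>(\<bar>f\<bar> - g)\<^sup>+, y\<rangle> \<le> \<epsilon>\<close> for all \<open>f\<close> in
  a ball; so the representation implies the net condition. Conversely, a bounded sequence with
  \<open>p (x\<^sub>n - x) \<le> 2\<^sup>-\<^sup>n\<close> is uo-convergent, so the sequence condition makes the bounded parts of the
  epigraph of \<open>\<rho>\<close> \<open>p\<close>-closed. On a ball of \<open>X\<close> the functions \<open>x \<mapsto> \<Sum>\<^sub>k \<langle>(x - a\<^sub>k)\<^sup>+, e\<rangle>\<close>, for a fine grid
  \<open>(a\<^sub>k)\<close> in \<open>[-g, g]\<close>, are uniformly convex with respect to \<open>p\<close>, hence bounded \<open>p\<close>-closed convex sets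
  have the finite intersection property, as if they were weak* compact. Together with a finite
  minimax theorem this drives the usual Krein--Smulian construction of a separating element of
  \<open>Y \<times> \<real>\<close>, without the Hahn--Banach and Alaoglu theorems.
\<close>


section \<open>Order continuous Banach lattices\<close>

text \<open>The sequence condition tests closedness along sequences only, so a metric is needed; the
  weak unit supplies it, since \<open>p\<close> is a norm that metrizes the absolute weak* topology
  on balls. But a bounded \<open>p\<close>-closed set is in general not weak* closed, and convexity
  has to bridge the gap. Uniform convexity reduces this to completeness: near-minimizers over
  shrinking convex sets are \<open>p\<close>-Cauchy, and balls are \<open>p\<close>-complete. The
  minimax step then needs separation in the plane only. The passage from a null sequence in
  \<open>Y\<close> x R to a single vector, usually the Hahn-Banach theorem in c_0, becomes a
  diagonal limit of finite convex weights, with levels dropping from 1/2 over 3/8 to 1/4. Order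
  completeness of \<open>Y\<close> or \<open>X\<close> is not presupposed, so limits of bounded
  increasing sequences stand in for suprema.\<close>

lemma norm_abs_eq [simp]: "norm \<bar>x\<bar> = norm x" for x :: "'a::banach_lattice"
  by (intro antisym norm_mono_abs) simp_all

lemma norm_mono_nonneg: "0 \<le> x \<Longrightarrow> x \<le> y \<Longrightarrow> norm x \<le> norm y" for x y :: "'a::banach_lattice"
  by (intro norm_mono_abs) simp

section \<open>Positive parts in a vector lattice\<close>

lemma pprt_eq_half_abs: "2 *\<^sub>R pprt x = x + \<bar>x\<bar>" for x :: "'a::vector_lattice"
proof -
  have "x + \<bar>x\<bar> = (pprt x + nprt x) + (pprt x - nprt x)"
    using prts[of x] abs_prts[of x] by simp
  then show ?thesis by (simp add: scaleR_2)
qed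

lemma pprt_le_abs: "pprt x \<le> \<bar>x\<bar>" for x :: "'a::vector_lattice"
  by (simp add: pprt_def abs_ge_self)

lemma le_pprt: "x \<le> pprt x" for x :: "'a::vector_lattice"
  by (simp add: pprt_def)

lemma pprt_least: "x \<le> y \<Longrightarrow> 0 \<le> y \<Longrightarrow> pprt x \<le> y" for x :: "'a::vector_lattice"
  by (simp add: pprt_def)

lemma pprt_diff_eq: "pprt (x - y) = x - inf x y" for x y :: "'a::vector_lattice"
proof -
  have "x - inf x y = x + sup (- x) (- y)" by (simp only: diff_inf_eq_sup)
  also have "\<dots> = sup 0 (x - y)" by (simp add: add_sup_distrib_left)
  finally show ?thesis by (simp only: pprt_def sup_commute)
qed

section \<open>The positive cone under norm limits\<close>

lemma nonneg_limit:
  fixes x :: "nat \<Rightarrow> 'a::banach_lattice"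
  assumes "x \<longlonglongrightarrow> l" "\<And>n. 0 \<le> x n"
  shows "0 \<le> l"
proof -
  have le: "norm (pprt (- l)) \<le> norm (x n - l)" for n
  proof -
    have "pprt (- l) \<le> pprt (x n - l)"
      using assms(2)[of n] by (intro pprt_mono) simp
    also have "\<dots> \<le> \<bar>x n - l\<bar>" by (rule pprt_le_abs)
    finally show ?thesis by (metis norm_abs_eq norm_mono_nonneg zero_le_pprt)
  qed
  have "(\<lambda>n. norm (x n - l)) \<longlonglongrightarrow> 0"
    using assms(1) by (simp add: LIM_zero_iff tendsto_norm_zero)
  then have "norm (pprt (- l)) \<le> 0"
    by (rule LIMSEQ_le_const) (use le in blast)
  then have "pprt (- l) = 0" by simp
  then have "- l \<le> 0" by (simp add: le_zero_iff_zero_pprt)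
  then show ?thesis by simp
qed

lemma le_limit:
  fixes x :: "nat \<Rightarrow> 'a::banach_lattice"
  assumes "x \<longlonglongrightarrow> l" "\<And>n. n \<ge> k \<Longrightarrow> a \<le> x n"
  shows "a \<le> l"
proof -
  have "(\<lambda>n. x (n + k) - a) \<longlonglongrightarrow> l - a"
    using LIMSEQ_ignore_initial_segment[OF assms(1)] by (intro tendsto_intros)
  then have "0 \<le> l - a" by (rule nonneg_limit) (simp add: assms(2))
  then show ?thesis by simp
qed

lemma limit_le:
  fixes x :: "nat \<Rightarrow> 'a::banach_lattice"
  assumes "x \<longlonglongrightarrow> l" "\<And>n. n \<ge> k \<Longrightarrow> x n \<le> a"
  shows "l \<le> a"
  using le_limit[OF tendsto_minus[OF assms(1)], of k "- a"] assms(2) by simp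

lemma archimedean:
  fixes x y :: "'a::banach_lattice"
  assumes "0 \<le> x" "\<And>n::nat. real n *\<^sub>R x \<le> y"
  shows "x = 0"
proof (rule ccontr)
  assume "x \<noteq> 0"
  then have pos: "norm x > 0" by simp
  obtain n :: nat where n: "norm y < real n * norm x"
    using reals_Archimedean3[OF pos] by blast
  have "norm (real n *\<^sub>R x) \<le> norm y"
    using assms by (intro norm_mono_nonneg) (auto simp: scaleR_nonneg_nonneg)
  with n show False by simp
qed

text \<open>The sequence is not known to have a supremum, so order continuity is applied to the
  differences \<open>u - x n\<close>, indexed by the upper bounds \<open>u\<close> together with
  \<open>n\<close>. They decrease to 0 by the Archimedean property: if \<open>z\<close> lies below
  all of them, then subtracting \<open>pprt z\<close> from an upper bound leaves an upper bound, and
  this can be repeated forever.\<close>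

lemma oc_incseq_convergent:
  fixes x :: "nat \<Rightarrow> 'a::banach_lattice"
  assumes oc: "order_continuous_norm TYPE('a)"
    and inc: "incseq x" and bd: "\<And>n. x n \<le> b"
  shows "convergent x"
proof -
  define A where "A = {u. \<forall>n. x n \<le> u} \<times> (UNIV :: nat set)"
  define r where "r = (\<lambda>(u::'a, n::nat) (v, m). v \<le> u \<and> n \<le> m)"
  define w where "w = (\<lambda>(u, n). u - x n)"
  have dir: "directed_by A r"
    unfolding directed_by_def
  proof (intro conjI ballI impI)
    show "A \<noteq> {}" using bd by (auto simp: A_def)
    show "r a a" for a by (auto simp: r_def split: prod.split)
    show "r a b \<Longrightarrow> r b c \<Longrightarrow> r a c" for a b c by (auto simp: r_def split: prod.splits)
    fix a b assume ab: "a \<in> A" "b \<in> A"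
    show "\<exists>c\<in>A. r a c \<and> r b c"
      using ab by (intro bexI[of _ "(inf (fst a) (fst b), max (snd a) (snd b))"])
        (auto simp: A_def r_def split: prod.splits)
  qed
  have dec: "decreases_to_zero A r w"
    unfolding decreases_to_zero_def
  proof (intro conjI ballI impI allI)
    show "w d \<le> w c" if "r c d" for c d
      using that incseqD[OF inc] by (auto simp: r_def w_def intro!: diff_mono split: prod.splits)
    show "0 \<le> w c" if "c \<in> A" for c
      using that by (auto simp: A_def w_def)
    fix z assume "\<forall>c\<in>A. z \<le> w c"
    then have z: "z \<le> u - x n" if "\<And>n. x n \<le> u" for u n
      using that by (auto simp: A_def w_def)
    have ub: "x m \<le> b - real k *\<^sub>R pprt z" for k m
    proof (induction k arbitrary: m)
      case 0
      then show ?case using bd by simp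
    next
      case (Suc k)
      have "pprt z \<le> (b - real k *\<^sub>R pprt z) - x m"
        using Suc by (intro pprt_least z) auto
      then show ?case by (simp add: algebra_simps)
    qed
    have "pprt z = 0"
      by (rule archimedean[of _ "b - x 0"]) (use ub[of 0] in \<open>auto simp: algebra_simps\<close>)
    then show "z \<le> 0" by (simp add: le_zero_iff_zero_pprt)
  qed
  have "order_converges A r w 0"
  proof (rule order_convergesI[OF dir dec])
    fix c assume c: "c \<in> A"
    then show "\<exists>a\<in>A. \<forall>b\<in>A. r a b \<longrightarrow> \<bar>w b - 0\<bar> \<le> w c"
      using dec by (intro bexI[of _ c]) (auto simp: decreases_to_zero_def)
  qed
  then have "Cauchy x"
    unfolding Cauchy_altdef
  proof (intro allI impI)
    fix e :: real assume "e > 0"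
    obtain a where a: "a \<in> A" "\<And>b. b \<in> A \<Longrightarrow> r a b \<Longrightarrow> norm (w b) < e"
      using order_continuous_normD[OF oc \<open>order_converges A r w 0\<close> \<open>e > 0\<close>] by blast
    obtain u M where uM: "a = (u, M)" by (cases a)
    have "dist (x m) (x n) < e" if "M \<le> m" "m < n" for m n
    proof -
      have "norm (x n - x m) \<le> norm (u - x m)"
        using a(1) uM that incseqD[OF inc, of m n]
        by (intro norm_mono_nonneg) (auto simp: A_def)
      also have "\<dots> < e"
        using a(2)[of "(u, m)"] a(1) uM that by (auto simp: A_def r_def w_def)
      finally show ?thesis by (simp add: dist_norm norm_minus_commute)
    qed
    then show "\<exists>M. \<forall>m\<ge>M. \<forall>n>m. dist (x m) (x n) < e" by blast
  qed
  then show ?thesis by (rule Cauchy_convergent)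
qed

lemma oc_decseq_convergent:
  fixes x :: "nat \<Rightarrow> 'a::banach_lattice"
  assumes "order_continuous_norm TYPE('a)" "decseq x" "\<And>n. b \<le> x n"
  shows "convergent x"
proof -
  have "convergent (\<lambda>n. - x n)"
    using assms by (intro oc_incseq_convergent[of _ "- b"]) (auto simp: incseq_def decseq_def)
  then show ?thesis by (simp add: convergent_minus_iff[of x])
qed

text \<open>The sequence decreases, so it has a norm limit \<open>w\<close>. Its \<open>n\<close>-th
  term is what \<open>inf y (n e)\<close> lacks to \<open>y\<close>, and it dominates
  \<open>h = inf w e\<close>; so \<open>h\<close> can be added once more at every step, and
  \<open>n h\<close> stays below \<open>y\<close>. Hence \<open>h = 0\<close>, and the weak unit
  gives \<open>w = 0\<close>.\<close>

lemma weak_unit_tail_tendsto_0: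
  fixes y :: "'a::banach_lattice"
  assumes oc: "order_continuous_norm TYPE('a)" and e: "weak_unit e" and y: "0 \<le> y"
  shows "(\<lambda>n. pprt (y - real n *\<^sub>R e)) \<longlonglongrightarrow> 0"
proof -
  let ?x = "\<lambda>n. pprt (y - real n *\<^sub>R e)"
  have e0: "0 \<le> e" using e by (simp add: weak_unit_def)
  have dec: "decseq ?x"
    using e0 by (auto simp: decseq_def intro!: pprt_mono scaleR_right_mono)
  then obtain w where w: "?x \<longlonglongrightarrow> w"
    using oc_decseq_convergent[OF oc dec, of 0] by (auto simp: convergent_def)
  have w0: "0 \<le> w" by (rule nonneg_limit[OF w]) simp
  have wle: "w \<le> ?x n" for n
    by (rule limit_le[OF w, of n]) (use dec in \<open>auto simp: decseq_def\<close>)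
  define h where "h = inf w e"
  have h0: "0 \<le> h" using w0 e0 by (simp add: h_def)
  have "real n *\<^sub>R h \<le> inf y (real n *\<^sub>R e)" for n
  proof (induction n)
    case 0
    then show ?case using y by simp
  next
    case (Suc n)
    have "h \<le> ?x n" using wle[of n] by (simp add: h_def le_infI1)
    moreover have "inf y (real n *\<^sub>R e) + ?x n = y"
      using pprt_diff_eq[of y "real n *\<^sub>R e"] by (metis add.commute diff_add_cancel)
    ultimately have 1: "inf y (real n *\<^sub>R e) + h \<le> y"
      by (metis add_left_mono)
    have "inf y (real n *\<^sub>R e) + h \<le> real n *\<^sub>R e + e"
      by (intro add_mono) (auto simp: h_def)
    then have 2: "inf y (real n *\<^sub>R e) + h \<le> real (Suc n) *\<^sub>R e"
      by (simp add: algebra_simps)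
    have "real (Suc n) *\<^sub>R h = real n *\<^sub>R h + h" by (simp add: algebra_simps)
    also have "\<dots> \<le> inf y (real n *\<^sub>R e) + h" using Suc by simp
    also have "\<dots> \<le> inf y (real (Suc n) *\<^sub>R e)" using 1 2 by simp
    finally show ?case .
  qed
  then have "h = 0"
    using h0 by (intro archimedean[of h y]) (auto)
  then have "w = 0"
    using e w0 by (simp add: weak_unit_def h_def)
  with w show ?thesis by simp
qed

section \<open>Monotonicity of the pairing in both arguments\<close>

lemma pairing_mono: "f \<le> g \<Longrightarrow> 0 \<le> y \<Longrightarrow> pairing f y \<le> pairing g y"
  for f g :: "'a::banach_lattice dual"
  by (simp add: less_eq_dual_def)

lemma pairing_nonneg: "0 \<le> f \<Longrightarrow> 0 \<le> y \<Longrightarrow> 0 \<le> pairing f y"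
  for f :: "'a::banach_lattice dual"
  using pairing_mono[of 0 f y] by simp

lemma pairing_mono_right: "0 \<le> f \<Longrightarrow> y \<le> z \<Longrightarrow> pairing f y \<le> pairing f z"
  for f :: "'a::banach_lattice dual"
  using pairing_nonneg[of f "z - y"] by simp

text \<open>\<open>y\<close> is at most \<open>n e\<close> plus a tail of norm below \<epsilon>, and
  \<open>n\<close> depends on \<open>y\<close> and \<epsilon> only, so one \<open>N\<close> serves
  all functionals.\<close>

lemma pairing_weak_unit_dominates:
  fixes y :: "'a::banach_lattice"
  assumes oc: "order_continuous_norm TYPE('a)" and e: "weak_unit e" and y: "0 \<le> y" and "\<epsilon> > 0"
  shows "\<exists>N. 0 < N \<and> (\<forall>f. pairing \<bar>f\<bar> y \<le> N * pairing \<bar>f\<bar> e + \<epsilon> * norm f)"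
proof -
  have "\<forall>\<^sub>F n in sequentially. norm (pprt (y - real n *\<^sub>R e)) < \<epsilon>"
    using weak_unit_tail_tendsto_0[OF oc e y] \<open>\<epsilon> > 0\<close> by (simp add: tendsto_iff)
  then obtain n0 where n0: "\<And>n. n \<ge> n0 \<Longrightarrow> norm (pprt (y - real n *\<^sub>R e)) < \<epsilon>"
    by (auto simp: eventually_sequentially)
  define n where "n = Suc n0"
  have n: "norm (pprt (y - real n *\<^sub>R e)) < \<epsilon>" using n0[of n] by (simp add: n_def del: of_nat_Suc)
  have "pairing \<bar>f\<bar> y \<le> real n * pairing \<bar>f\<bar> e + \<epsilon> * norm f" for f
  proof -
    have "y \<le> real n *\<^sub>R e + pprt (y - real n *\<^sub>R e)"
      using le_pprt[of "y - real n *\<^sub>R e"] by (simp add: algebra_simps)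
    then have "pairing \<bar>f\<bar> y \<le> pairing \<bar>f\<bar> (real n *\<^sub>R e + pprt (y - real n *\<^sub>R e))"
      by (intro pairing_mono_right) auto
    moreover have "pairing \<bar>f\<bar> (pprt (y - real n *\<^sub>R e)) \<le> norm f * norm (pprt (y - real n *\<^sub>R e))"
      by (intro pairing_abs_bound) simp
    moreover have "\<dots> \<le> norm f * \<epsilon>" using n by (intro mult_left_mono) auto
    ultimately show ?thesis by (simp add: mult.commute)
  qed
  then show ?thesis by (intro exI[of _ "real n"]) (auto simp: n_def)
qed

section \<open>Balls of the dual\<close>

lemma inf_add_le: "0 \<le> b \<Longrightarrow> inf (a + b) y \<le> inf a y + b" for a b y :: "'a::vector_lattice"
proof -
  assume b: "0 \<le> b"
  have "inf (a + b) y - b \<le> a" by (simp add: diff_le_eq le_infI1)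
  moreover have "inf (a + b) y - b \<le> y"
    using b by (simp add: diff_le_eq le_infI2 add_increasing2)
  ultimately show ?thesis by (simp flip: diff_le_eq)
qed

text \<open>The suprema of the tails of a sequence below \<open>y\<close> are avoided: truncated partial sums are
  just as good, since they increase and dominate each term.\<close>

lemma uniform_domination:
  fixes y :: "'a::banach_lattice"
  assumes oc: "order_continuous_norm TYPE('a)" and y: "0 \<le> y" and \<epsilon>: "\<epsilon> > 0"
  shows "\<exists>g\<ge>0. \<forall>f u. norm f \<le> R \<longrightarrow> 0 \<le> u \<longrightarrow> u \<le> y \<longrightarrow> pairing f u \<le> pairing g u + \<epsilon>"
proof (rule ccontr)
  assume "\<not> ?thesis"
  then have "\<forall>g. \<exists>f u. 0 \<le> g \<longrightarrow> norm f \<le> R \<and> 0 \<le> u \<and> u \<le> y \<and> pairing g u + \<epsilon> < pairing f u"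
    by (meson not_le)
  then obtain F U where FU: "\<And>g. 0 \<le> g \<Longrightarrow> norm (F g) \<le> R \<and> 0 \<le> U g \<and> U g \<le> y
      \<and> pairing g (U g) + \<epsilon> < pairing (F g) (U g)"
    by metis
  \<comment> \<open>Each new functional is chosen against \<open>2 ^ n\<close> times the sum of all
    earlier ones. So \<open>u n\<close> nearly annihilates the earlier functionals, with values at
    most \<open>M * (1/2) ^ n\<close>, while \<open>f n\<close> exceeds \<epsilon> there.\<close>
  define s where "s = rec_nat 0 (\<lambda>n s. s + \<bar>F ((2::real) ^ n *\<^sub>R s)\<bar>)"
  define f where "f n = \<bar>F ((2::real) ^ n *\<^sub>R s n)\<bar>" for n
  define u where "u n = U ((2::real) ^ n *\<^sub>R s n)" for n
  have s0: "s 0 = 0" and sS: "s (Suc n) = s n + f n" for n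
    by (simp_all add: s_def f_def)
  have f0: "0 \<le> f n" for n by (simp add: f_def)
  have sn: "0 \<le> s n" for n by (induction n) (simp_all add: s0 sS f0)
  have "incseq s" by (rule incseq_SucI) (simp add: sS f0)
  then have fs: "f i \<le> s n" if "i < n" for i n
  proof -
    have "f i \<le> s (Suc i)" using sn[of i] by (simp add: sS add_increasing)
    also have "\<dots> \<le> s n" using \<open>incseq s\<close> that by (simp add: incseqD)
    finally show ?thesis .
  qed
  have *: "norm (f n) \<le> R" "0 \<le> u n" "u n \<le> y"
    "2 ^ n * pairing (s n) (u n) + \<epsilon> < pairing (f n) (u n)" for n
  proof -
    have "0 \<le> (2::real) ^ n *\<^sub>R s n" using sn by (simp add: scaleR_nonneg_nonneg)
    note FU[OF this]
    moreover have "pairing (F ((2::real) ^ n *\<^sub>R s n)) (u n) \<le> pairing (f n) (u n)"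
      using calculation by (auto simp: f_def u_def intro!: pairing_mono abs_ge_self)
    ultimately show "norm (f n) \<le> R" "0 \<le> u n" "u n \<le> y"
      "2 ^ n * pairing (s n) (u n) + \<epsilon> < pairing (f n) (u n)"
      by (auto simp: f_def u_def)
  qed
  define M where "M = R * norm y"
  have fle: "pairing (f n) (u n) \<le> M" for n
  proof -
    have "pairing (f n) (u n) \<le> norm (f n) * norm (u n)"
      using pairing_le_norm[of "f n" "u n"] by simp
    also have "\<dots> \<le> R * norm y"
      using *[of n] order_trans[OF norm_ge_zero *(1)[of n]] by (intro mult_mono norm_mono_nonneg) auto
    finally show ?thesis by (simp add: M_def)
  qed
  have small: "pairing (f i) (u n) \<le> M * (1/2) ^ n" if "i < n" for i n
  proof -
    have "pairing (f i) (u n) \<le> pairing (s n) (u n)"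
      using fs that *(2) by (intro pairing_mono) auto
    moreover have "2 ^ n * pairing (s n) (u n) \<le> M"
      using *(4)[of n] fle[of n] \<epsilon> by linarith
    then have "pairing (s n) (u n) \<le> M * (1/2) ^ n"
      by (simp add: field_simps power_one_over)
    ultimately show ?thesis by linarith
  qed
  have M0: "0 \<le> M"
    using order_trans[OF norm_ge_zero *(1)[of 0]] by (simp add: M_def)
  define w where "w k m = inf (\<Sum>j=k..<k+m. u j) y" for k m
  have winc: "incseq (w k)" for k
    by (rule incseq_SucI) (auto simp: w_def *(2) intro!: le_infI1)
  have "convergent (w k)" for k
    by (rule oc_incseq_convergent[OF oc winc, of _ y]) (simp add: w_def)
  then obtain v where v: "\<And>k. w k \<longlonglongrightarrow> v k"
    unfolding convergent_def by metis
  have uv: "u k \<le> v k" for k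
    by (rule le_limit[OF v, of 1])
      (use incseqD[OF winc[of k], of 1] *(3)[of k] in \<open>auto simp: w_def inf_absorb1\<close>)
  have v0: "0 \<le> v k" for k using uv[of k] *(2)[of k] by (rule order_trans[rotated])
  have decv: "decseq v"
  proof (rule decseq_SucI)
    fix k
    have "w (Suc k) m \<le> w k (Suc m)" for m
      unfolding w_def by (intro inf_mono) (auto simp: *(2) sum.atLeast_Suc_lessThan[of k])
    moreover have "w k m \<le> v k" for m
      by (rule le_limit[OF v, of m]) (rule incseqD[OF winc])
    ultimately show "v (Suc k) \<le> v k"
      by (intro limit_le[OF v, of 0]) (blast intro: order_trans)
  qed
  obtain l where l: "v \<longlonglongrightarrow> l"
    using oc_decseq_convergent[OF oc decv v0] by (auto simp: convergent_def)
  have lv: "l \<le> v k" for k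
    by (rule limit_le[OF l, of k]) (rule decseqD[OF decv])
  have fv: "pairing (f i) (v k) \<le> 2 * M * (1/2) ^ k" if "i < k" for i k
  proof -
    have "pairing (f i) (w k m) \<le> 2 * M * (1/2) ^ k" for m
    proof -
      have "pairing (f i) (w k m) \<le> pairing (f i) (\<Sum>j=k..<k+m. u j)"
        using f0 by (intro pairing_mono_right) (auto simp: w_def)
      \<comment> \<open>The exact value of the geometric sum with \<open>m\<close> terms; the cruder
        bound without the subtracted term would not survive the induction.\<close>
      also have "\<dots> \<le> M * (1/2) ^ k * (2 - 2 * (1/2) ^ m)"
      proof (induction m)
        case (Suc m)
        have "pairing (f i) (u (k + m)) \<le> M * (1/2) ^ (k + m)"
          using that by (intro small) auto
        with Suc show ?case by (simp add: algebra_simps power_add)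
      qed simp
      also have "\<dots> \<le> M * (1/2) ^ k * 2"
        using M0 by (intro mult_left_mono) auto
      finally show ?thesis by (simp add: mult_ac)
    qed
    moreover have "(\<lambda>m. pairing (f i) (w k m)) \<longlonglongrightarrow> pairing (f i) (v k)"
      unfolding pairing_def by (intro tendsto_intros v)
    ultimately show ?thesis by (intro LIMSEQ_le_const2) auto
  qed
  have fl: "pairing (f i) l \<le> 0" for i
  proof (rule LIMSEQ_le_const)
    show "(\<lambda>k. 2 * M * (1/2) ^ k) \<longlonglongrightarrow> 0"
      by (intro tendsto_mult_right_zero LIMSEQ_power_zero) simp
    have "pairing (f i) l \<le> 2 * M * (1/2) ^ k" if "Suc i \<le> k" for k
      using order_trans[OF pairing_mono_right[OF f0 lv] fv[of i k]] that by simp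
    then show "\<exists>N. \<forall>k\<ge>N. pairing (f i) l \<le> 2 * M * (1/2) ^ k" by blast
  qed
  \<comment> \<open>Subtracting \<open>l\<close> does not lower the value of \<open>f k\<close>,
    since \<open>f k\<close> is nonpositive at \<open>l\<close>; yet it makes the vectors tend to 0
    in norm.\<close>
  have "\<epsilon> \<le> R * norm (v k - l)" for k
  proof -
    have "0 \<le> 2 ^ k * pairing (s k) (u k)" using sn *(2) by (simp add: pairing_nonneg)
    then have "\<epsilon> \<le> pairing (f k) (u k)" using *(4)[of k] by linarith
    also have "\<dots> \<le> pairing (f k) (v k)" by (intro pairing_mono_right f0 uv)
    also have "\<dots> \<le> pairing (f k) (v k - l)" using fl[of k] by simp
    also have "\<dots> \<le> norm (f k) * norm (v k - l)" using pairing_le_norm[of "f k" "v k - l"] by simp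
    also have "\<dots> \<le> R * norm (v k - l)" using *(1) by (intro mult_right_mono) auto
    finally show ?thesis .
  qed
  moreover have "(\<lambda>k. R * norm (v k - l)) \<longlonglongrightarrow> R * norm (l - l)"
    by (intro tendsto_intros l)
  ultimately have "\<epsilon> \<le> R * norm (l - l)" by (intro LIMSEQ_le_const) auto
  with \<epsilon> show False by simp
qed

text \<open>By the Riesz-Kantorovich formula, \<open>pairing (pprt h) y\<close> is the supremum of
  \<open>pairing h u\<close> over \<open>0 \<le> u \<le> y\<close>. So
  \<open>uniform_domination\<close>, applied to \<open>\<bar>f\<bar>\<close>, bounds the positive
  part.\<close>

lemma uniform_domination_pprt:
  fixes y :: "'a::banach_lattice"
  assumes "order_continuous_norm TYPE('a)" "0 \<le> y" "\<epsilon> > 0"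
  shows "\<exists>g\<ge>0. \<forall>f. norm f \<le> R \<longrightarrow> pairing (pprt (\<bar>f\<bar> - g)) y \<le> \<epsilon>"
proof -
  obtain g where g: "0 \<le> g"
    "\<And>f u. norm f \<le> R \<Longrightarrow> 0 \<le> u \<Longrightarrow> u \<le> y \<Longrightarrow> pairing f u \<le> pairing g u + \<epsilon>"
    using uniform_domination[OF assms] by blast
  have "pairing (pprt (\<bar>f\<bar> - g)) y \<le> \<epsilon>" if "norm f \<le> R" for f
  proof -
    have "pprt (\<bar>f\<bar> - g) = dual_pos (\<bar>f\<bar> - g)"
      by (simp add: pprt_def sup_dual_eq)
    moreover have "rk (\<bar>f\<bar> - g) y \<le> \<epsilon>"
      using g(2)[of "\<bar>f\<bar>"] that by (intro rk_least[OF assms(2)]) (auto simp: algebra_simps)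
    ultimately show ?thesis by (simp add: pairing_dual_pos_nonneg assms(2))
  qed
  with g(1) show ?thesis by blast
qed

text \<open>The map from \<open>u\<close> to \<open>u + u - e\<close> carries the interval from 0 to
  \<open>e\<close> onto the interval from \<open>- e\<close> to \<open>e\<close>, and so turns the
  Riesz-Kantorovich formula for \<open>\<bar>f\<bar>\<close> into a supremum over
  \<open>\<bar>u\<bar> \<le> e\<close>. A supremum of evaluations is lower semicontinuous under
  pointwise limits, which is what completeness requires.\<close>

lemma pairing_abs_least:
  fixes e :: "'a::banach_lattice"
  assumes e: "0 \<le> e" and le: "\<And>u. \<bar>u\<bar> \<le> e \<Longrightarrow> pairing f u \<le> c"
  shows "pairing \<bar>f\<bar> e \<le> c"
proof -
  have "rk (f - (- f)) e \<le> pairing f e + c"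
  proof (rule rk_least[OF e])
    fix u assume u: "u \<in> {0..e}"
    have "u + u - e \<le> e" "- (u + u - e) \<le> e"
      using u by (auto simp: algebra_simps add_mono)
    then have "pairing f (u + u - e) \<le> c" by (intro le abs_leI)
    then show "pairing (f - (- f)) u \<le> pairing f e + c" by simp
  qed
  moreover have "pairing \<bar>f\<bar> e = - pairing f e + rk (f - (- f)) e"
    using e by (simp only: abs_dual_def sup_dual_eq pairing_simps pairing_dual_pos_nonneg)
  ultimately show ?thesis by linarith
qed

lemma weak_star_tendsto:
  fixes e y :: "'a::banach_lattice"
  assumes oc: "order_continuous_norm TYPE('a)" and e: "weak_unit e"
    and bd: "\<And>n. norm (x n) \<le> R" and lim: "((\<lambda>n. pairing \<bar>x n - l\<bar> e) \<longlongrightarrow> 0) F"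
  shows "((\<lambda>n. pairing (x n) y) \<longlongrightarrow> pairing l y) F"
proof (rule tendstoI)
  fix \<epsilon> :: real assume \<epsilon>: "\<epsilon> > 0"
  define M where "M = R + norm l + 1"
  have "0 \<le> R" using bd[of undefined] norm_ge_zero order_trans by blast
  then have M: "0 < M" by (simp add: M_def add_nonneg_pos)
  have bd': "norm (x n - l) \<le> M" for n
    using norm_triangle_ineq4[of "x n" l] bd[of n] by (simp add: M_def)
  obtain N where N: "0 < N" "\<And>f. pairing \<bar>f\<bar> \<bar>y\<bar> \<le> N * pairing \<bar>f\<bar> e + \<epsilon> / (2 * M) * norm f"
    using pairing_weak_unit_dominates[OF oc e, of "\<bar>y\<bar>" "\<epsilon> / (2 * M)"] \<epsilon> M by auto
  have "\<forall>\<^sub>F n in F. pairing \<bar>x n - l\<bar> e < \<epsilon> / (2 * N)"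
    using order_tendstoD(2)[OF lim, of "\<epsilon> / (2 * N)"] \<epsilon> N(1) by simp
  then show "\<forall>\<^sub>F n in F. dist (pairing (x n) y) (pairing l y) < \<epsilon>"
  proof eventually_elim
    case (elim n)
    have "\<bar>pairing (x n - l) y\<bar> \<le> pairing \<bar>x n - l\<bar> \<bar>y\<bar>" by (rule pairing_abs_le)
    also have "\<dots> \<le> N * pairing \<bar>x n - l\<bar> e + \<epsilon> / (2 * M) * norm (x n - l)" by (rule N)
    also have "\<dots> < N * (\<epsilon> / (2 * N)) + \<epsilon> / (2 * M) * M"
      using elim N(1) bd'[of n] \<epsilon> M by (intro add_less_le_mono mult_strict_left_mono mult_left_mono) auto
    also have "\<dots> = \<epsilon>" using N(1) M by (simp add: field_simps)
    finally show ?case by (simp add: dist_real_def)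
  qed
qed

text \<open>The norm bound turns \<open>p\<close>-Cauchy into pointwise Cauchy on \<open>Y\<close>,
  and the pointwise limit is a functional in the same ball. It is also the \<open>p\<close>-limit by
  \<open>pairing_abs_least\<close>: for fixed \<open>u\<close> with
  \<open>\<bar>u\<bar> \<le> e\<close> the Cauchy estimate passes to the limit.\<close>

lemma dual_ball_complete:
  fixes e :: "'a::banach_lattice"
  assumes oc: "order_continuous_norm TYPE('a)" and e: "weak_unit e"
    and bd: "\<And>n. norm (x n) \<le> R"
    and cau: "\<And>\<epsilon>. \<epsilon> > 0 \<Longrightarrow> \<exists>N. \<forall>m\<ge>N. \<forall>n\<ge>N. pairing \<bar>x m - x n\<bar> e < \<epsilon>"
  obtains l where "norm l \<le> R" "(\<lambda>n. pairing \<bar>x n - l\<bar> e) \<longlonglongrightarrow> 0"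
proof -
  have e0: "0 \<le> e" using e by (simp add: weak_unit_def)
  have R: "0 \<le> R" using bd[of 0] norm_ge_zero order_trans by blast
  have "Cauchy (\<lambda>n. pairing (x n) y)" for y
    unfolding Cauchy_def
  proof (intro allI impI)
    fix \<epsilon> :: real assume \<epsilon>: "\<epsilon> > 0"
    define M where "M = 2 * R + 1"
    have M: "0 < M" using R by (simp add: M_def)
    have bd': "norm (x m - x n) \<le> M" for m n
      using norm_triangle_ineq4[of "x m" "x n"] bd[of n] bd[of m] by (simp add: M_def)
    obtain N where N: "0 < N" "\<And>f. pairing \<bar>f\<bar> \<bar>y\<bar> \<le> N * pairing \<bar>f\<bar> e + \<epsilon> / (2 * M) * norm f"
      using pairing_weak_unit_dominates[OF oc e, of "\<bar>y\<bar>" "\<epsilon> / (2 * M)"] \<epsilon> M by auto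
    obtain K where K: "\<And>m n. m \<ge> K \<Longrightarrow> n \<ge> K \<Longrightarrow> pairing \<bar>x m - x n\<bar> e < \<epsilon> / (2 * N)"
      using cau[of "\<epsilon> / (2 * N)"] \<epsilon> N(1) by auto
    have "dist (pairing (x m) y) (pairing (x n) y) < \<epsilon>" if "m \<ge> K" "n \<ge> K" for m n
    proof -
      have "\<bar>pairing (x m - x n) y\<bar> \<le> pairing \<bar>x m - x n\<bar> \<bar>y\<bar>" by (rule pairing_abs_le)
      also have "\<dots> \<le> N * pairing \<bar>x m - x n\<bar> e + \<epsilon> / (2 * M) * norm (x m - x n)" by (rule N)
      also have "\<dots> < N * (\<epsilon> / (2 * N)) + \<epsilon> / (2 * M) * M"
        using K[OF that] N(1) bd'[of m n] \<epsilon> M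
        by (intro add_less_le_mono mult_strict_left_mono mult_left_mono) auto
      also have "\<dots> = \<epsilon>" using N(1) M by (simp add: field_simps)
      finally show ?thesis by (simp add: dist_real_def)
    qed
    then show "\<exists>K. \<forall>m\<ge>K. \<forall>n\<ge>K. dist (pairing (x m) y) (pairing (x n) y) < \<epsilon>" by blast
  qed
  then obtain L where L: "\<And>y. (\<lambda>n. pairing (x n) y) \<longlonglongrightarrow> L y"
    unfolding Cauchy_convergent_iff convergent_def by metis
  have Lle: "\<bar>L y\<bar> \<le> R * norm y" for y
  proof (rule LIMSEQ_le_const2[OF tendsto_rabs[OF L]])
    have "\<bar>pairing (x n) y\<bar> \<le> R * norm y" for n
      using pairing_le_norm[of "x n" y] mult_right_mono[OF bd[of n] norm_ge_zero[of y]] by linarith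
    then show "\<exists>N. \<forall>n\<ge>N. \<bar>pairing (x n) y\<bar> \<le> R * norm y" by blast
  qed
  have "bounded_linear L"
  proof (rule bounded_linear_intro)
    show "L (y + z) = L y + L z" for y z
      using LIMSEQ_unique[OF L[of "y + z"]] tendsto_add[OF L[of y] L[of z]] by simp
    show "L (c *\<^sub>R y) = c *\<^sub>R L y" for c y
      using LIMSEQ_unique[OF L[of "c *\<^sub>R y"]] tendsto_mult_left[OF L[of y], of c] by simp
    show "norm (L y) \<le> norm y * R" for y using Lle[of y] by (simp add: mult.commute)
  qed
  define l where "l = Dual (Blinfun L)"
  have l: "pairing l y = L y" for y
    using \<open>bounded_linear L\<close> by (simp add: l_def pairing_def bounded_linear_Blinfun_apply)
  have "norm l \<le> R" using R Lle by (intro norm_dual_le) (auto simp: l)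
  moreover have "(\<lambda>n. pairing \<bar>x n - l\<bar> e) \<longlonglongrightarrow> 0"
  proof (rule LIMSEQ_I)
    fix \<epsilon> :: real assume \<epsilon>: "\<epsilon> > 0"
    obtain K where K: "\<And>m n. m \<ge> K \<Longrightarrow> n \<ge> K \<Longrightarrow> pairing \<bar>x m - x n\<bar> e < \<epsilon> / 2"
      using cau[of "\<epsilon> / 2"] \<epsilon> by auto
    have "pairing \<bar>x n - l\<bar> e \<le> \<epsilon> / 2" if "n \<ge> K" for n
    proof (rule pairing_abs_least[OF e0])
      fix u :: 'a assume u: "\<bar>u\<bar> \<le> e"
      have "(\<lambda>m. pairing (x n) u - pairing (x m) u) \<longlonglongrightarrow> pairing (x n) u - L u"
        by (intro tendsto_intros L)
      moreover have "pairing (x n) u - pairing (x m) u \<le> \<epsilon> / 2" if "m \<ge> K" for m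
      proof -
        have "\<bar>pairing (x n - x m) u\<bar> \<le> pairing \<bar>x n - x m\<bar> \<bar>u\<bar>" by (rule pairing_abs_le)
        also have "\<dots> \<le> pairing \<bar>x n - x m\<bar> e" using u by (intro pairing_mono_right) auto
        finally show ?thesis using K[OF \<open>n \<ge> K\<close> that] by simp
      qed
      ultimately have "pairing (x n) u - L u \<le> \<epsilon> / 2"
        by (elim LIMSEQ_le_const2) (intro exI[of _ K] allI impI)
      then show "pairing (x n - l) u \<le> \<epsilon> / 2" by (simp add: l)
    qed
    then show "\<exists>no. \<forall>n\<ge>no. norm (pairing \<bar>x n - l\<bar> e - 0) < \<epsilon>"
      using \<epsilon> e0 by (intro exI[of _ K]) (force simp: pairing_nonneg)
  qed
  ultimately show thesis using that by blast
qed

section \<open>Unbounded order convergence in the dual\<close>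

lemma weak_star_limit_le:
  fixes l :: "'a::banach_lattice dual"
  assumes "\<And>y. (\<lambda>n. pairing (x n) y) \<longlonglongrightarrow> pairing l y" "\<And>n. x n \<le> a"
  shows "l \<le> a"
  unfolding less_eq_dual_def
proof safe
  fix y :: 'a assume "0 \<le> y"
  then show "pairing l y \<le> pairing a y"
    using assms(2) by (intro LIMSEQ_le_const2[OF assms(1)]) (auto intro: pairing_mono)
qed

lemma le_weak_star_limit:
  fixes l :: "'a::banach_lattice dual"
  assumes "\<And>y. (\<lambda>n. pairing (x n) y) \<longlonglongrightarrow> pairing l y" "\<And>n. k \<le> n \<Longrightarrow> a \<le> x n"
  shows "a \<le> l"
  unfolding less_eq_dual_def
proof safe
  fix y :: 'a assume "0 \<le> y"
  then show "pairing a y \<le> pairing l y"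
    using assms(2) by (intro LIMSEQ_le_const[OF assms(1)] exI[of _ k]) (auto intro: pairing_mono)
qed

text \<open>The constant sequence \<open>f\<close> tends to 0 in \<open>p\<close>, hence weak*. So
  \<open>p\<close> is a norm and not merely a seminorm.\<close>

lemma pairing_weak_unit_eq_0:
  fixes e :: "'a::banach_lattice"
  assumes oc: "order_continuous_norm TYPE('a)" and e: "weak_unit e" and f: "0 \<le> f" "pairing f e \<le> 0"
  shows "f = 0"
proof (rule antisym)
  have "(\<lambda>n::nat. pairing f y) \<longlonglongrightarrow> pairing 0 y" for y
  proof (rule weak_star_tendsto[OF oc e])
    show "norm f \<le> norm f" ..
    have "pairing f e = 0" using f e by (intro antisym pairing_nonneg) (auto simp: weak_unit_def)
    then show "(\<lambda>n::nat. pairing \<bar>f - 0\<bar> e) \<longlonglongrightarrow> 0" using f by simp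
  qed
  then have "pairing f y = pairing 0 y" for y by (simp add: LIMSEQ_const_iff)
  then show "f \<le> 0" by (simp add: less_eq_dual_def)
qed (rule f)

text \<open>The natural dominating sequence would be the tail suprema of
  \<open>inf \<bar>x k - l\<bar> y\<close>. In their place stand the limits \<open>h n\<close> of
  partial sums truncated at \<open>y\<close>. Truncation keeps these sums in a fixed ball, where
  \<open>p\<close>-completeness provides the limit; summability gives
  \<open>pairing (h n) e \<le> 2 * (1/2) ^ n\<close>, which forces the infimum to be 0.\<close>

lemma uo_converges_of_summable:
  fixes e :: "'a::banach_lattice" and x :: "nat \<Rightarrow> 'a dual"
  assumes oc: "order_continuous_norm TYPE('a)" and e: "weak_unit e"
    and le: "\<And>n. pairing \<bar>x n - l\<bar> e \<le> (1/2) ^ n"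
  shows "uo_converges UNIV (\<le>) x l"
  unfolding uo_converges_def
proof (intro allI impI)
  fix y :: "'a dual" assume y: "0 \<le> y"
  have e0: "0 \<le> e" using e by (simp add: weak_unit_def)
  define b where "b k = \<bar>x k - l\<bar>" for k
  define w where "w n m = inf (\<Sum>k=n..<n+m. b k) y" for n m
  have b0: "0 \<le> b k" for k by (simp add: b_def)
  have w0: "0 \<le> w n m" for n m using y b0 by (simp add: w_def sum_nonneg)
  have wy: "w n m \<le> y" for n m by (simp add: w_def)
  have wnorm: "norm (w n m) \<le> norm y" for n m by (intro norm_mono_nonneg w0 wy)
  have winc: "incseq (w n)" for n
    by (rule incseq_SucI) (auto simp: w_def b0 intro!: le_infI1)
  have step: "w n (Suc m) \<le> w n m + b (n + m)" for n m
    using inf_add_le[OF b0, of "\<Sum>k=n..<n+m. b k" "n + m" y] by (simp add: w_def)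
  \<comment> \<open>The right-hand side is the sum of the \<open>j\<close> geometric terms from
    exponent \<open>n + m\<close> on; in this exact form the induction closes.\<close>
  have diff: "pairing (w n (m + j) - w n m) e \<le> (1/2) ^ (n + m) * (2 - 2 * (1/2) ^ j)" for n m j
  proof (induction j)
    case (Suc j)
    have "pairing (w n (Suc (m + j))) e \<le> pairing (w n (m + j) + b (n + (m + j))) e"
      using step e0 by (intro pairing_mono) auto
    also have "\<dots> \<le> pairing (w n (m + j)) e + (1/2) ^ (n + (m + j))"
      using le[of "n + (m + j)"] by (simp add: b_def)
    finally show ?case using Suc by (simp add: algebra_simps power_add)
  qed simp
  have diff2: "pairing (w n (m + j) - w n m) e \<le> 2 * (1/2) ^ (n + m)" for n m j
  proof -
    have "(1/2) ^ (n + m) * (2 - 2 * (1/2) ^ j) \<le> (1/2) ^ (n + m) * (2::real)"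
      by (intro mult_left_mono) auto
    from order_trans[OF diff this] show ?thesis by (simp only: mult.commute)
  qed
  have "\<exists>h. \<forall>v. (\<lambda>m. pairing (w n m) v) \<longlonglongrightarrow> pairing h v" for n
  proof -
    have abs_diff: "pairing \<bar>w n m' - w n m\<bar> e \<le> 2 * (1/2) ^ m" if "m \<le> m'" for m m'
    proof -
      have "\<bar>w n m' - w n m\<bar> = w n m' - w n m"
        using incseqD[OF winc that, of n] by (simp)
      then have "pairing \<bar>w n m' - w n m\<bar> e \<le> 2 * (1/2) ^ (n + m)"
        using diff2[of n m "m' - m"] that by simp
      also have "\<dots> \<le> 2 * (1/2) ^ m" by (simp add: power_add mult_left_le_one_le power_le_one)
      finally show ?thesis .
    qed
    have "\<exists>N. \<forall>m\<ge>N. \<forall>m'\<ge>N. pairing \<bar>w n m - w n m'\<bar> e < \<epsilon>" if "\<epsilon> > 0" for \<epsilon>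
    proof -
      obtain N where N: "2 * (1/2) ^ N < \<epsilon>"
        using real_arch_pow_inv[of "\<epsilon> / 2" "1/2"] \<open>\<epsilon> > 0\<close> by (auto simp: field_simps)
      have "pairing \<bar>w n m - w n m'\<bar> e < \<epsilon>" if "N \<le> m" "N \<le> m'" for m m'
      proof -
        have *: "2 * (1/2) ^ k < \<epsilon>" if "N \<le> k" for k
          by (rule le_less_trans[OF mult_left_mono[OF power_decreasing[OF that]] N]) simp_all
        show ?thesis
          using abs_diff[of m m'] abs_diff[of m' m] *[OF \<open>N \<le> m\<close>] *[OF \<open>N \<le> m'\<close>]
          by (cases "m \<le> m'") (auto simp: abs_minus_commute)
      qed
      then show ?thesis by blast
    qed
    then obtain h where h: "(\<lambda>m. pairing \<bar>w n m - h\<bar> e) \<longlonglongrightarrow> 0"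
      by (rule dual_ball_complete[OF oc e, of "w n" "norm y", OF wnorm])
    show ?thesis
      by (intro exI[of _ h] allI) (rule weak_star_tendsto[OF oc e wnorm h])
  qed
  then obtain h where h: "\<And>n v. (\<lambda>m. pairing (w n m) v) \<longlonglongrightarrow> pairing (h n) v"
    by metis
  have wh: "w n m \<le> h n" for n m
    by (rule le_weak_star_limit[OF h, of m]) (rule incseqD[OF winc])
  have hdec: "decseq h"
  proof (rule decseq_SucI)
    fix n
    have "w (Suc n) m \<le> w n (Suc m)" for m
      unfolding w_def by (intro inf_mono) (auto simp: b0 sum.atLeast_Suc_lessThan[of n])
    then show "h (Suc n) \<le> h n"
      using wh by (intro weak_star_limit_le[OF h]) (blast intro: order_trans)
  qed
  have h0: "0 \<le> h n" for n using wh[of n 0] w0[of n 0] by (rule order_trans[rotated])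
  have he: "pairing (h n) e \<le> 2 * (1/2) ^ n" for n
  proof (rule LIMSEQ_le_const2[OF h])
    have "pairing (w n m) e \<le> 2 * (1/2) ^ n" for m
      using diff2[of n 0 m] y by (simp add: w_def inf_absorb1)
    then show "\<exists>N. \<forall>m\<ge>N. pairing (w n m) e \<le> 2 * (1/2) ^ n" by blast
  qed
  have bh: "inf (b k) y \<le> h n" if "n \<le> k" for n k
  proof -
    have "b k \<le> (\<Sum>k=n..<n+Suc (k - n). b k)"
      using that sum_mono2[of "{n..<n+Suc (k - n)}" "{k}" b] by (simp add: b0)
    then have "inf (b k) y \<le> w n (Suc (k - n))"
      unfolding w_def by (intro inf_mono order_refl)
    with wh show ?thesis by (rule order_trans[rotated])
  qed
  show "order_converges UNIV (\<le>) (\<lambda>a. inf \<bar>x a - l\<bar> y) 0"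
  proof (rule order_convergesI)
    show "directed_by (UNIV :: nat set) (\<le>)"
      by (auto simp: directed_by_def intro: max.cobounded1 max.cobounded2)
    show "decreases_to_zero UNIV (\<le>) h"
      unfolding decreases_to_zero_def
    proof (intro conjI ballI allI impI)
      fix z assume z: "\<forall>c\<in>UNIV. z \<le> h c"
      have "pairing (pprt z) e \<le> 2 * (1/2) ^ n" for n
        using pairing_mono[OF pprt_least[OF _ h0] e0, of z n] z he[of n] by simp
      moreover have "(\<lambda>n. 2 * (1/2) ^ n :: real) \<longlonglongrightarrow> 0"
        by (intro tendsto_mult_right_zero LIMSEQ_power_zero) simp
      ultimately have "pairing (pprt z) e \<le> 0" by (intro LIMSEQ_le_const) blast+
      then have "pprt z = 0" by (intro pairing_weak_unit_eq_0[OF oc e]) simp_all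
      then show "z \<le> 0" by (simp add: le_zero_iff_zero_pprt)
    qed (use hdec h0 in \<open>auto simp: decseq_def\<close>)
    fix c :: nat
    have "\<bar>inf \<bar>x n - l\<bar> y - 0\<bar> \<le> h c" if "c \<le> n" for n
      using bh[OF that] y by (simp add: b_def)
    then show "\<exists>a\<in>UNIV. \<forall>n\<in>UNIV. a \<le> n \<longrightarrow> \<bar>inf \<bar>x n - l\<bar> y - 0\<bar> \<le> h c" by blast
  qed
qed

text \<open>The net may be uncountable, while limits are at hand for sequences only. A sequence of
  members with \<open>p\<close>-values near the infimum \<open>m\<close> is \<open>p\<close>-Cauchy,
  because two of them have a common lower member that loses little of either. Its limit
  \<open>z\<close> lies below every member \<open>w a\<close>: a sequence squeezed below both
  \<open>w a\<close> and \<open>w (c n)\<close> has the same limit. So \<open>z \<le> 0\<close>,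
  hence \<open>m \<le> 0\<close>, and domination by the weak unit carries this from \<open>e\<close>
  to \<open>y\<close>.\<close>

lemma decreases_to_zero_pairing:
  fixes w :: "'g \<Rightarrow> 'a::banach_lattice dual" and e y :: 'a
  assumes oc: "order_continuous_norm TYPE('a)" and e: "weak_unit e"
    and G: "directed_by G s" and w: "decreases_to_zero G s w" and y: "0 \<le> y" and \<epsilon>: "\<epsilon> > 0"
  shows "\<exists>c\<in>G. pairing (w c) y < \<epsilon>"
proof -
  have e0: "0 \<le> e" using e by (simp add: weak_unit_def)
  have w0: "0 \<le> w c" if "c \<in> G" for c
    using w that unfolding decreases_to_zero_def by blast
  have wm: "w d \<le> w c" if "c \<in> G" "d \<in> G" "s c d" for c d
    using w that unfolding decreases_to_zero_def by blast
  have dir: "\<exists>d\<in>G. w d \<le> w a \<and> w d \<le> w b" if "a \<in> G" "b \<in> G" for a b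
    proof -
    have "\<exists>d\<in>G. s a d \<and> s b d" using directed_byD(3)[OF G] that by simp
    then obtain d where d: "d \<in> G" "s a d" "s b d" by (elim bexE conjE)
    show ?thesis
      by (rule bexI[OF _ d(1)], rule conjI) (rule wm[OF that(1) d(1,2)], rule wm[OF that(2) d(1,3)])
  qed
  obtain c0 where c0: "c0 \<in> G" using directed_byD(1)[OF G] by blast
  define m where "m = (INF c\<in>G. pairing (w c) e)"
  have bdd: "bdd_below ((\<lambda>c. pairing (w c) e) ` G)"
    by (intro bdd_belowI2[of _ 0] pairing_nonneg w0 e0)
  have mle: "m \<le> pairing (w c) e" if "c \<in> G" for c
    unfolding m_def by (intro cINF_lower bdd that)
  \<comment> \<open>Staying below the fixed member \<open>w c0\<close> keeps the sequence in a
    ball.\<close>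
  have "\<exists>c\<in>G. w c \<le> w c0 \<and> pairing (w c) e < m + inverse (real (Suc n))" for n
  proof -
    obtain c where c: "c \<in> G" "pairing (w c) e < m + inverse (real (Suc n))"
    proof -
      have "(INF c\<in>G. pairing (w c) e) < m + inverse (real (Suc n))" by (simp add: m_def)
      then show thesis using cINF_less_iff[OF directed_byD(1)[OF G] bdd] that by blast
    qed
    obtain d where "d \<in> G" "w d \<le> w c" "w d \<le> w c0" using dir[OF c(1) c0] by blast
    moreover have "pairing (w d) e < m + inverse (real (Suc n))"
      using order_le_less_trans[OF pairing_mono[OF \<open>w d \<le> w c\<close> e0] c(2)] .
    ultimately show ?thesis by blast
  qed
  then have "\<forall>n. \<exists>c. c \<in> G \<and> w c \<le> w c0 \<and> pairing (w c) e < m + inverse (real (Suc n))"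
    by blast
  from choice[OF this] obtain c where c: "\<And>n. c n \<in> G" "\<And>n. w (c n) \<le> w c0"
      "\<And>n. pairing (w (c n)) e < m + inverse (real (Suc n))"
    by blast
  have cnorm: "norm (w d) \<le> norm (w c0)" if "d \<in> G" "w d \<le> w c0" for d
    by (rule norm_mono_nonneg[OF w0[OF that(1)] that(2)])
  have below: "pairing \<bar>w (c n) - w d\<bar> e \<le> inverse (real (Suc n))" if "d \<in> G" "w d \<le> w (c n)" for n d
  proof -
    have "\<bar>w (c n) - w d\<bar> = w (c n) - w d" using that(2) by (intro abs_of_nonneg) simp
    then have "pairing \<bar>w (c n) - w d\<bar> e = pairing (w (c n)) e - pairing (w d) e"
      by (simp only: pairing_simps)
    then show ?thesis using c(3)[of n] mle[OF that(1)] by linarith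
  qed
  have cau: "\<exists>N. \<forall>i\<ge>N. \<forall>j\<ge>N. pairing \<bar>w (c i) - w (c j)\<bar> e < \<epsilon>" if "\<epsilon> > 0" for \<epsilon>
  proof -
    obtain N where N: "inverse (real (Suc N)) < \<epsilon> / 2"
      using reals_Archimedean[of "\<epsilon> / 2"] \<open>\<epsilon> > 0\<close> by auto
    have "pairing \<bar>w (c i) - w (c j)\<bar> e < \<epsilon>" if ij: "N \<le> i" "N \<le> j" for i j
    proof -
      obtain d where d: "d \<in> G" "w d \<le> w (c i)" "w d \<le> w (c j)" using dir[OF c(1) c(1), of i j] by blast
      have "\<bar>w (c i) - w (c j)\<bar> \<le> \<bar>w (c i) - w d\<bar> + \<bar>w (c j) - w d\<bar>"
        using abs_triangle_ineq4[of "w (c i) - w d" "w (c j) - w d"] by simp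
      then have "pairing \<bar>w (c i) - w (c j)\<bar> e \<le> pairing (\<bar>w (c i) - w d\<bar> + \<bar>w (c j) - w d\<bar>) e"
        by (rule pairing_mono[OF _ e0])
      also have "\<dots> \<le> inverse (real (Suc i)) + inverse (real (Suc j))"
        using add_mono[OF below[OF d(1,2)] below[OF d(1,3)]] by (simp only: pairing_simps)
      also have "\<dots> \<le> inverse (real (Suc N)) + inverse (real (Suc N))"
        using ij by (intro add_mono le_imp_inverse_le) auto
      also have "\<dots> < \<epsilon>" using N by simp
      finally show ?thesis .
    qed
    then show ?thesis by blast
  qed
  obtain z where z: "(\<lambda>n. pairing \<bar>w (c n) - z\<bar> e) \<longlonglongrightarrow> 0"
    by (rule dual_ball_complete[OF oc e, of "\<lambda>n. w (c n)" "norm (w c0)"])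
      (rule cnorm[OF c(1,2)], erule cau)
  have "z \<le> w a" if a: "a \<in> G" for a
  proof -
    have "\<forall>n. \<exists>d. d \<in> G \<and> w d \<le> w a \<and> w d \<le> w (c n)" using dir[OF a c(1)] by blast
    from choice[OF this] obtain d where d: "\<And>n. d n \<in> G" "\<And>n. w (d n) \<le> w a" "\<And>n. w (d n) \<le> w (c n)"
      by blast
    have "(\<lambda>n. pairing \<bar>w (d n) - z\<bar> e) \<longlonglongrightarrow> 0"
    proof (rule tendsto_sandwich)
      show "\<forall>\<^sub>F n in sequentially. 0 \<le> pairing \<bar>w (d n) - z\<bar> e"
        using e0 by (simp add: pairing_nonneg)
      show "\<forall>\<^sub>F n in sequentially. pairing \<bar>w (d n) - z\<bar> e
          \<le> inverse (real (Suc n)) + pairing \<bar>w (c n) - z\<bar> e"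
      proof (rule always_eventually, rule allI)
        fix n
        have "\<bar>w (d n) - z\<bar> \<le> \<bar>w (c n) - w (d n)\<bar> + \<bar>w (c n) - z\<bar>"
          using abs_triangle_ineq4[of "w (c n) - z" "w (c n) - w (d n)"] by (simp add: add.commute)
        then have "pairing \<bar>w (d n) - z\<bar> e \<le> pairing (\<bar>w (c n) - w (d n)\<bar> + \<bar>w (c n) - z\<bar>) e"
          by (rule pairing_mono[OF _ e0])
        also have "\<dots> \<le> inverse (real (Suc n)) + pairing \<bar>w (c n) - z\<bar> e"
          using below[OF d(1,3), of n] by (simp del: of_nat_Suc)
        finally show "pairing \<bar>w (d n) - z\<bar> e \<le> inverse (real (Suc n)) + pairing \<bar>w (c n) - z\<bar> e" .
      qed
      show "(\<lambda>n. inverse (real (Suc n)) + pairing \<bar>w (c n) - z\<bar> e) \<longlonglongrightarrow> 0"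
        using tendsto_add[OF LIMSEQ_inverse_real_of_nat z] by simp
    qed simp
    then have "\<And>y. (\<lambda>n. pairing (w (d n)) y) \<longlonglongrightarrow> pairing z y"
      using cnorm[OF d(1) order_trans[OF d(3) c(2)]] by (intro weak_star_tendsto[OF oc e])
    then show ?thesis using d(2) by (rule weak_star_limit_le)
  qed
  then have "z \<le> 0" using w unfolding decreases_to_zero_def by blast
  then have "pairing z e \<le> 0" using pairing_mono[OF _ e0, of z 0] by simp
  moreover have "(\<lambda>n. pairing (w (c n)) e) \<longlonglongrightarrow> pairing z e"
    by (rule weak_star_tendsto[OF oc e _ z]) (rule cnorm[OF c(1,2)])
  then have "m \<le> pairing z e" by (rule LIMSEQ_le_const) (simp add: mle c(1))
  ultimately have m: "m \<le> 0" by linarith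
  define M where "M = norm (w c0) + 1"
  have M: "0 < M" by (simp add: M_def add_nonneg_pos)
  obtain N where N: "0 < N" "\<And>f. pairing \<bar>f\<bar> y \<le> N * pairing \<bar>f\<bar> e + \<epsilon> / (2 * M) * norm f"
    using pairing_weak_unit_dominates[OF oc e y, of "\<epsilon> / (2 * M)"] \<epsilon> M by auto
  obtain n where n: "inverse (real (Suc n)) < \<epsilon> / (2 * N)"
    using reals_Archimedean[of "\<epsilon> / (2 * N)"] \<epsilon> N(1) by auto
  have abs_c: "\<bar>w (c n)\<bar> = w (c n)" by (rule abs_of_nonneg[OF w0[OF c(1)]])
  have ce: "pairing (w (c n)) e < \<epsilon> / (2 * N)" using c(3)[of n] m n by linarith
  have cM: "norm (w (c n)) \<le> M" using cnorm[OF c(1,2), of n] unfolding M_def by linarith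
  have "pairing (w (c n)) y \<le> N * pairing (w (c n)) e + \<epsilon> / (2 * M) * norm (w (c n))"
    using N(2)[of "w (c n)"] by (simp only: abs_c)
  also have "\<dots> < N * (\<epsilon> / (2 * N)) + \<epsilon> / (2 * M) * M"
    using N(1) \<epsilon> M
    by (intro add_less_le_mono mult_strict_left_mono[OF ce] mult_left_mono[OF cM]) simp_all
  also have "\<dots> = \<epsilon>" using N(1) M by (simp add: field_simps)
  finally show ?thesis using c(1) by blast
qed

text \<open>With \<open>f = xs b - x\<close>, split \<open>\<bar>f\<bar>\<close> into
  \<open>inf \<bar>f\<bar> g\<close> and \<open>pprt (\<bar>f\<bar> - g)\<close>. Order convergence
  makes the first part small eventually; uniform domination makes the second small for all
  \<open>b\<close> at once.\<close>

lemma bounded_uo_converges_weak_star: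
  fixes xs :: "'i \<Rightarrow> 'a::banach_lattice dual" and e y :: 'a
  assumes oc: "order_continuous_norm TYPE('a)" and e: "weak_unit e"
    and bd: "bounded (xs ` A)" and uo: "uo_converges A r xs x" and \<epsilon>: "\<epsilon> > 0"
  shows "\<exists>a\<in>A. \<forall>b\<in>A. r a b \<longrightarrow> \<bar>pairing (xs b) y - pairing x y\<bar> < \<epsilon>"
proof -
  obtain B where B: "\<And>b. b \<in> A \<Longrightarrow> norm (xs b) \<le> B"
    using bd by (auto simp: bounded_iff)
  have bd': "norm (xs b - x) \<le> B + norm x" if "b \<in> A" for b
    using norm_triangle_ineq4[of "xs b" x] B[OF that] by simp
  obtain g where g: "0 \<le> g"
    "\<And>f. norm f \<le> B + norm x \<Longrightarrow> pairing (pprt (\<bar>f\<bar> - g)) \<bar>y\<bar> \<le> \<epsilon> / 2"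
    using uniform_domination_pprt[OF oc, of "\<bar>y\<bar>" "\<epsilon> / 2" "B + norm x"] \<epsilon> by auto
  obtain G :: "'a dual set" and s w where G: "directed_by G s" "decreases_to_zero G s w"
    and dom: "\<And>c. c \<in> G \<Longrightarrow> \<exists>a\<in>A. \<forall>b\<in>A. r a b \<longrightarrow> \<bar>inf \<bar>xs b - x\<bar> g - 0\<bar> \<le> w c"
  proof -
    have "order_converges A r (\<lambda>a. inf \<bar>xs a - x\<bar> g) 0" using uo g(1) by (simp add: uo_converges_def)
    then show thesis using that unfolding order_converges_def by (elim exE conjE) blast
  qed
  obtain c where c: "c \<in> G" "pairing (w c) \<bar>y\<bar> < \<epsilon> / 2"
    using decreases_to_zero_pairing[OF oc e G, of "\<bar>y\<bar>" "\<epsilon> / 2"] \<epsilon> by auto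
  obtain a where a: "a \<in> A" "\<And>b. b \<in> A \<Longrightarrow> r a b \<Longrightarrow> \<bar>inf \<bar>xs b - x\<bar> g - 0\<bar> \<le> w c"
    using dom[OF c(1)] by blast
  have "\<bar>pairing (xs b) y - pairing x y\<bar> < \<epsilon>" if b: "b \<in> A" "r a b" for b
  proof -
    let ?f = "xs b - x"
    have "inf \<bar>?f\<bar> g \<le> w c"
      using abs_ge_self[of "inf \<bar>?f\<bar> g"] a(2)[OF b] by simp
    then have "pairing (inf \<bar>?f\<bar> g) \<bar>y\<bar> \<le> pairing (w c) \<bar>y\<bar>" by (rule pairing_mono) simp
    moreover have "pairing (pprt (\<bar>?f\<bar> - g)) \<bar>y\<bar> \<le> \<epsilon> / 2" using bd'[OF b(1)] by (rule g(2))
    moreover have "pairing \<bar>?f\<bar> \<bar>y\<bar> = pairing (inf \<bar>?f\<bar> g) \<bar>y\<bar> + pairing (pprt (\<bar>?f\<bar> - g)) \<bar>y\<bar>"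
      by (simp only: pprt_diff_eq pairing_simps)
    moreover have "\<bar>pairing ?f y\<bar> \<le> pairing \<bar>?f\<bar> \<bar>y\<bar>" by (rule pairing_abs_le)
    ultimately show ?thesis using c(2) by simp
  qed
  with a(1) show ?thesis by blast
qed

section \<open>Uniform convexity and compactness\<close>

lemma abs_eq_pprt_add: "\<bar>x\<bar> = pprt x + pprt (- x)" for x :: "'a::vector_lattice"
  by (simp only: abs_prts pprt_neg diff_conv_add_uminus)

lemma inf_pprt_pprt_neg: "inf (pprt x) (pprt (- x)) = 0" for x :: "'a::vector_lattice"
proof -
  have "sup (pprt x) (pprt (- x)) = \<bar>x\<bar>"
  proof (rule antisym)
    show "sup (pprt x) (pprt (- x)) \<le> \<bar>x\<bar>"
      using pprt_le_abs[of x] pprt_le_abs[of "- x"] by (intro le_supI) (simp_all only: abs_minus_cancel)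
    show "\<bar>x\<bar> \<le> sup (pprt x) (pprt (- x))"
      by (intro abs_leI le_supI1[OF le_pprt] le_supI2[OF le_pprt])
  qed
  then show ?thesis using add_eq_inf_sup[of "pprt x" "pprt (- x)"] abs_eq_pprt_add[of x] by simp
qed

text \<open>For real numbers this says that some grid point is within \<open>h\<close> of
  \<open>m\<close>, up to the overshoot of \<open>m\<close> at the two ends. In a vector lattice no
  single grid point need be close, hence the formulation with a lower bound \<open>z\<close> of all
  the distances. In the inductive step the excess \<open>t\<close> is below both the positive and
  the negative part of \<open>s + h\<close>, which are disjoint.\<close>

lemma grid_approximation:
  fixes a h m z :: "'a::vector_lattice"
  assumes h: "0 \<le> h" and z: "\<And>k. k \<le> N \<Longrightarrow> z \<le> \<bar>m - (a + real k *\<^sub>R h)\<bar>"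
  shows "z \<le> pprt (m - (a + real N *\<^sub>R h)) + pprt (a - m) + h"
  using z
proof (induction N)
  case 0
  have "\<bar>m - a\<bar> = pprt (m - a) + pprt (a - m)"
    using abs_eq_pprt_add[of "m - a"] by (simp only: minus_diff_eq)
  then have "z \<le> pprt (m - a) + pprt (a - m)" using 0[of 0] by simp
  then show ?case using h by (simp add: add_increasing2)
next
  case (Suc N)
  define q where "q = pprt (a - m)"
  define s where "s = m - (a + real (Suc N) *\<^sub>R h)"
  define t where "t = z - pprt s - q - h"
  have q: "0 \<le> q" by (simp add: q_def)
  have sh: "m - (a + real N *\<^sub>R h) = s + h" by (simp add: s_def algebra_simps)
  have "z \<le> pprt (s + h) + q + h"
    using Suc.IH Suc.prems by (simp add: sh q_def)
  also have "\<dots> \<le> pprt (s + h) + pprt s + q + h" by simp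
  finally have t1: "t \<le> pprt (s + h)" by (simp add: t_def algebra_simps)
  have "z \<le> pprt s + pprt (- s)"
    using Suc.prems[of "Suc N"] unfolding s_def abs_eq_pprt_add[symmetric] by blast
  moreover have "pprt (- s) \<le> pprt (- (s + h)) + h"
    using h add_right_mono[OF le_pprt[of "- (s + h)"], of h]
    by (intro pprt_least add_nonneg_nonneg) simp_all
  ultimately have "z \<le> pprt s + (pprt (- (s + h)) + h)" by (meson add_left_mono order_trans)
  also have "\<dots> \<le> pprt s + (pprt (- (s + h)) + h) + q" using q by simp
  finally have t2: "t \<le> pprt (- (s + h))" by (simp add: t_def algebra_simps)
  from t1 t2 have "t \<le> 0" using inf_pprt_pprt_neg[of "s + h"] by (metis le_inf_iff)
  then show ?case unfolding q_def[symmetric] s_def[symmetric] by (simp add: t_def algebra_simps)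
qed

text \<open>Twice a positive part is the element plus its absolute value, so
  \<open>D + \<bar>m - a\<bar>\<close> equals \<open>pprt (u - a) + pprt (v - a) - (m - a)\<close>.
  This dominates both \<open>u - m\<close> and \<open>v - m\<close>, and the latter is
  \<open>- (u - m)\<close>.\<close>

lemma pprt_midpoint_deficit:
  fixes u v m a :: "'a::vector_lattice"
  assumes m: "m + m = u + v"
  defines "D \<equiv> pprt (u - a) + pprt (v - a) - 2 *\<^sub>R pprt (m - a)"
  shows "0 \<le> D" "\<bar>u - m\<bar> \<le> D + \<bar>m - a\<bar>"
proof -
  have eq: "D + \<bar>m - a\<bar> = pprt (u - a) + pprt (v - a) - (m - a)"
    by (simp add: D_def pprt_eq_half_abs)
  have "(m - a) + (m - a) = (u - a) + (v - a)" using m by (simp add: algebra_simps)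
  also have "\<dots> \<le> pprt (u - a) + pprt (v - a)" by (intro add_mono le_pprt)
  finally have le: "(m - a) + (m - a) \<le> pprt (u - a) + pprt (v - a)" .
  have "m - a = (1/2) *\<^sub>R ((m - a) + (m - a))" by (simp flip: scaleR_2)
  also have "\<dots> \<le> (1/2) *\<^sub>R (pprt (u - a) + pprt (v - a))" by (intro scaleR_left_mono le) simp
  finally have "pprt (m - a) \<le> (1/2) *\<^sub>R (pprt (u - a) + pprt (v - a))"
    by (rule pprt_least) (simp add: scaleR_nonneg_nonneg add_nonneg_nonneg)
  then have "2 *\<^sub>R pprt (m - a) \<le> 2 *\<^sub>R (1/2) *\<^sub>R (pprt (u - a) + pprt (v - a))"
    by (intro scaleR_left_mono) simp_all
  also have "\<dots> = pprt (u - a) + pprt (v - a)" by simp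
  finally show "0 \<le> D" by (simp add: D_def)
  show "\<bar>u - m\<bar> \<le> D + \<bar>m - a\<bar>"
    unfolding eq
  proof (rule abs_leI)
    have "u - a \<le> pprt (u - a) + pprt (v - a)"
      using le_pprt[of "u - a"] by (simp add: add_increasing2)
    then show "u - m \<le> pprt (u - a) + pprt (v - a) - (m - a)" by (simp add: algebra_simps)
    have "v - a \<le> pprt (u - a) + pprt (v - a)"
      using le_pprt[of "v - a"] by (simp add: add_increasing)
    moreover have "- (u - m) = v - m" using m by (simp add: algebra_simps)
    ultimately show "- (u - m) \<le> pprt (u - a) + pprt (v - a) - (m - a)" by (simp add: algebra_simps)
  qed
qed

text \<open>
  The midpoint deficit of \<open>x \<mapsto> (x - a)\<^sup>+\<close> at \<open>u, v\<close> is at least \<open>\<bar>u - v\<bar> / 2 - \<bar>m - a\<bar>\<close> with \<open>m\<close> the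
  midpoint, and some point of the grid is close to \<open>m\<close>.
\<close>

lemma dual_ball_uniformly_convex:
  fixes e :: "'a::banach_lattice"
  assumes oc: "order_continuous_norm TYPE('a)" and e0: "0 \<le> e" and \<epsilon>: "\<epsilon> > 0"
  shows "\<exists>\<phi> C. (\<forall>x::'a dual. norm x \<le> R \<longrightarrow> 0 \<le> \<phi> x \<and> \<phi> x \<le> C) \<and>
    (\<forall>u v. 2 * \<phi> ((1/2) *\<^sub>R (u + v)) \<le> \<phi> u + \<phi> v) \<and>
    (\<forall>u v. norm u \<le> R \<longrightarrow> norm v \<le> R \<longrightarrow>
      pairing \<bar>u - v\<bar> e \<le> 2 * (\<phi> u + \<phi> v - 2 * \<phi> ((1/2) *\<^sub>R (u + v))) + \<epsilon>)"
proof -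
  \<comment> \<open>The budget: two overshoots of at most \<epsilon>/8 and a mesh below \<epsilon>/4
    give \<epsilon>/2 for \<open>\<bar>u - m\<bar>\<close>, and \<open>u - v\<close> is twice
    \<open>u - m\<close>.\<close>
  obtain g :: "'a dual" where g: "0 \<le> g"
    "\<And>f. norm f \<le> R \<Longrightarrow> pairing (pprt (\<bar>f\<bar> - g)) e \<le> \<epsilon> / 8"
    using uniform_domination_pprt[OF oc e0, of "\<epsilon> / 8" R] \<epsilon> by auto
  obtain K :: nat where K: "K > 0" "pairing g e / real K < \<epsilon> / 4"
  proof -
    obtain K :: nat where "pairing g e / (\<epsilon> / 4) < real K" using reals_Archimedean2 by blast
    then have K: "pairing g e < real K * (\<epsilon> / 4)" using \<epsilon> by (simp add: field_simps)
    moreover have "K > 0" using K pairing_nonneg[OF g(1) e0] by (cases K) auto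
    ultimately show thesis using that[of K] by (simp add: field_simps)
  qed
  \<comment> \<open>The grid runs from \<open>- g\<close> to \<open>g\<close> in steps of
    \<open>g / K\<close>, hence \<open>2 * K\<close> of them.\<close>
  define N where "N = 2 * K"
  define h where "h = (1 / real K) *\<^sub>R g"
  have h0: "0 \<le> h" using g(1) by (simp add: h_def scaleR_nonneg_nonneg)
  define a where "a k = - g + real k *\<^sub>R h" for k
  have aN: "a N = g" using K(1) by (simp add: a_def N_def h_def scaleR_2)
  define \<phi> where "\<phi> x = (\<Sum>k\<le>N. pairing (pprt (x - a k)) e)" for x
  define C where "C = (\<Sum>k\<le>N. (R + norm (a k)) * norm e)"
  have 1: "0 \<le> \<phi> x" for x
    unfolding \<phi>_def by (intro sum_nonneg pairing_nonneg e0) simp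
  have 2: "\<phi> x \<le> C" if "norm x \<le> R" for x
    unfolding \<phi>_def C_def
  proof (rule sum_mono)
    fix k
    have "pairing (pprt (x - a k)) e \<le> pairing \<bar>x - a k\<bar> e"
      by (intro pairing_mono pprt_le_abs e0)
    also have "\<dots> \<le> norm (x - a k) * norm e" by (rule pairing_abs_bound[OF e0])
    also have "\<dots> \<le> (R + norm (a k)) * norm e"
      using norm_triangle_ineq4[of x "a k"] that by (intro mult_right_mono) auto
    finally show "pairing (pprt (x - a k)) e \<le> (R + norm (a k)) * norm e" .
  qed
  define D where "D u v k = pprt (u - a k) + pprt (v - a k) - 2 *\<^sub>R pprt ((1/2) *\<^sub>R (u + v) - a k)" for u v k
  have mid: "(1/2) *\<^sub>R (u + v) + (1/2) *\<^sub>R (u + v) = u + v" for u v :: "'a dual"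
    by (simp flip: scaleR_2)
  have D0: "0 \<le> D u v k" for u v k
    unfolding D_def by (rule pprt_midpoint_deficit(1)[OF mid])
  have def_eq: "\<phi> u + \<phi> v - 2 * \<phi> ((1/2) *\<^sub>R (u + v)) = pairing (\<Sum>k\<le>N. D u v k) e" for u v
  proof -
    have "pairing (\<Sum>k\<le>M. D u v k) e = (\<Sum>k\<le>M. pairing (D u v k) e)" for M
      by (induction M) simp_all
    then show ?thesis
      by (simp add: \<phi>_def D_def sum.distrib sum_subtractf sum_distrib_left)
  qed
  have 3: "2 * \<phi> ((1/2) *\<^sub>R (u + v)) \<le> \<phi> u + \<phi> v" for u v
  proof -
    have "0 \<le> pairing (\<Sum>k\<le>N. D u v k) e" by (intro pairing_nonneg sum_nonneg D0 e0)
    then show ?thesis unfolding def_eq[symmetric] by simp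
  qed
  have 4: "pairing \<bar>u - v\<bar> e \<le> 2 * (\<phi> u + \<phi> v - 2 * \<phi> ((1/2) *\<^sub>R (u + v))) + \<epsilon>"
    if uv: "norm u \<le> R" "norm v \<le> R" for u v
  proof -
    define m where "m = (1/2) *\<^sub>R (u + v)"
    have mm: "m + m = u + v" by (simp only: m_def mid)
    have mR: "norm m \<le> R" using norm_triangle_ineq[of u v] uv by (simp add: m_def)
    have "\<bar>u - m\<bar> \<le> (\<Sum>k\<le>N. D u v k) + \<bar>m - a k\<bar>" if "k \<le> N" for k
    proof -
      have "\<bar>u - m\<bar> \<le> D u v k + \<bar>m - a k\<bar>"
        using pprt_midpoint_deficit(2)[OF mm, of "a k"] by (simp add: D_def m_def)
      also have "\<dots> \<le> (\<Sum>k\<le>N. D u v k) + \<bar>m - a k\<bar>"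
        using that sum_mono2[of "{..N}" "{k}" "D u v"] D0 by (intro add_right_mono) simp
      finally show ?thesis .
    qed
    then have "\<bar>u - m\<bar> - (\<Sum>k\<le>N. D u v k) \<le> \<bar>m - (- g + real k *\<^sub>R h)\<bar>" if "k \<le> N" for k
      using that by (simp add: a_def algebra_simps)
    then have "\<bar>u - m\<bar> - (\<Sum>k\<le>N. D u v k) \<le> pprt (m - (- g + real N *\<^sub>R h)) + pprt (- g - m) + h"
      by (rule grid_approximation[OF h0])
    also have "\<dots> = pprt (m - g) + pprt (- g - m) + h" using aN by (simp add: a_def)
    also have "\<dots> \<le> pprt (\<bar>m\<bar> - g) + pprt (\<bar>m\<bar> - g) + h"
      using abs_ge_self[of m] abs_ge_minus_self[of m]
      by (intro add_mono pprt_mono order_refl) (auto simp: algebra_simps)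
    finally have "pairing (\<bar>u - m\<bar> - (\<Sum>k\<le>N. D u v k)) e \<le> pairing (pprt (\<bar>m\<bar> - g) + pprt (\<bar>m\<bar> - g) + h) e"
      by (rule pairing_mono[OF _ e0])
    moreover have "pairing h e < \<epsilon> / 4" using K by (simp add: h_def)
    ultimately have um: "pairing \<bar>u - m\<bar> e \<le> pairing (\<Sum>k\<le>N. D u v k) e + \<epsilon> / 2"
      using g(2)[OF mR] by simp
    have "u - v = (u - m) + (u - m)" using mm by (simp add: algebra_simps)
    then have "\<bar>u - v\<bar> \<le> \<bar>u - m\<bar> + \<bar>u - m\<bar>" by (simp only: abs_triangle_ineq)
    then have "pairing \<bar>u - v\<bar> e \<le> pairing (\<bar>u - m\<bar> + \<bar>u - m\<bar>) e" by (rule pairing_mono[OF _ e0])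
    then show ?thesis using um unfolding def_eq by simp
  qed
  show ?thesis using 1 2 3 4 by blast
qed

text \<open>Each single \<phi> leaves an additive error; a function with a genuine modulus comes
  from summing countably many whose errors tend to 0. All midpoint deficits are nonnegative, so a
  small deficit of the sum forces a small deficit of each term.\<close>

lemma uniformly_convex_sum:
  fixes S :: "'a::real_vector set" and d :: "'a \<Rightarrow> 'a \<Rightarrow> real"
  assumes mid: "\<And>u v. u \<in> S \<Longrightarrow> v \<in> S \<Longrightarrow> (1/2) *\<^sub>R (u + v) \<in> S"
    and uc: "\<And>\<epsilon>. \<epsilon> > 0 \<Longrightarrow> \<exists>\<phi> C. (\<forall>x\<in>S. 0 \<le> \<phi> x \<and> \<phi> x \<le> C) \<and>
      (\<forall>u\<in>S. \<forall>v\<in>S. 2 * \<phi> ((1/2) *\<^sub>R (u + v)) \<le> \<phi> u + \<phi> v) \<and>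
      (\<forall>u\<in>S. \<forall>v\<in>S. d u v \<le> 2 * (\<phi> u + \<phi> v - 2 * \<phi> ((1/2) *\<^sub>R (u + v))) + \<epsilon>)"
  obtains \<Phi> :: "'a \<Rightarrow> real" where "\<And>x. x \<in> S \<Longrightarrow> 0 \<le> \<Phi> x" "\<And>x. x \<in> S \<Longrightarrow> \<Phi> x \<le> 2"
    "\<And>\<epsilon>. \<epsilon> > 0 \<Longrightarrow> \<exists>\<delta>>0. \<forall>u\<in>S. \<forall>v\<in>S. \<Phi> u + \<Phi> v - 2 * \<Phi> ((1/2) *\<^sub>R (u + v)) < \<delta> \<longrightarrow> d u v < \<epsilon>"
proof -
  have "\<exists>\<phi> C. (\<forall>x\<in>S. 0 \<le> \<phi> x \<and> \<phi> x \<le> C) \<and>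
      (\<forall>u\<in>S. \<forall>v\<in>S. 2 * \<phi> ((1/2) *\<^sub>R (u + v)) \<le> \<phi> u + \<phi> v) \<and>
      (\<forall>u\<in>S. \<forall>v\<in>S. d u v \<le> 2 * (\<phi> u + \<phi> v - 2 * \<phi> ((1/2) *\<^sub>R (u + v))) + inverse (real (Suc n)))" for n
    by (rule uc) simp
  then obtain \<psi> C where \<psi>: "\<And>n x. x \<in> S \<Longrightarrow> 0 \<le> \<psi> n x" "\<And>n x. x \<in> S \<Longrightarrow> \<psi> n x \<le> C n"
    "\<And>n u v. u \<in> S \<Longrightarrow> v \<in> S \<Longrightarrow> 2 * \<psi> n ((1/2) *\<^sub>R (u + v)) \<le> \<psi> n u + \<psi> n v"
    "\<And>n u v. u \<in> S \<Longrightarrow> v \<in> S \<Longrightarrow>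
      d u v \<le> 2 * (\<psi> n u + \<psi> n v - 2 * \<psi> n ((1/2) *\<^sub>R (u + v))) + inverse (real (Suc n))"
    by metis
  \<comment> \<open>Dividing by the bound of \<open>\<psi> n\<close> makes the weighted term at most
    \<open>(1/2) ^ n\<close>; the added 1 keeps the denominator positive.\<close>
  define w where "w n = (1/2) ^ n / (\<bar>C n\<bar> + 1)" for n :: nat
  have w: "0 < w n" for n by (simp add: w_def add_nonneg_pos)
  have wle: "w n * \<psi> n x \<le> (1/2) ^ n" if "x \<in> S" for n x
  proof -
    have "\<psi> n x \<le> \<bar>C n\<bar> + 1" using \<psi>(2)[OF that, of n] by linarith
    then have "w n * \<psi> n x \<le> w n * (\<bar>C n\<bar> + 1)" using w[of n] by (intro mult_left_mono) auto
    also have "\<dots> = (1/2) ^ n" using abs_ge_zero[of "C n"] by (simp add: w_def)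
    finally show ?thesis .
  qed
  define \<Phi> where "\<Phi> x = (\<Sum>n. w n * \<psi> n x)" for x
  have geo: "(\<lambda>n. (1/2::real) ^ n) sums 2" using geometric_sums[of "1/2::real"] by simp
  have nn: "0 \<le> w n * \<psi> n x" if "x \<in> S" for n x using w[of n] \<psi>(1)[OF that, of n] by simp
  have summ: "summable (\<lambda>n. w n * \<psi> n x)" if "x \<in> S" for x
    by (rule summable_comparison_test'[OF sums_summable[OF geo], of 0]) (use nn wle that in auto)
  show thesis
  proof
    fix x assume x: "x \<in> S"
    show "0 \<le> \<Phi> x" unfolding \<Phi>_def by (intro suminf_nonneg summ nn x)
    have "\<Phi> x \<le> (\<Sum>n. (1/2) ^ n)"
      unfolding \<Phi>_def by (intro suminf_le summ x wle sums_summable[OF geo])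
    then show "\<Phi> x \<le> 2" using sums_unique[OF geo] by simp
  next
    fix \<epsilon> :: real assume \<epsilon>: "\<epsilon> > 0"
    obtain n where n: "inverse (real (Suc n)) < \<epsilon> / 2"
      using reals_Archimedean[of "\<epsilon> / 2"] \<epsilon> by auto
    show "\<exists>\<delta>>0. \<forall>u\<in>S. \<forall>v\<in>S. \<Phi> u + \<Phi> v - 2 * \<Phi> ((1/2) *\<^sub>R (u + v)) < \<delta> \<longrightarrow> d u v < \<epsilon>"
    proof (intro exI[of _ "w n * (\<epsilon> / 4)"] conjI ballI impI)
      show "0 < w n * (\<epsilon> / 4)" using w \<epsilon> by simp
      fix u v assume uv: "u \<in> S" "v \<in> S"
        and less: "\<Phi> u + \<Phi> v - 2 * \<Phi> ((1/2) *\<^sub>R (u + v)) < w n * (\<epsilon> / 4)"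
      define D where "D i = \<psi> i u + \<psi> i v - 2 * \<psi> i ((1/2) *\<^sub>R (u + v))" for i
      have "(\<lambda>i. w i * \<psi> i u + w i * \<psi> i v - 2 * (w i * \<psi> i ((1/2) *\<^sub>R (u + v))))
          sums (\<Phi> u + \<Phi> v - 2 * \<Phi> ((1/2) *\<^sub>R (u + v)))"
        unfolding \<Phi>_def by (intro sums_add sums_diff sums_mult summable_sums summ uv mid)
      then have D: "(\<lambda>i. w i * D i) sums (\<Phi> u + \<Phi> v - 2 * \<Phi> ((1/2) *\<^sub>R (u + v)))"
        by (simp add: D_def algebra_simps)
      have D0: "0 \<le> w i * D i" for i
        using w[of i] \<psi>(3)[OF uv, of i] by (simp add: D_def)
      have "w n * D n \<le> (\<Sum>i. w i * D i)"
        using sum_le_suminf[OF sums_summable[OF D], of "{n}"] D0 by simp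
      then have "w n * D n < w n * (\<epsilon> / 4)" using less sums_unique[OF D] by simp
      then have "D n < \<epsilon> / 4" using w[of n] by simp
      then show "d u v < \<epsilon>" using \<psi>(4)[OF uv, of n] n by (simp add: D_def)
    qed
  qed
qed

text \<open>
  Near-minimizers of a uniformly convex function over smaller and smaller finite intersections form
  a Cauchy sequence, and its limit lies in every member of the family.
\<close>

lemma uniformly_convex_fip:
  fixes S :: "'a::real_vector set" and d :: "'a \<Rightarrow> 'a \<Rightarrow> real"
  assumes d: "\<And>u v. d u v = d v u" "\<And>u v w. d u w \<le> d u v + d v w" "\<And>u v. 0 \<le> d u v"
    and complete: "\<And>x. (\<And>n. x n \<in> S) \<Longrightarrow> (\<And>\<epsilon>. \<epsilon> > 0 \<Longrightarrow> \<exists>N. \<forall>i\<ge>N. \<forall>j\<ge>N. d (x i) (x j) < \<epsilon>)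
      \<Longrightarrow> \<exists>l\<in>S. (\<lambda>n. d (x n) l) \<longlonglongrightarrow> 0"
    and mid: "\<And>u v. u \<in> S \<Longrightarrow> v \<in> S \<Longrightarrow> (1/2) *\<^sub>R (u + v) \<in> S"
    and uc: "\<And>\<epsilon>. \<epsilon> > 0 \<Longrightarrow> \<exists>\<phi> C. (\<forall>x\<in>S. 0 \<le> \<phi> x \<and> \<phi> x \<le> C) \<and>
      (\<forall>u\<in>S. \<forall>v\<in>S. 2 * \<phi> ((1/2) *\<^sub>R (u + v)) \<le> \<phi> u + \<phi> v) \<and>
      (\<forall>u\<in>S. \<forall>v\<in>S. d u v \<le> 2 * (\<phi> u + \<phi> v - 2 * \<phi> ((1/2) *\<^sub>R (u + v))) + \<epsilon>)"
    and Fmid: "\<And>F u v. F \<in> \<F> \<Longrightarrow> u \<in> F \<Longrightarrow> v \<in> F \<Longrightarrow> (1/2) *\<^sub>R (u + v) \<in> F"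
    and Fclosed: "\<And>F x l. F \<in> \<F> \<Longrightarrow> (\<And>n. x n \<in> S \<inter> F) \<Longrightarrow> l \<in> S \<Longrightarrow> (\<lambda>n. d (x n) l) \<longlonglongrightarrow> 0 \<Longrightarrow> l \<in> F"
    and fip: "\<And>H. finite H \<Longrightarrow> H \<subseteq> \<F> \<Longrightarrow> S \<inter> \<Inter>H \<noteq> {}"
  shows "S \<inter> \<Inter>\<F> \<noteq> {}"
proof -
  obtain \<Phi> :: "'a \<Rightarrow> real" where \<Phi>: "\<And>x. x \<in> S \<Longrightarrow> 0 \<le> \<Phi> x" "\<And>x. x \<in> S \<Longrightarrow> \<Phi> x \<le> 2"
    "\<And>\<epsilon>. \<epsilon> > 0 \<Longrightarrow> \<exists>\<delta>>0. \<forall>u\<in>S. \<forall>v\<in>S. \<Phi> u + \<Phi> v - 2 * \<Phi> ((1/2) *\<^sub>R (u + v)) < \<delta> \<longrightarrow> d u v < \<epsilon>"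
    using uniformly_convex_sum[OF mid uc] by blast
  define I where "I H = S \<inter> \<Inter>H" for H
  define \<H> where "\<H> = {H. finite H \<and> H \<subseteq> \<F>}"
  define val where "val H = (INF x\<in>I H. \<Phi> x)" for H
  define m where "m = (SUP H\<in>\<H>. val H)"
  have ne: "I H \<noteq> {}" if "H \<in> \<H>" for H using fip that by (simp add: \<H>_def I_def)
  have bdd: "bdd_below (\<Phi> ` I H)" for H
    using \<Phi>(1) by (intro bdd_belowI[of _ 0]) (auto simp: I_def)
  have val_le: "val H \<le> \<Phi> x" if "x \<in> I H" for H x
    unfolding val_def by (intro cINF_lower bdd that)
  have val2: "val H \<le> 2" if H: "H \<in> \<H>" for H
  proof -
    obtain x where "x \<in> I H" using ne[OF H] by blast
    with val_le[OF this] \<Phi>(2)[of x] show ?thesis by (simp add: I_def)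
  qed
  then have bdd2: "bdd_above (val ` \<H>)" by (intro bdd_aboveI[of _ 2]) auto
  have H0: "{} \<in> \<H>" by (simp add: \<H>_def)
  have val_m: "val H \<le> m" if "H \<in> \<H>" for H
    unfolding m_def by (intro cSUP_upper that bdd2)
  have val_mono: "val H \<le> val H'" if "H \<subseteq> H'" "H' \<in> \<H>" for H H'
    unfolding val_def by (rule cINF_superset_mono[OF ne[OF that(2)] bdd]) (use that in \<open>auto simp: I_def\<close>)
  have "\<exists>H\<in>\<H>. m - inverse (real (Suc n)) < val H" for n
    using less_cSUP_iff[OF _ bdd2, of "m - inverse (real (Suc n))"] H0 by (auto simp: m_def)
  then obtain H where H: "\<And>n. H n \<in> \<H>" "\<And>n. m - inverse (real (Suc n)) < val (H n)" by metis
  \<comment> \<open>These finite families bring the infimum of \<Phi> within 1/(n+1) of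
    \<open>m\<close>, so adjoining further members raises it by less than that.\<close>
  define G where "G n = (\<Union>i\<le>n. H i)" for n
  have G: "G n \<in> \<H>" for n using H(1) by (auto simp: \<H>_def G_def)
  have Gmono: "G n \<subseteq> G k" if "n \<le> k" for n k using that by (auto simp: G_def intro: order_trans)
  have Gval: "m - inverse (real (Suc n)) < val (G n)" for n
    using H(2)[of n] val_mono[OF _ G, of "H n" n] by (force simp: G_def)
  have near: "\<exists>x\<in>I J. \<Phi> x < m + inverse (real (Suc n))" if J: "J \<in> \<H>" for J n
  proof -
    have "val J < m + inverse (real (Suc n))" using val_m[OF J] by (rule order_le_less_trans) simp
    then show ?thesis using cINF_less_iff[OF ne[OF J] bdd] by (simp add: val_def)
  qed
  have Imid: "(1/2) *\<^sub>R (u + v) \<in> I J" if "J \<in> \<H>" "u \<in> I J" "v \<in> I J" for J u v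
    using that mid Fmid by (auto simp: I_def \<H>_def)
  have close: "\<exists>N. \<forall>n\<ge>N. \<forall>u\<in>I (G n). \<forall>v\<in>I (G n).
      \<Phi> u < m + inverse (real (Suc n)) \<longrightarrow> \<Phi> v < m + inverse (real (Suc n)) \<longrightarrow> d u v < \<epsilon>" if "\<epsilon> > 0" for \<epsilon>
  proof -
    obtain \<delta> where \<delta>: "\<delta> > 0"
      "\<And>u v. u \<in> S \<Longrightarrow> v \<in> S \<Longrightarrow> \<Phi> u + \<Phi> v - 2 * \<Phi> ((1/2) *\<^sub>R (u + v)) < \<delta> \<Longrightarrow> d u v < \<epsilon>"
      using \<Phi>(3)[OF \<open>\<epsilon> > 0\<close>] by blast
    obtain N where N: "inverse (real (Suc N)) < \<delta> / 4"
      using reals_Archimedean[of "\<delta> / 4"] \<delta>(1) by auto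
    have "d u v < \<epsilon>" if n: "n \<ge> N" and uv: "u \<in> I (G n)" "v \<in> I (G n)"
      and less: "\<Phi> u < m + inverse (real (Suc n))" "\<Phi> v < m + inverse (real (Suc n))" for n u v
    proof (rule \<delta>(2))
      show "u \<in> S" "v \<in> S" using uv by (auto simp: I_def)
      have "inverse (real (Suc n)) \<le> inverse (real (Suc N))" using n by (intro le_imp_inverse_le) auto
      \<comment> \<open>The midpoint lies in the same intersection, so \<Phi> exceeds
        \<open>m\<close> - 1/(n+1) there and the deficit is below 4/(n+1); hence the
        \<delta>/4.\<close>
      moreover have "m - inverse (real (Suc n)) < \<Phi> ((1/2) *\<^sub>R (u + v))"
        using Gval[of n] val_le[OF Imid[OF G uv]] by linarith
      ultimately show "\<Phi> u + \<Phi> v - 2 * \<Phi> ((1/2) *\<^sub>R (u + v)) < \<delta>"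
        using N less by argo
    qed
    then show ?thesis by blast
  qed
  have "\<forall>n. \<exists>x. x \<in> I (G n) \<and> \<Phi> x < m + inverse (real (Suc n))"
    using near[OF G] by blast
  from choice[OF this]
  obtain x where x: "\<And>n. x n \<in> I (G n)" "\<And>n. \<Phi> (x n) < m + inverse (real (Suc n))"
    by blast
  have less_mono: "\<Phi> u < m + inverse (real (Suc n))" if "\<Phi> u < m + inverse (real (Suc k))" "n \<le> k" for u n k
  proof -
    have "inverse (real (Suc k)) \<le> inverse (real (Suc n))" using that by (intro le_imp_inverse_le) auto
    with that show ?thesis by linarith
  qed
  have cau: "\<exists>N. \<forall>i\<ge>N. \<forall>j\<ge>N. d (x i) (x j) < \<epsilon>" if "\<epsilon> > 0" for \<epsilon>
  proof -
    obtain N where N: "\<And>u v. u \<in> I (G N) \<Longrightarrow> v \<in> I (G N) \<Longrightarrow> \<Phi> u < m + inverse (real (Suc N)) \<Longrightarrow>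
        \<Phi> v < m + inverse (real (Suc N)) \<Longrightarrow> d u v < \<epsilon>"
      using close[OF \<open>\<epsilon> > 0\<close>] by blast
    have "x i \<in> I (G N)" "\<Phi> (x i) < m + inverse (real (Suc N))" if "i \<ge> N" for i
      using x(1)[of i] Gmono[OF that] less_mono[OF x(2) that] by (auto simp: I_def)
    then show ?thesis using N by blast
  qed
  obtain l where l: "l \<in> S" "(\<lambda>n. d (x n) l) \<longlonglongrightarrow> 0"
    using complete[OF _ cau] x(1) by (auto simp: I_def)
  have "l \<in> F" if F: "F \<in> \<F>" for F
  proof -
    \<comment> \<open>The \<open>y n\<close> are near-minimizers inside \<open>F\<close>. Both they
      and the \<open>x n\<close> are near-minimizers over the same \<open>G n\<close>, so they share
      the limit \<open>l\<close>.\<close>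
    have J: "insert F (G n) \<in> \<H>" for n using F G[of n] by (simp add: \<H>_def)
    have "\<forall>n. \<exists>y. y \<in> I (insert F (G n)) \<and> \<Phi> y < m + inverse (real (Suc n))"
      using near[OF J] by blast
    from choice[OF this]
    obtain y where y: "\<And>n. y n \<in> I (insert F (G n))" "\<And>n. \<Phi> (y n) < m + inverse (real (Suc n))"
      by blast
    have yG: "y n \<in> I (G n)" for n using y(1)[of n] by (auto simp: I_def)
    have dxy: "(\<lambda>n. d (y n) (x n)) \<longlonglongrightarrow> 0"
    proof (rule LIMSEQ_I)
      fix \<epsilon> :: real assume "\<epsilon> > 0"
      then show "\<exists>N. \<forall>n\<ge>N. norm (d (y n) (x n) - 0) < \<epsilon>"
        using close[of \<epsilon>] x y(2) yG d(3) by simp blast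
    qed
    have "(\<lambda>n. d (y n) l) \<longlonglongrightarrow> 0"
    proof (rule tendsto_sandwich[OF _ _ tendsto_const])
      show "\<forall>\<^sub>F n in sequentially. 0 \<le> d (y n) l" using d(3) by simp
      show "\<forall>\<^sub>F n in sequentially. d (y n) l \<le> d (y n) (x n) + d (x n) l" using d(2) by simp
      show "(\<lambda>n. d (y n) (x n) + d (x n) l) \<longlonglongrightarrow> 0" using tendsto_add[OF dxy l(2)] by simp
    qed
    then show ?thesis using Fclosed[OF F _ l(1), of y] y(1) by (simp add: I_def)
  qed
  with l(1) show ?thesis by blast
qed

section \<open>Finite minimax for convex functions\<close>

lemma convex_pair_separation:
  fixes D :: "'a::real_vector set"
  assumes a: "convex_on D a" and b: "convex_on D b" and no: "\<And>c. c \<in> D \<Longrightarrow> \<not> (a c < 0 \<and> b c < 0)"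
  obtains s :: real where "0 \<le> s" "s \<le> 1" "\<And>c. c \<in> D \<Longrightarrow> 0 \<le> s * a c + (1 - s) * b c"
proof (cases "D = {}")
  case True
  then show thesis using that[of 0] by simp
next
  case False
  then obtain c0 where c0: "c0 \<in> D" by blast
  \<comment> \<open>\<open>P\<close> is the image of \<open>D\<close> under the pair of functions,
    closed upwards, which makes it convex. A line separates it from the open negative quadrant
    \<open>Q\<close>; upward closure makes both coordinates of the normal nonnegative, and scaling
    them to sum 1 yields the weight.\<close>
  define P where "P = {x :: real \<times> real. \<exists>c\<in>D. a c \<le> fst x \<and> b c \<le> snd x}"
  define Q where "Q = {(p::real, q::real). p < 0 \<and> q < 0}"
  have D: "convex D" using a by (rule convex_on_imp_convex)
  have cP: "convex P"
    unfolding convex_def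
  proof (intro ballI allI impI)
    fix x y and u v :: real assume xy: "x \<in> P" "y \<in> P" and uv: "0 \<le> u" "0 \<le> v" "u + v = 1"
    obtain c c' where c: "c \<in> D" "a c \<le> fst x" "b c \<le> snd x" "c' \<in> D" "a c' \<le> fst y" "b c' \<le> snd y"
      using xy by (auto simp: P_def)
    have "u *\<^sub>R c + v *\<^sub>R c' \<in> D" using D c uv by (auto simp: convex_def)
    moreover have "a (u *\<^sub>R c + v *\<^sub>R c') \<le> u * fst x + v * fst y"
    proof -
      have "a (u *\<^sub>R c + v *\<^sub>R c') \<le> u * a c + v * a c'" using a c uv by (auto simp: convex_on_def)
      also have "\<dots> \<le> u * fst x + v * fst y" using c uv by (intro add_mono mult_left_mono) auto
      finally show ?thesis .
    qed
    moreover have "b (u *\<^sub>R c + v *\<^sub>R c') \<le> u * snd x + v * snd y"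
    proof -
      have "b (u *\<^sub>R c + v *\<^sub>R c') \<le> u * b c + v * b c'" using b c uv by (auto simp: convex_on_def)
      also have "\<dots> \<le> u * snd x + v * snd y" using c uv by (intro add_mono mult_left_mono) auto
      finally show ?thesis .
    qed
    ultimately show "u *\<^sub>R x + v *\<^sub>R y \<in> P" by (auto simp: P_def)
  qed
  have cQ: "convex Q"
  proof -
    have "Q = {..<0} \<times> {..<0}" by (auto simp: Q_def)
    then show ?thesis by (simp add: convex_Times)
  qed
  have Pne: "P \<noteq> {}" using c0 by (auto simp: P_def)
  have "(-1, -1) \<in> Q" by (simp add: Q_def)
  then have Qne: "Q \<noteq> {}" by blast
  have "Q \<inter> P = {}" using no by (fastforce simp: P_def Q_def)
  from separating_hyperplane_sets[OF cQ cP Qne Pne this] obtain n \<beta> where n: "n \<noteq> 0" "\<And>x. x \<in> Q \<Longrightarrow> inner n x \<le> \<beta>" "\<And>x. x \<in> P \<Longrightarrow> \<beta> \<le> inner n x"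
    by blast
  obtain s t where st: "n = (s, t)" by (cases n)
  have Q: "s * p + t * q \<le> \<beta>" if "p < 0" "q < 0" for p q
    using n(2)[of "(p, q)"] that by (simp add: Q_def st)
  have P: "\<beta> \<le> s * p + t * q" if "c \<in> D" "a c \<le> p" "b c \<le> q" for c p q
    using n(3)[of "(p, q)"] that by (auto simp: P_def st)
  have lim: "(\<lambda>k. s * (- inverse (real (Suc k))) + t * (- inverse (real (Suc k)))) \<longlonglongrightarrow> s * - 0 + t * - 0"
    by (intro tendsto_intros LIMSEQ_inverse_real_of_nat)
  have \<beta>: "0 \<le> \<beta>"
  proof -
    have "s * (- inverse (real (Suc k))) + t * (- inverse (real (Suc k))) \<le> \<beta>" for k
      by (rule Q) simp_all
    then have "s * - 0 + t * - 0 \<le> \<beta>" by (intro LIMSEQ_le_const2[OF lim]) blast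
    then show ?thesis by simp
  qed
  have "0 \<le> s"
  proof (rule ccontr)
    assume s: "\<not> 0 \<le> s"
    define p where "p = max (a c0) ((\<beta> - 1 - t * b c0) / s)"
    have "s * p \<le> s * ((\<beta> - 1 - t * b c0) / s)" using s by (intro mult_left_mono_neg) (auto simp: p_def)
    then have "s * p \<le> \<beta> - 1 - t * b c0" using s by simp
    moreover have "\<beta> \<le> s * p + t * b c0" by (rule P[OF c0]) (simp_all add: p_def)
    ultimately show False by linarith
  qed
  moreover have "0 \<le> t"
  proof (rule ccontr)
    assume t: "\<not> 0 \<le> t"
    define q where "q = max (b c0) ((\<beta> - 1 - s * a c0) / t)"
    have "t * q \<le> t * ((\<beta> - 1 - s * a c0) / t)" using t by (intro mult_left_mono_neg) (auto simp: q_def)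
    then have "t * q \<le> \<beta> - 1 - s * a c0" using t by simp
    moreover have "\<beta> \<le> s * a c0 + t * q" by (rule P[OF c0]) (simp_all add: q_def)
    ultimately show False by linarith
  qed
  moreover have "s \<noteq> 0 \<or> t \<noteq> 0" using n(1) by (auto simp: st zero_prod_def)
  ultimately have pos: "0 < s + t" and st0: "0 \<le> s" "0 \<le> t" by linarith+
  show thesis
  proof
    show "0 \<le> s / (s + t)" "s / (s + t) \<le> 1" using pos st0 by simp_all
    fix c assume "c \<in> D"
    then have "0 \<le> s * a c + t * b c" using P[of c "a c" "b c"] \<beta> by simp
    then have "0 \<le> (s * a c + t * b c) / (s + t)" using pos by simp
    also have "\<dots> = s / (s + t) * a c + (1 - s / (s + t)) * b c"
    proof -
      have "1 - s / (s + t) = t / (s + t)" using pos by (simp add: field_simps)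
      then show ?thesis by (simp only: add_divide_distrib times_divide_eq_left)
    qed
    finally show "0 \<le> s / (s + t) * a c + (1 - s / (s + t)) * b c" .
  qed
qed

lemma convex_Collect_less:
  fixes a :: "'a::real_vector \<Rightarrow> real"
  assumes "convex_on D a"
  shows "convex {c \<in> D. a c < r}"
  unfolding convex_def
proof (intro ballI allI impI)
  fix x y and u v :: real
  assume xy: "x \<in> {c \<in> D. a c < r}" "y \<in> {c \<in> D. a c < r}" and uv: "0 \<le> u" "0 \<le> v" "u + v = 1"
  have "a (u *\<^sub>R x + v *\<^sub>R y) \<le> u * a x + v * a y" using assms xy uv by (auto simp: convex_on_def)
  also have "\<dots> < r" using xy uv by (intro convex_bound_lt) auto
  finally show "u *\<^sub>R x + v *\<^sub>R y \<in> {c \<in> D. a c < r}"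
    using convex_on_imp_convex[OF assms] xy uv by (auto simp: convex_def)
qed

lemma convex_on_sum_fun:
  assumes "finite I" "convex D" "\<And>i. i \<in> I \<Longrightarrow> convex_on D (f i)"
  shows "convex_on D (\<lambda>c. \<Sum>i\<in>I. f i c)"
  using assms by (induction I rule: finite_induct) (simp_all add: convex_on_add convex_on_const)

text \<open>By induction: where \<open>a j\<close> is negative, some other function is nonnegative,
  so the others have weights there. Their mixture and \<open>a j\<close> are then nowhere in
  \<open>D\<close> negative together, and the case of two functions merges them. The sublevel set of
  \<open>a j\<close> is why \<open>D\<close> has to vary.\<close>

lemma finite_minimax:
  fixes D :: "'a::real_vector set" and a :: "'i \<Rightarrow> 'a \<Rightarrow> real"
  assumes "finite I" "I \<noteq> {}" "\<And>i. i \<in> I \<Longrightarrow> convex_on D (a i)"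
    and "\<And>c. c \<in> D \<Longrightarrow> \<exists>i\<in>I. 0 \<le> a i c"
  shows "\<exists>t. (\<forall>i\<in>I. 0 \<le> t i) \<and> sum t I = 1 \<and> (\<forall>c\<in>D. 0 \<le> (\<Sum>i\<in>I. t i * a i c))"
  using assms
proof (induction I arbitrary: D rule: finite_ne_induct)
  case (singleton i)
  then show ?case by (intro exI[of _ "\<lambda>_. 1"]) auto
next
  case (insert j I)
  let ?D = "{c \<in> D. a j c < 0}"
  have cj: "convex_on D (a j)" and ci: "\<And>i. i \<in> I \<Longrightarrow> convex_on D (a i)" using insert.prems(1) by simp_all
  have "\<exists>t. (\<forall>i\<in>I. 0 \<le> t i) \<and> sum t I = 1 \<and> (\<forall>c\<in>?D. 0 \<le> (\<Sum>i\<in>I. t i * a i c))"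
  proof (rule insert.IH)
    show "convex_on ?D (a i)" if "i \<in> I" for i
      by (rule convex_on_subset[OF ci[OF that] _ convex_Collect_less[OF cj]]) auto
    show "\<exists>i\<in>I. 0 \<le> a i c" if "c \<in> ?D" for c
    proof -
      have "c \<in> D" "\<not> 0 \<le> a j c" using that by simp_all
      then show ?thesis using insert.prems(2)[OF \<open>c \<in> D\<close>] by blast
    qed
  qed
  then obtain t where t: "\<And>i. i \<in> I \<Longrightarrow> 0 \<le> t i" "sum t I = 1"
    "\<And>c. c \<in> ?D \<Longrightarrow> 0 \<le> (\<Sum>i\<in>I. t i * a i c)" by blast
  have cs: "convex_on D (\<lambda>c. \<Sum>i\<in>I. t i * a i c)"
    by (rule convex_on_sum_fun[OF insert.hyps(1) convex_on_imp_convex[OF cj]]) (intro convex_on_cmul t(1) ci)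
  have "\<not> (a j c < 0 \<and> (\<Sum>i\<in>I. t i * a i c) < 0)" if "c \<in> D" for c
  proof
    assume neg: "a j c < 0 \<and> (\<Sum>i\<in>I. t i * a i c) < 0"
    with that have "c \<in> ?D" by simp
    from t(3)[OF this] neg show False by linarith
  qed
  from convex_pair_separation[OF cj cs this]
  obtain s where s: "0 \<le> s" "s \<le> 1" "\<And>c. c \<in> D \<Longrightarrow> 0 \<le> s * a j c + (1 - s) * (\<Sum>i\<in>I. t i * a i c)"
    by blast
  define t' where "t' i = (if i = j then s else (1 - s) * t i)" for i
  have eq: "(\<Sum>i\<in>insert j I. t' i * f i) = s * f j + (1 - s) * (\<Sum>i\<in>I. t i * f i)" for f :: "'i \<Rightarrow> real"
  proof -
    have "(\<Sum>i\<in>I. t' i * f i) = (1 - s) * (\<Sum>i\<in>I. t i * f i)"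
      unfolding sum_distrib_left using insert.hyps by (intro sum.cong) (auto simp: t'_def)
    then show ?thesis using insert.hyps by (simp add: t'_def)
  qed
  have "sum t' (insert j I) = 1" using eq[of "\<lambda>_. 1"] t(2) by simp
  moreover have "\<forall>i\<in>insert j I. 0 \<le> t' i" using s t(1) by (auto simp: t'_def)
  moreover have "\<forall>c\<in>D. 0 \<le> (\<Sum>i\<in>insert j I. t' i * a i c)"
    unfolding eq using s(3) by blast
  ultimately show ?case by blast
qed

section \<open>Separation in the product of the dual and the reals\<close>

definition epi_pairing :: "'a::real_normed_vector dual \<times> real \<Rightarrow> 'a \<times> real \<Rightarrow> real" where
  "epi_pairing c w = pairing (fst c) (fst w) + snd c * snd w"

definition epi_box :: "real \<Rightarrow> ('a::real_normed_vector dual \<times> real) set" where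
  "epi_box R = {c. norm (fst c) \<le> R \<and> \<bar>snd c\<bar> \<le> R}"

text \<open>
  For bounded sequences, convergence of \<open>\<langle>\<bar>x\<^sub>n - x\<bar>, e\<rangle>\<close> to \<open>0\<close> does not depend on the weak unit \<open>e\<close>:
  it is convergence in the absolute weak* topology.
\<close>

definition boundedly_closed :: "'a::banach_lattice \<Rightarrow> ('a dual \<times> real) set \<Rightarrow> bool" where
  "boundedly_closed e C \<longleftrightarrow> (\<forall>R c l. (\<forall>n::nat. c n \<in> C \<inter> epi_box R) \<longrightarrow>
     (\<lambda>n. pairing \<bar>fst (c n) - fst l\<bar> e) \<longlonglongrightarrow> 0 \<longrightarrow> (\<lambda>n. snd (c n)) \<longlonglongrightarrow> snd l \<longrightarrow> l \<in> C)"

lemma boundedly_closedD: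
  assumes "boundedly_closed e C" "\<And>n::nat. c n \<in> C" "\<And>n. c n \<in> epi_box R"
    "(\<lambda>n. pairing \<bar>fst (c n) - fst l\<bar> e) \<longlonglongrightarrow> 0" "(\<lambda>n. snd (c n)) \<longlonglongrightarrow> snd l"
  shows "l \<in> C"
  using assms(1)[unfolded boundedly_closed_def, rule_format, of c R l] assms(2-) by blast

lemma boundedly_closed_Int:
  assumes "boundedly_closed e C" "boundedly_closed e D"
  shows "boundedly_closed e (C \<inter> D)"
  unfolding boundedly_closed_def
proof (intro allI impI)
  fix R c l
  assume c: "\<forall>n::nat. c n \<in> C \<inter> D \<inter> epi_box R"
    and l: "(\<lambda>n. pairing \<bar>fst (c n) - fst l\<bar> e) \<longlonglongrightarrow> 0" "(\<lambda>n. snd (c n)) \<longlonglongrightarrow> snd l"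
  have "l \<in> C" by (rule boundedly_closedD[OF assms(1) _ _ l]) (use c in auto)
  moreover have "l \<in> D" by (rule boundedly_closedD[OF assms(2) _ _ l]) (use c in auto)
  ultimately show "l \<in> C \<inter> D" by blast
qed

section \<open>Halfspaces and boxes in the product\<close>

lemma epi_pairing_convex_comb:
  "epi_pairing (u *\<^sub>R c + v *\<^sub>R c') w = u * epi_pairing c w + v * epi_pairing c' w"
  by (simp add: epi_pairing_def algebra_simps)

lemma bounded_linear_epi_pairing: "bounded_linear (epi_pairing c)"
proof -
  have "bounded_linear (\<lambda>w. blinfun_apply (blinfun_of_dual (fst c)) (fst w) + snd c * snd w)"
    by (intro bounded_linear_add bounded_linear_compose[OF blinfun.bounded_linear_right]
        bounded_linear_fst bounded_linear_compose[OF bounded_linear_mult_right] bounded_linear_snd)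
  then show ?thesis by (simp add: epi_pairing_def[abs_def] pairing_def)
qed

lemma convex_epi_halfspace: "convex {c. epi_pairing c w \<le> r}"
  unfolding convex_def
proof (intro ballI allI impI)
  fix x y and u v :: real
  assume xy: "x \<in> {c. epi_pairing c w \<le> r}" "y \<in> {c. epi_pairing c w \<le> r}"
    and uv: "0 \<le> u" "0 \<le> v" "u + v = 1"
  have "u * epi_pairing x w + v * epi_pairing y w \<le> r"
    using xy uv by (intro convex_bound_le) auto
  then show "u *\<^sub>R x + v *\<^sub>R y \<in> {c. epi_pairing c w \<le> r}" by (simp add: epi_pairing_convex_comb)
qed

lemma convex_epi_box: "convex (epi_box R :: ('a::real_normed_vector dual \<times> real) set)"
proof -
  have "(epi_box R :: ('a dual \<times> real) set) = cball 0 R \<times> cball 0 R" by (auto simp: epi_box_def)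
  then show ?thesis by (simp add: convex_Times)
qed

lemma convex_on_epi_pairing:
  assumes "convex D"
  shows "convex_on D (\<lambda>c. epi_pairing c w - r)"
proof -
  have "u * (epi_pairing x w - r) + v * (epi_pairing y w - r) = u * epi_pairing x w + v * epi_pairing y w - r"
    if "u + v = 1" for u v x y
  proof -
    have "u * r + v * r = r" using that by (metis distrib_right mult_1)
    then show ?thesis by (simp add: algebra_simps)
  qed
  then show ?thesis unfolding convex_on_def by (simp add: assms epi_pairing_convex_comb)
qed

lemma boundedly_closed_halfspace:
  fixes e :: "'a::banach_lattice"
  assumes oc: "order_continuous_norm TYPE('a)" and e: "weak_unit e"
  shows "boundedly_closed e {c. epi_pairing c w \<le> r}"
  unfolding boundedly_closed_def
proof (intro allI impI)
  fix R l and c :: "nat \<Rightarrow> 'a dual \<times> real"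
  assume c: "\<forall>n. c n \<in> {c. epi_pairing c w \<le> r} \<inter> epi_box R"
    and l: "(\<lambda>n. pairing \<bar>fst (c n) - fst l\<bar> e) \<longlonglongrightarrow> 0" "(\<lambda>n. snd (c n)) \<longlonglongrightarrow> snd l"
  have "norm (fst (c n)) \<le> R" for n using c by (simp add: epi_box_def)
  then have "(\<lambda>n. pairing (fst (c n)) (fst w)) \<longlonglongrightarrow> pairing (fst l) (fst w)"
    by (rule weak_star_tendsto[OF oc e _ l(1)])
  then have "(\<lambda>n. epi_pairing (c n) w) \<longlonglongrightarrow> epi_pairing l w"
    unfolding epi_pairing_def by (intro tendsto_intros l)
  then have "epi_pairing l w \<le> r" by (rule LIMSEQ_le_const2) (use c in auto)
  then show "l \<in> {c. epi_pairing c w \<le> r}" by simp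
qed

text \<open>The substitute for weak* compactness of the box. The real coordinate needs a uniformly
  convex function of its own, for which a square serves.\<close>

lemma epi_box_fip:
  fixes e :: "'a::banach_lattice"
  assumes oc: "order_continuous_norm TYPE('a)" and e: "weak_unit e"
    and F: "\<And>F. F \<in> \<F> \<Longrightarrow> convex F" "\<And>F. F \<in> \<F> \<Longrightarrow> boundedly_closed e F"
    and fip: "\<And>H. finite H \<Longrightarrow> H \<subseteq> \<F> \<Longrightarrow> epi_box R \<inter> \<Inter>H \<noteq> {}"
  shows "epi_box R \<inter> \<Inter>\<F> \<noteq> {}"
proof -
  have e0: "0 \<le> e" using e by (simp add: weak_unit_def)
  define d :: "'a dual \<times> real \<Rightarrow> 'a dual \<times> real \<Rightarrow> real" where
    "d = (\<lambda>u v. pairing \<bar>fst u - fst v\<bar> e + \<bar>snd u - snd v\<bar>)"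
  have p0: "0 \<le> pairing \<bar>x\<bar> e" for x :: "'a dual" by (rule pairing_nonneg[OF abs_ge_zero e0])
  have d_lim: "(\<lambda>n. pairing \<bar>fst (x n) - fst l\<bar> e) \<longlonglongrightarrow> 0 \<and> (\<lambda>n. snd (x n)) \<longlonglongrightarrow> snd l"
    if lim: "(\<lambda>n. d (x n) l) \<longlonglongrightarrow> 0" for x l
  proof
    show "(\<lambda>n. pairing \<bar>fst (x n) - fst l\<bar> e) \<longlonglongrightarrow> 0"
      by (rule tendsto_sandwich[OF _ _ tendsto_const lim]) (simp_all add: p0 d_def)
    have "(\<lambda>n. \<bar>snd (x n) - snd l\<bar>) \<longlonglongrightarrow> 0"
      by (rule tendsto_sandwich[OF _ _ tendsto_const lim]) (simp_all add: p0 d_def)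
    then show "(\<lambda>n. snd (x n)) \<longlonglongrightarrow> snd l"
      by (simp add: tendsto_rabs_zero_iff LIM_zero_iff)
  qed
  have half: "(1/2) *\<^sub>R (u + v) = (1/2) *\<^sub>R u + (1/2) *\<^sub>R v" for u v :: "'a dual \<times> real"
    by (rule scaleR_add_right)
  show ?thesis
  proof (rule uniformly_convex_fip[where d = d])
    show "d u v = d v u" for u v by (simp add: d_def abs_minus_commute)
    show "0 \<le> d u v" for u v by (simp add: d_def p0)
    show "d u w \<le> d u v + d v w" for u v w
    proof -
      have "\<bar>fst u - fst w\<bar> \<le> \<bar>fst u - fst v\<bar> + \<bar>fst v - fst w\<bar>"
        using abs_triangle_ineq[of "fst u - fst v" "fst v - fst w"] by simp
      then have "pairing \<bar>fst u - fst w\<bar> e \<le> pairing (\<bar>fst u - fst v\<bar> + \<bar>fst v - fst w\<bar>) e"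
        by (rule pairing_mono[OF _ e0])
      then show ?thesis by (simp add: d_def)
    qed
    show "(1/2) *\<^sub>R (u + v) \<in> epi_box R" if "u \<in> epi_box R" "v \<in> epi_box R" for u v :: "'a dual \<times> real"
      unfolding half by (rule convexD[OF convex_epi_box that]) simp_all
    show "(1/2) *\<^sub>R (u + v) \<in> F" if "F \<in> \<F>" "u \<in> F" "v \<in> F" for F u v
      unfolding half by (rule convexD[OF F(1)[OF that(1)] that(2,3)]) simp_all
    show "l \<in> F" if "F \<in> \<F>" "\<And>n. x n \<in> epi_box R \<inter> F" "(\<lambda>n. d (x n) l) \<longlonglongrightarrow> 0" for F x l
      by (rule boundedly_closedD[OF F(2)[OF that(1)] IntD2[OF that(2)] IntD1[OF that(2)]
            conjunct1[OF d_lim[OF that(3)]] conjunct2[OF d_lim[OF that(3)]]])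
    show "epi_box R \<inter> \<Inter>H \<noteq> {}" if "finite H" "H \<subseteq> \<F>" for H by (rule fip[OF that])
    show "\<exists>l\<in>epi_box R. (\<lambda>n. d (x n) l) \<longlonglongrightarrow> 0"
      if x: "\<And>n. x n \<in> epi_box R" and cau: "\<And>\<epsilon>. \<epsilon> > 0 \<Longrightarrow> \<exists>N. \<forall>i\<ge>N. \<forall>j\<ge>N. d (x i) (x j) < \<epsilon>" for x
    proof -
      have cau1: "\<exists>N. \<forall>i\<ge>N. \<forall>j\<ge>N. pairing \<bar>fst (x i) - fst (x j)\<bar> e < \<epsilon>" if \<epsilon>: "\<epsilon> > 0" for \<epsilon>
      proof -
        obtain N where N: "\<And>i j. i \<ge> N \<Longrightarrow> j \<ge> N \<Longrightarrow> d (x i) (x j) < \<epsilon>" using cau[OF \<epsilon>] by blast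
        have "pairing \<bar>fst (x i) - fst (x j)\<bar> e < \<epsilon>" if "i \<ge> N" "j \<ge> N" for i j
          using N[OF that] abs_ge_zero[of "snd (x i) - snd (x j)"] unfolding d_def by linarith
        then show ?thesis by blast
      qed
      have bd: "norm (fst (x n)) \<le> R" for n using x by (simp add: epi_box_def)
      obtain l where l: "norm l \<le> R" "(\<lambda>n. pairing \<bar>fst (x n) - l\<bar> e) \<longlonglongrightarrow> 0"
        by (rule dual_ball_complete[OF oc e, of "\<lambda>n. fst (x n)" R, OF bd cau1])
      have "Cauchy (\<lambda>n. snd (x n))"
        unfolding Cauchy_def
      proof (intro allI impI)
        fix \<epsilon> :: real assume \<epsilon>: "\<epsilon> > 0"
        obtain N where N: "\<And>i j. i \<ge> N \<Longrightarrow> j \<ge> N \<Longrightarrow> d (x i) (x j) < \<epsilon>" using cau[OF \<epsilon>] by blast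
        have "dist (snd (x i)) (snd (x j)) < \<epsilon>" if "i \<ge> N" "j \<ge> N" for i j
          using N[OF that] p0[of "fst (x i) - fst (x j)"] unfolding d_def dist_real_def by linarith
        then show "\<exists>N. \<forall>i\<ge>N. \<forall>j\<ge>N. dist (snd (x i)) (snd (x j)) < \<epsilon>" by blast
      qed
      then obtain s where s: "(\<lambda>n. snd (x n)) \<longlonglongrightarrow> s"
        by (auto simp: Cauchy_convergent_iff convergent_def)
      have "\<bar>s\<bar> \<le> R"
        by (rule LIMSEQ_le_const2[OF tendsto_rabs[OF s]]) (use x in \<open>auto simp: epi_box_def\<close>)
      moreover have "(\<lambda>n. \<bar>snd (x n) - s\<bar>) \<longlonglongrightarrow> 0"
        using s by (simp add: tendsto_rabs_zero_iff LIM_zero_iff)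
      from tendsto_add[OF l(2) this] have "(\<lambda>n. d (x n) (l, s)) \<longlonglongrightarrow> 0"
        by (simp add: d_def)
      ultimately show ?thesis using l(1) by (intro bexI[of _ "(l, s)"]) (simp_all add: epi_box_def)
    qed
    show "\<exists>\<phi> C. (\<forall>x\<in>epi_box R. 0 \<le> \<phi> x \<and> \<phi> x \<le> C) \<and>
      (\<forall>u\<in>epi_box R. \<forall>v\<in>epi_box R. 2 * \<phi> ((1/2) *\<^sub>R (u + v)) \<le> \<phi> u + \<phi> v) \<and>
      (\<forall>u\<in>epi_box R. \<forall>v\<in>epi_box R. d u v \<le> 2 * (\<phi> u + \<phi> v - 2 * \<phi> ((1/2) *\<^sub>R (u + v))) + \<epsilon>)"
      if \<epsilon>: "\<epsilon> > 0" for \<epsilon>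
    proof -
      define \<delta> where "\<delta> = \<epsilon> / 2"
      have \<delta>: "\<delta> > 0" using \<epsilon> by (simp add: \<delta>_def)
      obtain \<phi> C where \<phi>: "\<And>x::'a dual. norm x \<le> R \<Longrightarrow> 0 \<le> \<phi> x \<and> \<phi> x \<le> C"
        "\<And>u v. 2 * \<phi> ((1/2) *\<^sub>R (u + v)) \<le> \<phi> u + \<phi> v"
        "\<And>u v. norm u \<le> R \<Longrightarrow> norm v \<le> R \<Longrightarrow>
          pairing \<bar>u - v\<bar> e \<le> 2 * (\<phi> u + \<phi> v - 2 * \<phi> ((1/2) *\<^sub>R (u + v))) + \<delta>"
        using dual_ball_uniformly_convex[OF oc e0 \<delta>, of R] by blast
      \<comment> \<open>The square has deficit \<open>(t - r)\<^sup>2 / (2 * \<delta>)\<close>, and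
        twice this plus \<delta> is at least \<open>\<bar>t - r\<bar>\<close>. So each of the two
        coordinates uses up \<delta>, half of the error \<epsilon>.\<close>
      define \<psi> where "\<psi> c = \<phi> (fst c) + (snd c)\<^sup>2 / \<delta>" for c
      have mid: "\<psi> ((1/2) *\<^sub>R (u + v)) = \<phi> ((1/2) *\<^sub>R (fst u + fst v)) + ((snd u + snd v) / 2)\<^sup>2 / \<delta>" for u v
        by (simp add: \<psi>_def)
      have par: "t\<^sup>2 / \<delta> + r\<^sup>2 / \<delta> - 2 * (((t + r) / 2)\<^sup>2 / \<delta>) = (t - r)\<^sup>2 / (2 * \<delta>)" for t r
        using \<delta> by (simp add: field_simps power2_eq_square)
      have "0 \<le> \<psi> x \<and> \<psi> x \<le> C + R\<^sup>2 / \<delta>" if "x \<in> epi_box R" for x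
      proof -
        have "\<bar>snd x\<bar> \<le> \<bar>R\<bar>" using that by (auto simp: epi_box_def)
        then have "(snd x)\<^sup>2 \<le> R\<^sup>2" by (simp only: abs_le_square_iff)
        then have "(snd x)\<^sup>2 / \<delta> \<le> R\<^sup>2 / \<delta>" using \<delta> by (simp add: divide_right_mono)
        moreover have "0 \<le> (snd x)\<^sup>2 / \<delta>" using \<delta> by simp
        moreover have "0 \<le> \<phi> (fst x) \<and> \<phi> (fst x) \<le> C" using that \<phi>(1) by (simp add: epi_box_def)
        ultimately show ?thesis unfolding \<psi>_def by linarith
      qed
      moreover have "2 * \<psi> ((1/2) *\<^sub>R (u + v)) \<le> \<psi> u + \<psi> v" for u v
      proof -
        have "0 \<le> (snd u - snd v)\<^sup>2 / (2 * \<delta>)" using \<delta> by simp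
        then show ?thesis
          using \<phi>(2)[of "fst u" "fst v"] par[of "snd u" "snd v"] unfolding mid unfolding \<psi>_def by argo
      qed
      moreover have "d u v \<le> 2 * (\<psi> u + \<psi> v - 2 * \<psi> ((1/2) *\<^sub>R (u + v))) + \<epsilon>"
        if uv: "u \<in> epi_box R" "v \<in> epi_box R" for u v
      proof -
        define t where "t = \<bar>snd u - snd v\<bar>"
        have "0 \<le> (t - \<delta>)\<^sup>2 + t * \<delta>" using \<delta> by (intro add_nonneg_nonneg) (simp_all add: t_def)
        then have "t * \<delta> \<le> t\<^sup>2 + \<delta> * \<delta>" by (simp add: power2_eq_square algebra_simps)
        then have "t \<le> t\<^sup>2 / \<delta> + \<delta>" using \<delta> by (simp add: field_simps)
        also have "t\<^sup>2 / \<delta> = 2 * ((snd u - snd v)\<^sup>2 / (2 * \<delta>))" by (simp add: t_def)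
        finally have "t \<le> 2 * ((snd u - snd v)\<^sup>2 / (2 * \<delta>)) + \<delta>" .
        moreover have "pairing \<bar>fst u - fst v\<bar> e
            \<le> 2 * (\<phi> (fst u) + \<phi> (fst v) - 2 * \<phi> ((1/2) *\<^sub>R (fst u + fst v))) + \<delta>"
          using uv by (intro \<phi>(3)) (auto simp: epi_box_def)
        moreover have "2 * \<delta> = \<epsilon>" by (simp add: \<delta>_def)
        ultimately show ?thesis
          using par[of "snd u" "snd v"] unfolding mid unfolding \<psi>_def d_def t_def[symmetric] by argo
      qed
      ultimately show ?thesis by blast
    qed
  qed
qed

text \<open>The candidates \<open>W\<close> form the polar of \<open>epi_box \<delta>\<close>. If
  each had value below 1 somewhere on \<open>C \<inter> epi_box R\<close>, then by minimax finitely
  many of them would have values at most 1 at a common point there, since convex combinations stay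
  in \<open>W\<close>. The finite intersection property yields one such point for all of
  \<open>W\<close>; it lies in \<open>C\<close> and in the bipolar, which is
  \<open>epi_box \<delta>\<close>.\<close>

lemma separate_from_box:
  fixes e :: "'a::banach_lattice"
  assumes oc: "order_continuous_norm TYPE('a)" and e: "weak_unit e"
    and C: "convex C" "boundedly_closed e C" and \<delta>: "0 < \<delta>" and disj: "C \<inter> epi_box \<delta> = {}"
  shows "\<exists>w. norm (fst w) + \<bar>snd w\<bar> \<le> 1 / \<delta> \<and> (\<forall>c\<in>C \<inter> epi_box R. 1 \<le> epi_pairing c w)"
proof (rule ccontr)
  assume none: "\<not> ?thesis"
  define W :: "('a \<times> real) set" where "W = {w. norm (fst w) + \<bar>snd w\<bar> \<le> 1 / \<delta>}"
  have no: "\<exists>c\<in>C \<inter> epi_box R. epi_pairing c w < 1" if "w \<in> W" for w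
    using none that unfolding W_def mem_Collect_eq not_le[symmetric] by blast
  have W0: "0 \<in> W" using \<delta> by (simp add: W_def)
  have convW: "convex W"
    unfolding convex_def
  proof (intro ballI allI impI)
    fix x y and u v :: real assume xy: "x \<in> W" "y \<in> W" and uv: "0 \<le> u" "0 \<le> v" "u + v = 1"
    have "norm (fst (u *\<^sub>R x + v *\<^sub>R y)) \<le> u * norm (fst x) + v * norm (fst y)"
      using uv norm_triangle_ineq[of "u *\<^sub>R fst x" "v *\<^sub>R fst y"] by simp
    moreover have "\<bar>snd (u *\<^sub>R x + v *\<^sub>R y)\<bar> \<le> u * \<bar>snd x\<bar> + v * \<bar>snd y\<bar>"
      using uv abs_triangle_ineq[of "u * snd x" "v * snd y"] by (simp add: abs_mult)
    moreover have "u * (norm (fst x) + \<bar>snd x\<bar>) + v * (norm (fst y) + \<bar>snd y\<bar>) \<le> 1 / \<delta>"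
      using xy uv by (intro convex_bound_le) (auto simp: W_def)
    ultimately show "u *\<^sub>R x + v *\<^sub>R y \<in> W" by (simp add: W_def algebra_simps)
  qed
  define \<F> where "\<F> = (\<lambda>w. C \<inter> {c. epi_pairing c w \<le> 1}) ` W"
  have convD: "convex (C \<inter> epi_box R)" by (intro convex_Int C convex_epi_box)
  have "epi_box R \<inter> \<Inter>\<F> \<noteq> {}"
  proof (rule epi_box_fip[OF oc e])
    show "convex F" if "F \<in> \<F>" for F
      using that C(1) convex_epi_halfspace by (auto simp: \<F>_def intro: convex_Int)
    show "boundedly_closed e F" if "F \<in> \<F>" for F
      using that boundedly_closed_Int[OF C(2) boundedly_closed_halfspace[OF oc e]] by (auto simp: \<F>_def)
    fix H assume H: "finite H" "H \<subseteq> \<F>"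
    obtain I where I: "finite I" "I \<subseteq> W" "H = (\<lambda>w. C \<inter> {c. epi_pairing c w \<le> 1}) ` I"
      using finite_subset_image[OF H(1) H(2)[unfolded \<F>_def]] by blast
    show "epi_box R \<inter> \<Inter>H \<noteq> {}"
    proof (cases "I = {}")
      case True
      then show ?thesis using no[OF W0] I(3) by auto
    next
      case False
      show ?thesis
      proof (rule ccontr)
        assume empty: "\<not> epi_box R \<inter> \<Inter>H \<noteq> {}"
        have "\<exists>w\<in>I. 0 \<le> epi_pairing c w - 1" if "c \<in> C \<inter> epi_box R" for c
        proof (rule ccontr)
          assume "\<not> (\<exists>w\<in>I. 0 \<le> epi_pairing c w - 1)"
          then have "\<forall>w\<in>I. epi_pairing c w \<le> 1" by force
          then have "c \<in> epi_box R \<inter> \<Inter>H" using that I(3) by auto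
          with empty show False by blast
        qed
        then obtain t where t: "\<forall>w\<in>I. 0 \<le> t w" "sum t I = 1"
          "\<forall>c\<in>C \<inter> epi_box R. 0 \<le> (\<Sum>w\<in>I. t w * (epi_pairing c w - 1))"
          using finite_minimax[OF I(1) False, of "C \<inter> epi_box R" "\<lambda>w c. epi_pairing c w - 1"]
            convex_on_epi_pairing[OF convD] by blast
        define w where "w = (\<Sum>w\<in>I. t w *\<^sub>R w)"
        have "w \<in> W" unfolding w_def using t I by (intro convex_sum[OF I(1) convW]) auto
        then obtain c where c: "c \<in> C \<inter> epi_box R" "epi_pairing c w < 1" using no by blast
        have "epi_pairing c w = (\<Sum>w\<in>I. t w * epi_pairing c w)"
          using bounded_linear.linear[OF bounded_linear_epi_pairing[of c]]
          by (simp add: w_def linear_sum linear_scale)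
        moreover have "(\<Sum>w\<in>I. t w * (epi_pairing c w - 1)) = (\<Sum>w\<in>I. t w * epi_pairing c w) - sum t I"
          by (simp add: right_diff_distrib sum_subtractf)
        moreover have "0 \<le> (\<Sum>w\<in>I. t w * (epi_pairing c w - 1))" using t(3) c(1) by blast
        ultimately show False using c(2) t(2) by linarith
      qed
    qed
  qed
  then obtain c where cF: "c \<in> epi_box R" "c \<in> \<Inter>\<F>" by blast
  have c: "c \<in> C \<and> epi_pairing c w \<le> 1" if "w \<in> W" for w
    using InterD[OF cF(2) imageI[OF that, of "\<lambda>w. C \<inter> {c. epi_pairing c w \<le> 1}", folded \<F>_def]] by simp
  have "norm (fst c) \<le> \<delta>"
  proof (rule norm_dual_le)
    fix y :: 'a
    show "\<bar>pairing (fst c) y\<bar> \<le> \<delta> * norm y"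
    proof (cases "y = 0")
      case False
      \<comment> \<open>Scaled so that \<open>k *\<^sub>R y\<close> lies on the boundary of
        \<open>W\<close>; used with both signs, it tests the norm of \<open>fst c\<close>.\<close>
      define k where "k = 1 / (\<delta> * norm y)"
      have k: "0 < k" using \<delta> False by (simp add: k_def)
      have "(k *\<^sub>R y, 0) \<in> W" "(- k *\<^sub>R y, 0) \<in> W"
        using \<delta> False by (simp_all add: W_def k_def)
      from c[OF this(1)] c[OF this(2)] have "k * \<bar>pairing (fst c) y\<bar> \<le> 1"
        using k by (simp add: epi_pairing_def abs_if)
      then show ?thesis using \<delta> False by (simp add: k_def field_simps)
    qed simp
  qed (use \<delta> in simp)
  moreover have "\<bar>snd c\<bar> \<le> \<delta>"
  proof -
    have "(0, 1 / \<delta>) \<in> W" "(0, - (1 / \<delta>)) \<in> W" using \<delta> by (simp_all add: W_def)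
    from c[OF this(1)] c[OF this(2)] show ?thesis
      using \<delta> by (simp add: epi_pairing_def abs_le_iff field_simps)
  qed
  moreover have "c \<in> C" using c[OF W0] by blast
  ultimately show False using disj by (auto simp: epi_box_def)
qed

text \<open>
  The halfspaces cut off at level \<open>1/2\<close> whereas \<open>separate_from_box\<close> gives level \<open>1\<close>; the gap keeps the
  remaining set disjoint from the next box.
\<close>

lemma separating_sequence:
  fixes e :: "'a::banach_lattice"
  assumes oc: "order_continuous_norm TYPE('a)" and e: "weak_unit e"
    and C: "convex C" "boundedly_closed e C" and \<delta>: "0 < \<delta>" and disj: "C \<inter> epi_box \<delta> = {}"
  obtains w :: "nat \<Rightarrow> 'a \<times> real" where
    "\<And>n. norm (fst (w n)) + \<bar>snd (w n)\<bar> \<le> 1 / (real (Suc n) * \<delta>)"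
    "\<And>c. c \<in> C \<Longrightarrow> \<exists>n. 1/2 < epi_pairing c (w n)"
proof -
  \<comment> \<open>At stage \<open>n\<close> the rest of \<open>C\<close> misses the box of radius
    \<open>(n + 1) * \<delta>\<close>. The vector has norm at most the reciprocal of this radius and
    takes care of the next box, of radius \<open>(n + 2) * \<delta>\<close>.\<close>
  define good where "good n S w \<longleftrightarrow> norm (fst w) + \<bar>snd w\<bar> \<le> 1 / (real (Suc n) * \<delta>) \<and>
      (\<forall>c\<in>S \<inter> epi_box (real (Suc (Suc n)) * \<delta>). 1 \<le> epi_pairing c w)" for n S and w :: "'a \<times> real"
  define pick where "pick n S = (SOME w. good n S w)" for n S
  define Cs where "Cs = rec_nat C (\<lambda>n S. S \<inter> {c. epi_pairing c (pick n S) \<le> 1/2})"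
  have Cs0: "Cs 0 = C" and CsS: "Cs (Suc n) = Cs n \<inter> {c. epi_pairing c (pick n (Cs n)) \<le> 1/2}" for n
    by (simp_all add: Cs_def)
  have inv: "convex (Cs n) \<and> boundedly_closed e (Cs n) \<and> Cs n \<inter> epi_box (real (Suc n) * \<delta>) = {}
      \<and> good n (Cs n) (pick n (Cs n))" for n
  proof (induction n)
    case 0
    have "\<exists>w. good 0 C w"
      using separate_from_box[OF oc e C \<delta> disj, of "2 * \<delta>"] by (simp add: good_def)
    then have "good 0 C (pick 0 C)" unfolding pick_def by (rule someI_ex)
    then show ?case using C disj by (simp add: Cs0)
  next
    case (Suc n)
    then have IH: "convex (Cs n)" "boundedly_closed e (Cs n)" "good n (Cs n) (pick n (Cs n))" by blast+
    have 1: "convex (Cs (Suc n))" unfolding CsS by (intro convex_Int IH convex_epi_halfspace)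
    have 2: "boundedly_closed e (Cs (Suc n))"
      unfolding CsS by (intro boundedly_closed_Int IH boundedly_closed_halfspace[OF oc e])
    have 3: "Cs (Suc n) \<inter> epi_box (real (Suc (Suc n)) * \<delta>) = {}"
      using IH(3) unfolding good_def CsS by force
    have "0 < real (Suc (Suc n)) * \<delta>" using \<delta> by simp
    from separate_from_box[OF oc e 1 2 this 3] have "\<exists>w. good (Suc n) (Cs (Suc n)) w"
      unfolding good_def by blast
    then have "good (Suc n) (Cs (Suc n)) (pick (Suc n) (Cs (Suc n)))"
      unfolding pick_def by (rule someI_ex)
    with 1 2 3 show ?case by blast
  qed
  show thesis
  proof (rule that[of "\<lambda>n. pick n (Cs n)"])
    show "norm (fst (pick n (Cs n))) + \<bar>snd (pick n (Cs n))\<bar> \<le> 1 / (real (Suc n) * \<delta>)" for n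
      using inv[of n] unfolding good_def by blast
    fix c assume c: "c \<in> C"
    show "\<exists>n. 1/2 < epi_pairing c (pick n (Cs n))"
    proof (rule ccontr)
      assume none: "\<not> ?thesis"
      \<comment> \<open>A point that is never cut off stays in every \<open>Cs n\<close>, although
        it lies in some box that \<open>Cs n\<close> misses.\<close>
      then have all: "c \<in> Cs n" for n
        by (induction n) (auto simp: Cs0 c CsS not_less)
      define m where "m = max (norm (fst c)) \<bar>snd c\<bar>"
      obtain n :: nat where "m < real n * \<delta>" using reals_Archimedean3[OF \<delta>] by blast
      also have "\<dots> \<le> real (Suc n) * \<delta>" using \<delta> by (intro mult_right_mono) auto
      finally have "c \<in> epi_box (real (Suc n) * \<delta>)" unfolding epi_box_def m_def by auto
      with all[of n] inv[of n] show False by blast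
    qed
  qed
qed

text \<open>For each \<open>c\<close> the values at the \<open>w n\<close> form a null sequence, and
  what is sought are summable weights. On \<open>C \<inter> epi_box M\<close> only finitely many
  \<open>n\<close> count, and minimax gives finite convex weights with mean at least 1/2. As
  \<open>M\<close> grows, the weights converge coordinatewise along a subsequence. Mass may escape
  to infinity, but only to indices where the values are at most 1/8, so 3/8 remains; the tail of the
  limit costs another 1/8.\<close>

lemma separating_functional:
  fixes w :: "nat \<Rightarrow> 'a::banach \<times> real"
  assumes \<delta>: "0 < \<delta>" and C: "convex C"
    and w: "\<And>n. norm (fst (w n)) + \<bar>snd (w n)\<bar> \<le> 1 / (real (Suc n) * \<delta>)"
      "\<And>c. c \<in> C \<Longrightarrow> \<exists>n. 1/2 < epi_pairing c (w n)"
  obtains v where "\<And>c. c \<in> C \<Longrightarrow> 1/4 \<le> epi_pairing c v"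
proof -
  have bound: "\<bar>epi_pairing c (w n)\<bar> \<le> M / (real (Suc n) * \<delta>)" if c: "c \<in> epi_box M" for c M n
  proof -
    have cM: "norm (fst c) \<le> M" "\<bar>snd c\<bar> \<le> M" using c by (auto simp: epi_box_def)
    have M: "0 \<le> M" using cM(2) by linarith
    have "\<bar>epi_pairing c (w n)\<bar> \<le> \<bar>pairing (fst c) (fst (w n))\<bar> + \<bar>snd c * snd (w n)\<bar>"
      unfolding epi_pairing_def by (rule abs_triangle_ineq)
    also have "\<dots> \<le> norm (fst c) * norm (fst (w n)) + \<bar>snd c\<bar> * \<bar>snd (w n)\<bar>"
      using pairing_le_norm[of "fst c" "fst (w n)"] by (simp add: abs_mult)
    also have "\<dots> \<le> M * norm (fst (w n)) + M * \<bar>snd (w n)\<bar>"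
      by (intro add_mono mult_right_mono cM) simp_all
    also have "\<dots> = M * (norm (fst (w n)) + \<bar>snd (w n)\<bar>)" by (simp add: distrib_left)
    also have "\<dots> \<le> M * (1 / (real (Suc n) * \<delta>))" by (rule mult_left_mono[OF w(1) M])
    finally show ?thesis by simp
  qed
  have small: "\<exists>N>0. \<forall>n\<ge>N. \<forall>c\<in>epi_box M. \<bar>epi_pairing c (w n)\<bar> \<le> \<epsilon>"
    if "\<epsilon> > 0" for M \<epsilon>
  proof -
    obtain N :: nat where N: "\<bar>M\<bar> / (\<epsilon> * \<delta>) < real N" using reals_Archimedean2 by blast
    have "\<bar>epi_pairing c (w n)\<bar> \<le> \<epsilon>" if n: "n \<ge> Suc N" and c: "c \<in> epi_box M" for n c
    proof -
      have "\<bar>M\<bar> / (\<epsilon> * \<delta>) < real (Suc n)" using N n by simp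
      then have "\<bar>M\<bar> < real (Suc n) * (\<epsilon> * \<delta>)" using \<open>\<epsilon> > 0\<close> \<delta> by (simp add: pos_divide_less_eq)
      then have "M \<le> \<epsilon> * (real (Suc n) * \<delta>)" by (simp add: mult_ac)
      then have "M / (real (Suc n) * \<delta>) \<le> \<epsilon>" using \<delta> by (simp add: pos_divide_le_eq)
      with bound[OF c, of n] show ?thesis by linarith
    qed
    then show ?thesis by (intro exI[of _ "Suc N"]) auto
  qed
  \<comment> \<open>Here \<open>K\<close> can be chosen from \<open>c\<close> alone, independently
    of \<open>M\<close>, so a fixed finite number of coordinates is involved when \<open>M\<close>
    grows.\<close>
  have "\<exists>t. (\<forall>n. 0 \<le> t n) \<and> (\<forall>K. (\<Sum>n<K. t n) \<le> 1) \<and>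
      (\<forall>c\<in>C \<inter> epi_box (real M). \<forall>K. (\<forall>n\<ge>K. \<bar>epi_pairing c (w n)\<bar> \<le> 1/8) \<longrightarrow>
        3/8 \<le> (\<Sum>n<K. t n * epi_pairing c (w n)))" for M :: nat
  proof -
    obtain N where N: "N > 0" "\<And>n c. n \<ge> N \<Longrightarrow> c \<in> epi_box (real M) \<Longrightarrow> \<bar>epi_pairing c (w n)\<bar> \<le> 1/2"
      using small[of "1/2" "real M"] by auto
    have convD: "convex (C \<inter> epi_box (real M))" by (intro convex_Int C convex_epi_box)
    have ex: "\<exists>n\<in>{..<N}. 0 \<le> epi_pairing c (w n) - 1/2" if c: "c \<in> C \<inter> epi_box (real M)" for c
    proof -
      obtain n where n: "1/2 < epi_pairing c (w n)" using w(2) c by blast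
      have "n < N"
      proof (rule ccontr)
        assume "\<not> n < N"
        then have "\<bar>epi_pairing c (w n)\<bar> \<le> 1/2" using N(2) c by simp
        with n show False by linarith
      qed
      with n show ?thesis by (intro bexI[of _ n]) auto
    qed
    have "{..<N} \<noteq> {}" using N(1) by (simp add: lessThan_empty_iff)
    from finite_minimax[OF finite_lessThan this convex_on_epi_pairing[OF convD] ex]
    obtain s where s: "\<forall>n\<in>{..<N}. 0 \<le> s n" "sum s {..<N} = 1"
      "\<forall>c\<in>C \<inter> epi_box (real M). 0 \<le> (\<Sum>n<N. s n * (epi_pairing c (w n) - 1/2))" by blast
    define t where "t n = (if n < N then s n else 0)" for n
    have t0: "0 \<le> t n" for n using s(1) by (simp add: t_def)
    have tsum: "(\<Sum>n<K. t n * f n) = (\<Sum>n<N. t n * f n)" if "N \<le> K" for K and f :: "nat \<Rightarrow> real"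
      by (rule sum.mono_neutral_right) (use that in \<open>auto simp: t_def\<close>)
    have tN: "(\<Sum>n<N. t n) = 1" using s(2) by (simp add: t_def)
    have t1: "(\<Sum>n<K. t n) \<le> 1" for K
    proof (cases "N \<le> K")
      case True
      then show ?thesis using tsum[of K "\<lambda>_. 1"] tN by simp
    next
      case False
      then have "(\<Sum>n<K. t n) \<le> (\<Sum>n<N. t n)" by (intro sum_mono2) (auto simp: t0)
      with tN show ?thesis by simp
    qed
    have "3/8 \<le> (\<Sum>n<K. t n * epi_pairing c (w n))"
      if c: "c \<in> C \<inter> epi_box (real M)" and K: "\<forall>n\<ge>K. \<bar>epi_pairing c (w n)\<bar> \<le> 1/8" for c K
    proof -
      have "(\<Sum>n<N. s n * (epi_pairing c (w n) - 1/2)) = (\<Sum>n<N. s n * epi_pairing c (w n)) - sum s {..<N} * (1/2)"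
        by (simp only: right_diff_distrib sum_subtractf sum_distrib_right)
      then have "1/2 \<le> (\<Sum>n<N. s n * epi_pairing c (w n))" using s(2,3) c by force
      also have "\<dots> = (\<Sum>n<N. t n * epi_pairing c (w n))" by (simp add: t_def)
      finally have half: "1/2 \<le> (\<Sum>n<N. t n * epi_pairing c (w n))" .
      show ?thesis
      proof (cases "N \<le> K")
        case True
        then show ?thesis using tsum[OF True, of "\<lambda>n. epi_pairing c (w n)"] half by simp
      next
        case False
        then have split: "{..<N} = {..<K} \<union> {K..<N}" "{..<K} \<inter> {K..<N} = {}" by auto
        have "(\<Sum>n=K..<N. t n * epi_pairing c (w n)) \<le> (\<Sum>n=K..<N. t n * (1/8))"
          using K t0 by (intro sum_mono mult_left_mono) (auto simp: abs_le_iff)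
        also have "\<dots> = (\<Sum>n=K..<N. t n) * (1/8)" by (rule sum_distrib_right[symmetric])
        also have "(\<Sum>n=K..<N. t n) \<le> (\<Sum>n<N. t n)" by (intro sum_mono2) (auto simp: t0)
        finally have "(\<Sum>n=K..<N. t n * epi_pairing c (w n)) \<le> 1/8" using tN by simp
        moreover have "(\<Sum>n<N. t n * epi_pairing c (w n))
            = (\<Sum>n<K. t n * epi_pairing c (w n)) + (\<Sum>n=K..<N. t n * epi_pairing c (w n))"
          unfolding split(1) by (rule sum.union_disjoint) (use split(2) in simp_all)
        ultimately show ?thesis using half by linarith
      qed
    qed
    with t0 t1 show ?thesis by blast
  qed
  then have "\<forall>M::nat. \<exists>t. (\<forall>n. 0 \<le> t n) \<and> (\<forall>K. (\<Sum>n<K. t n) \<le> 1) \<and>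
      (\<forall>c\<in>C \<inter> epi_box (real M). \<forall>K. (\<forall>n\<ge>K. \<bar>epi_pairing c (w n)\<bar> \<le> 1/8) \<longrightarrow>
        3/8 \<le> (\<Sum>n<K. t n * epi_pairing c (w n)))" by blast
  from choice[OF this] obtain T :: "nat \<Rightarrow> nat \<Rightarrow> real" where T: "\<And>M n. 0 \<le> T M n" "\<And>M K. (\<Sum>n<K. T M n) \<le> 1"
    "\<And>M c K. c \<in> C \<inter> epi_box (real M) \<Longrightarrow> (\<forall>n\<ge>K. \<bar>epi_pairing c (w n)\<bar> \<le> 1/8) \<Longrightarrow>
        3/8 \<le> (\<Sum>n<K. T M n * epi_pairing c (w n))"
    by blast
  have Tnorm: "norm (T M n) \<le> 1" for M n
  proof -
    have "T M n \<le> (\<Sum>k<Suc n. T M k)" using T(1) by (simp add: sum_nonneg)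
    then show ?thesis using T(1)[of M n] T(2)[of M "Suc n"] by simp
  qed
  \<comment> \<open>Cantor's diagonal argument over the countably many indices. Since mass can be
    lost, the total weight of the limit is only known to be at most 1.\<close>
  obtain k where k: "strict_mono (k::nat \<Rightarrow> nat)" "\<And>n. \<exists>l. (\<lambda>M. T (k M) n) \<longlonglongrightarrow> l"
  proof (rule function_convergent_subsequence[of UNIV T 1])
    show "norm (T M n) \<le> 1" for M n by (rule Tnorm)
  qed (simp_all add: that)
  then obtain t where t: "\<And>n. (\<lambda>M. T (k M) n) \<longlonglongrightarrow> t n" by metis
  have t0: "0 \<le> t n" for n by (rule LIMSEQ_le_const[OF t]) (simp add: T)
  have t1: "(\<Sum>n<K. t n) \<le> 1" for K
    by (rule LIMSEQ_le_const2[OF tendsto_sum[OF t]]) (simp add: T)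
  have tsummable: "summable t"
    by (rule bounded_imp_summable[of t 1, OF t0]) (simp only: t1 flip: lessThan_Suc_atMost)
  have wnorm: "norm (w n) \<le> 1 / \<delta>" for n
  proof -
    have "norm (w n) \<le> norm (fst (w n)) + \<bar>snd (w n)\<bar>"
      using norm_Pair_le[of "fst (w n)" "snd (w n)"] by simp
    also have "\<dots> \<le> 1 / (real (Suc n) * \<delta>)" by (rule w(1))
    also have "\<dots> \<le> 1 / \<delta>" using \<delta> by (intro frac_le) (simp_all add: distrib_right)
    finally show ?thesis .
  qed
  have "summable (\<lambda>n. norm (t n *\<^sub>R w n))"
  proof (rule summable_comparison_test'[of "\<lambda>n. t n * (1 / \<delta>)" 0])
    show "summable (\<lambda>n. t n * (1 / \<delta>))" by (rule summable_mult2[OF tsummable])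
    show "norm (norm (t n *\<^sub>R w n)) \<le> t n * (1 / \<delta>)" for n
      using mult_left_mono[OF wnorm t0, of n n] t0[of n] by simp
  qed
  then have wsummable: "summable (\<lambda>n. t n *\<^sub>R w n)" by (rule summable_norm_cancel)
  define v where "v = (\<Sum>n. t n *\<^sub>R w n)"
  show thesis
  proof (rule that[of v])
    fix c assume c: "c \<in> C"
    let ?b = "\<lambda>n. epi_pairing c (w n)"
    define m where "m = max (norm (fst c)) \<bar>snd c\<bar>"
    obtain M0 :: nat where M0: "m \<le> real M0" using real_arch_simple by blast
    have box: "c \<in> epi_box (real M)" if "M0 \<le> M" for M
      using M0 of_nat_mono[OF that, where 'a = real] by (auto simp: epi_box_def m_def)
    obtain K where K: "\<forall>n\<ge>K. \<bar>?b n\<bar> \<le> 1/8" using small[of "1/8" "real M0"] box by auto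
    have "3/8 \<le> (\<Sum>n<K. t n * ?b n)"
    proof (rule LIMSEQ_le_const)
      show "(\<lambda>M. \<Sum>n<K. T (k M) n * ?b n) \<longlonglongrightarrow> (\<Sum>n<K. t n * ?b n)"
        by (intro tendsto_sum tendsto_mult_right t)
      have "3/8 \<le> (\<Sum>n<K. T (k M) n * ?b n)" if "M0 \<le> M" for M
        using c box[of "k M"] order_trans[OF that seq_suble[OF k(1)]] by (intro T(3)[OF _ K]) blast
      then show "\<exists>N. \<forall>M\<ge>N. 3/8 \<le> (\<Sum>n<K. T (k M) n * ?b n)" by blast
    qed
    moreover have vsums: "(\<lambda>n. t n * ?b n) sums epi_pairing c v"
    proof -
      have "(\<lambda>n. epi_pairing c (t n *\<^sub>R w n)) sums epi_pairing c v"
        unfolding v_def by (rule bounded_linear.sums[OF bounded_linear_epi_pairing summable_sums[OF wsummable]])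
      then show ?thesis
        by (simp add: linear_scale[OF bounded_linear.linear[OF bounded_linear_epi_pairing]])
    qed
    moreover have "(\<Sum>n<K. t n * ?b n) - 1/8 \<le> epi_pairing c v"
    proof (rule LIMSEQ_le_const[OF vsums[unfolded sums_def]])
      have "(\<Sum>n<K. t n * ?b n) - 1/8 \<le> (\<Sum>n<L. t n * ?b n)" if "K \<le> L" for L
      proof -
        have split: "{..<L} = {..<K} \<union> {K..<L}" "{..<K} \<inter> {K..<L} = {}" using that by auto
        have "(\<Sum>n=K..<L. t n * (- (1/8))) \<le> (\<Sum>n=K..<L. t n * ?b n)"
          using K t0 by (intro sum_mono mult_left_mono) (auto simp: abs_le_iff)
        moreover have "(\<Sum>n=K..<L. t n * (- (1/8))) = (\<Sum>n=K..<L. t n) * (- (1/8))"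
          by (rule sum_distrib_right[symmetric])
        moreover have "(\<Sum>n=K..<L. t n) \<le> (\<Sum>n<L. t n)" by (intro sum_mono2) (auto simp: t0)
        moreover have "(\<Sum>n<L. t n * ?b n) = (\<Sum>n<K. t n * ?b n) + (\<Sum>n=K..<L. t n * ?b n)"
          unfolding split(1) by (rule sum.union_disjoint) (use split(2) in simp_all)
        ultimately show ?thesis using t1[of L] by linarith
      qed
      then show "\<exists>N. \<forall>L\<ge>N. (\<Sum>n<K. t n * ?b n) - 1/8 \<le> (\<Sum>n<L. t n * ?b n)" by blast
    qed
    ultimately show "1/4 \<le> epi_pairing c v" by linarith
  qed
qed

text \<open>Norm convergence implies \<open>p\<close>-convergence, so \<open>C\<close> misses some
  box around 0, from which the Krein-Smulian construction starts.\<close>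

lemma boundedly_closed_separation:
  fixes e :: "'a::banach_lattice"
  assumes oc: "order_continuous_norm TYPE('a)" and e: "weak_unit e"
    and C: "convex C" "boundedly_closed e C" and 0: "0 \<notin> C"
  obtains v where "\<And>c. c \<in> C \<Longrightarrow> 1/4 \<le> epi_pairing c v"
proof -
  have e0: "0 \<le> e" using e by (simp add: weak_unit_def)
  have "\<exists>\<delta>>0. C \<inter> epi_box \<delta> = {}"
  proof (rule ccontr)
    assume none: "\<not> ?thesis"
    have "\<exists>c. c \<in> C \<inter> epi_box (inverse (real (Suc n)))" for n
      using none inverse_positive_iff_positive[of "real (Suc n)"] by (metis of_nat_0_less_iff zero_less_Suc equals0I)
    then obtain c where c: "\<And>n. c n \<in> C \<inter> epi_box (inverse (real (Suc n)))" by metis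
    have cn: "norm (fst (c n)) \<le> inverse (real (Suc n))" "\<bar>snd (c n)\<bar> \<le> inverse (real (Suc n))" for n
      using c[of n] unfolding epi_box_def by blast+
    have inv1: "inverse (real (Suc n)) \<le> 1" for n by (simp add: inverse_le_1_iff)
    have "(0 :: 'a dual \<times> real) \<in> C"
    proof (rule boundedly_closedD[OF C(2)])
      show "c n \<in> C" for n using c by blast
      show "c n \<in> epi_box 1" for n
        using order_trans[OF cn(1) inv1] order_trans[OF cn(2) inv1] by (simp add: epi_box_def)
      show "(\<lambda>n. pairing \<bar>fst (c n) - fst 0\<bar> e) \<longlonglongrightarrow> 0"
      proof (rule tendsto_sandwich[OF _ _ tendsto_const])
        show "\<forall>\<^sub>F n in sequentially. 0 \<le> pairing \<bar>fst (c n) - fst 0\<bar> e"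
          by (intro always_eventually allI pairing_nonneg abs_ge_zero e0)
        show "\<forall>\<^sub>F n in sequentially. pairing \<bar>fst (c n) - fst 0\<bar> e \<le> inverse (real (Suc n)) * norm e"
        proof (intro always_eventually allI)
          fix n
          have "pairing \<bar>fst (c n) - fst 0\<bar> e \<le> norm (fst (c n)) * norm e"
            using pairing_abs_bound[OF e0, of "fst (c n)"] by simp
          also have "\<dots> \<le> inverse (real (Suc n)) * norm e" by (rule mult_right_mono[OF cn(1)]) simp
          finally show "pairing \<bar>fst (c n) - fst 0\<bar> e \<le> inverse (real (Suc n)) * norm e" .
        qed
        show "(\<lambda>n. inverse (real (Suc n)) * norm e) \<longlonglongrightarrow> 0"
          using tendsto_mult_left_zero[OF LIMSEQ_inverse_real_of_nat] .
      qed
      have "(\<lambda>n. snd (c n)) \<longlonglongrightarrow> 0"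
        by (rule Lim_null_comparison[OF always_eventually LIMSEQ_inverse_real_of_nat]) (use cn(2) in simp)
      then show "(\<lambda>n. snd (c n)) \<longlonglongrightarrow> snd 0" by simp
    qed
    with 0 show False by blast
  qed
  then obtain \<delta> where \<delta>: "\<delta> > 0" "C \<inter> epi_box \<delta> = {}" by blast
  obtain w :: "nat \<Rightarrow> 'a \<times> real" where w:
    "\<And>n. norm (fst (w n)) + \<bar>snd (w n)\<bar> \<le> 1 / (real (Suc n) * \<delta>)"
    "\<And>c. c \<in> C \<Longrightarrow> \<exists>n. 1/2 < epi_pairing c (w n)"
    by (rule separating_sequence[OF oc e C \<delta>]) blast
  show thesis by (rule separating_functional[OF \<delta>(1) C(1) w]) (assumption | rule that)+
qed

section \<open>Dual representation\<close>

text \<open>The translation moves \<open>(x0, \<alpha>)\<close> to the origin, the point to be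
  separated off. A subsequence with \<open>p\<close>-distances at most \<open>(1/2) ^ n\<close>
  uo-converges, so the sequence condition applies to it.\<close>

lemma boundedly_closed_epigraph:
  fixes e :: "'a::banach_lattice" and \<rho> :: "'a dual \<Rightarrow> ereal"
  assumes oc: "order_continuous_norm TYPE('a)" and e: "weak_unit e"
    and lsc: "\<And>(xs :: nat \<Rightarrow> 'a dual) x. bounded (range xs) \<Longrightarrow> uo_converges UNIV (\<le>) xs x \<Longrightarrow>
        \<rho> x \<le> liminf (\<lambda>n. \<rho> (xs n))"
  shows "boundedly_closed e {c. \<rho> (x0 + fst c) \<le> ereal (\<alpha> + snd c)}"
  unfolding boundedly_closed_def
proof (intro allI impI)
  fix R l and c :: "nat \<Rightarrow> 'a dual \<times> real"
  assume c: "\<forall>n. c n \<in> {c. \<rho> (x0 + fst c) \<le> ereal (\<alpha> + snd c)} \<inter> epi_box R"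
    and l: "(\<lambda>n. pairing \<bar>fst (c n) - fst l\<bar> e) \<longlonglongrightarrow> 0" "(\<lambda>n. snd (c n)) \<longlonglongrightarrow> snd l"
  have "\<exists>k. pairing \<bar>fst (c k) - fst l\<bar> e \<le> (1/2) ^ n \<and> \<bar>snd (c k) - snd l\<bar> \<le> (1/2) ^ n" for n
  proof -
    have pos: "(0::real) < (1/2) ^ n" by simp
    have "\<forall>\<^sub>F k in sequentially. pairing \<bar>fst (c k) - fst l\<bar> e < (1/2) ^ n \<and> dist (snd (c k)) (snd l) < (1/2) ^ n"
      by (intro eventually_conj order_tendstoD(2)[OF l(1) pos] tendstoD[OF l(2) pos])
    then obtain k where "pairing \<bar>fst (c k) - fst l\<bar> e < (1/2) ^ n \<and> dist (snd (c k)) (snd l) < (1/2) ^ n"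
      unfolding eventually_sequentially by blast
    then show ?thesis by (intro exI[of _ k]) (simp add: dist_real_def)
  qed
  then obtain k where k: "\<And>n. pairing \<bar>fst (c (k n)) - fst l\<bar> e \<le> (1/2) ^ n"
    "\<And>n. \<bar>snd (c (k n)) - snd l\<bar> \<le> (1/2) ^ n" by metis
  define x where "x n = x0 + fst (c (k n))" for n
  have "uo_converges UNIV (\<le>) x (x0 + fst l)"
    by (rule uo_converges_of_summable[OF oc e]) (simp add: x_def k(1))
  moreover have "bounded (range x)"
  proof -
    have "norm (x n) \<le> norm x0 + R" for n
    proof -
      have "norm (fst (c (k n))) \<le> R" using c by (simp add: epi_box_def)
      then show ?thesis using norm_triangle_ineq[of x0 "fst (c (k n))"] unfolding x_def by linarith
    qed
    then show ?thesis by (auto simp: bounded_iff)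
  qed
  ultimately have "\<rho> (x0 + fst l) \<le> liminf (\<lambda>n. \<rho> (x n))" by (intro lsc)
  also have "\<dots> \<le> liminf (\<lambda>n. ereal (\<alpha> + snd (c (k n))))"
    using c by (intro Liminf_mono always_eventually) (simp add: x_def)
  also have "\<dots> = ereal (\<alpha> + snd l)"
  proof (rule lim_imp_Liminf)
    have "(\<lambda>n. snd (c (k n)) - snd l) \<longlonglongrightarrow> 0"
      by (rule Lim_null_comparison[OF always_eventually LIMSEQ_power_zero[of "1/2::real"]]) (use k(2) in simp_all)
    then have "(\<lambda>n. snd (c (k n))) \<longlonglongrightarrow> snd l" by (simp only: LIM_zero_iff)
    then show "(\<lambda>n. ereal (\<alpha> + snd (c (k n)))) \<longlonglongrightarrow> ereal (\<alpha> + snd l)"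
      by (intro tendsto_ereal tendsto_add tendsto_const)
  qed simp
  finally show "l \<in> {c. \<rho> (x0 + fst c) \<le> ereal (\<alpha> + snd c)}" by simp
qed

lemma convex_epigraph:
  fixes \<rho> :: "'a::real_normed_vector dual \<Rightarrow> ereal"
  assumes "convex_functional \<rho>"
  shows "convex {c. \<rho> (x0 + fst c) \<le> ereal (\<alpha> + snd c)}"
  unfolding convex_def
proof (intro ballI allI impI)
  fix c d and u v :: real
  assume c: "c \<in> {c. \<rho> (x0 + fst c) \<le> ereal (\<alpha> + snd c)}"
    and d: "d \<in> {c. \<rho> (x0 + fst c) \<le> ereal (\<alpha> + snd c)}"
    and uv: "0 \<le> u" "0 \<le> v" "u + v = 1"
  have v: "v = 1 - u" using uv by simp
  have "x0 + fst (u *\<^sub>R c + v *\<^sub>R d) = u *\<^sub>R (x0 + fst c) + (1 - u) *\<^sub>R (x0 + fst d)"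
    by (simp add: v algebra_simps)
  then have "\<rho> (x0 + fst (u *\<^sub>R c + v *\<^sub>R d)) \<le> ereal u * \<rho> (x0 + fst c) + ereal (1 - u) * \<rho> (x0 + fst d)"
    using assms uv unfolding convex_functional_def by simp
  also have "\<dots> \<le> ereal u * ereal (\<alpha> + snd c) + ereal (1 - u) * ereal (\<alpha> + snd d)"
    using c d uv by (intro add_mono ereal_mult_left_mono) (auto simp: v)
  also have "\<dots> = ereal (\<alpha> + snd (u *\<^sub>R c + v *\<^sub>R d))" by (simp add: v algebra_simps)
  finally show "u *\<^sub>R c + v *\<^sub>R d \<in> {c. \<rho> (x0 + fst c) \<le> ereal (\<alpha> + snd c)}" by simp
qed

text \<open>A separating vector \<open>(y, s)\<close> with \<open>s > 0\<close> can be solved for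
  the real coordinate. The epigraph is closed upwards, so \<open>s \<ge> 0\<close>; the case
  \<open>s = 0\<close> can only arise when \<open>\<rho> x0\<close> is infinite.\<close>

lemma affine_minorant:
  fixes e :: "'a::banach_lattice" and \<rho> :: "'a dual \<Rightarrow> ereal"
  assumes oc: "order_continuous_norm TYPE('a)" and e: "weak_unit e"
    and lsc: "\<And>(xs :: nat \<Rightarrow> 'a dual) x. bounded (range xs) \<Longrightarrow> uo_converges UNIV (\<le>) xs x \<Longrightarrow>
        \<rho> x \<le> liminf (\<lambda>n. \<rho> (xs n))"
    and conv: "convex_functional \<rho>" and proper: "\<And>x. \<rho> x \<noteq> - \<infinity>" "proper \<rho>"
    and less: "ereal \<alpha> < \<rho> x0"
  shows "\<exists>y \<beta>. (\<forall>x. ereal (pairing x y + \<beta>) \<le> \<rho> x) \<and> \<alpha> \<le> pairing x0 y + \<beta>"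
proof -
  have sep: "\<exists>y s. \<forall>x q. \<rho> x \<le> ereal q \<longrightarrow> 1/4 \<le> pairing (x - a) y + (q - m) * s"
    if "ereal m < \<rho> a" for m a
  proof -
    have "0 \<notin> {c. \<rho> (a + fst c) \<le> ereal (m + snd c)}" using that by simp
    from boundedly_closed_separation[OF oc e convex_epigraph[OF conv] boundedly_closed_epigraph[OF oc e lsc] this]
    obtain v where v: "\<And>c. c \<in> {c. \<rho> (a + fst c) \<le> ereal (m + snd c)} \<Longrightarrow> 1/4 \<le> epi_pairing c v"
      by blast
    have "1/4 \<le> pairing (x - a) (fst v) + (q - m) * snd v" if "\<rho> x \<le> ereal q" for x q
      using v[of "(x - a, q - m)"] that by (simp add: epi_pairing_def)
    then show ?thesis by blast
  qed
  have minorant: "\<exists>y' \<beta>. (\<forall>x. ereal (pairing x y' + \<beta>) \<le> \<rho> x) \<and> m \<le> pairing a y' + \<beta>"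
    if s: "0 < s" and ys: "\<And>x q. \<rho> x \<le> ereal q \<Longrightarrow> 1/4 \<le> pairing (x - a) y + (q - m) * s" for a m y s
  proof -
    define y' where "y' = (- (1 / s)) *\<^sub>R y"
    define \<beta> where "\<beta> = m + pairing a y / s"
    have "ereal (pairing x y' + \<beta>) \<le> \<rho> x" for x
    proof (cases "\<rho> x")
      case (real q)
      have "0 \<le> pairing x y - pairing a y + (q - m) * s" using ys[of x q] real by simp
      then have "pairing a y / s - pairing x y / s + m \<le> q" using s by (simp add: field_simps)
      then show ?thesis by (simp add: real y'_def \<beta>_def)
    qed (use proper(1) in simp_all)
    moreover have "m \<le> pairing a y' + \<beta>" by (simp add: y'_def \<beta>_def)
    ultimately show ?thesis by blast
  qed
  obtain x1 q1 where x1: "\<rho> x1 = ereal q1"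
    using proper by (metis ereal_cases proper_def)
  obtain y s where ys: "\<And>x q. \<rho> x \<le> ereal q \<Longrightarrow> 1/4 \<le> pairing (x - x0) y + (q - \<alpha>) * s"
    using sep[OF less] by blast
  have s_nonneg: "0 \<le> s"
  proof (rule ccontr)
    assume s: "\<not> 0 \<le> s"
    \<comment> \<open>So large that the negative term \<open>(q - \<alpha>) * s\<close> offsets
      \<open>pairing (x1 - x0) y\<close>.\<close>
    define q where "q = max q1 (\<alpha> - pairing (x1 - x0) y / s)"
    have "\<alpha> - pairing (x1 - x0) y / s \<le> q" unfolding q_def by (rule max.cobounded2)
    then have "(q - \<alpha>) * s \<le> (- (pairing (x1 - x0) y / s)) * s"
      using s by (intro mult_right_mono_neg) linarith+
    also have "\<dots> = - pairing (x1 - x0) y" using s by simp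
    finally show False using ys[of x1 q] by (simp add: x1 q_def)
  qed
  show ?thesis
  proof (cases "s = 0")
    case False
    then show ?thesis using minorant[OF _ ys] s_nonneg by simp
  next
    case True
    txt \<open>The separating hyperplane is vertical: tilt a non-vertical one, which exists at a point
      where \<open>\<rho>\<close> is finite.\<close>
    have "ereal (q1 - 1) < \<rho> x1" by (simp add: x1)
    from sep[OF this] obtain y1 s1 where ys1:
      "\<And>x q. \<rho> x \<le> ereal q \<Longrightarrow> 1/4 \<le> pairing (x - x1) y1 + (q - (q1 - 1)) * s1" by blast
    \<comment> \<open>At \<open>x1\<close> the pairing vanishes and the real coordinate is 1 above
      the level \<open>q1 - 1\<close>, so the inequality reads \<open>1/4 \<le> s1\<close>.\<close>
    have "0 < s1" using ys1[of x1 q1] by (simp add: x1)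
    from minorant[OF this ys1] obtain z \<beta> where z: "\<And>x. ereal (pairing x z + \<beta>) \<le> \<rho> x" by blast
    \<comment> \<open>Tilting by \<open>N\<close> raises the minorant by \<open>N / 4\<close> at
      \<open>x0\<close> without passing \<rho>; this \<open>N\<close> makes it reach
      \<alpha>.\<close>
    define N where "N = max 0 (4 * (\<alpha> - (pairing x0 z + \<beta>)))"
    define \<beta>' where "\<beta>' = \<beta> + N * (1/4 + pairing x0 y)"
    have "ereal (pairing x (z - N *\<^sub>R y) + \<beta>') \<le> \<rho> x" for x
    proof (cases "\<rho> x")
      case (real q)
      have "1/4 \<le> pairing x y - pairing x0 y" using ys[of x q] real True by simp
      then have "N * (1/4 + pairing x0 y - pairing x y) \<le> 0"
        by (intro mult_nonneg_nonpos) (simp_all add: N_def)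
      moreover have "pairing x z + \<beta> \<le> q" using z[of x] real by simp
      ultimately show ?thesis by (simp add: real \<beta>'_def algebra_simps)
    qed (use proper(1) in simp_all)
    moreover have "\<alpha> \<le> pairing x0 (z - N *\<^sub>R y) + \<beta>'"
    proof -
      have "4 * (\<alpha> - (pairing x0 z + \<beta>)) \<le> N" by (simp add: N_def)
      moreover have "pairing x0 (z - N *\<^sub>R y) + \<beta>' = pairing x0 z + \<beta> + N / 4"
        by (simp add: \<beta>'_def algebra_simps)
      ultimately show ?thesis by argo
    qed
    ultimately show ?thesis by blast
  qed
qed

lemma dual_representation:
  fixes e :: "'a::banach_lattice" and \<rho> :: "'a dual \<Rightarrow> ereal"
  assumes oc: "order_continuous_norm TYPE('a)" and e: "weak_unit e"
    and lsc: "\<And>(xs :: nat \<Rightarrow> 'a dual) x. bounded (range xs) \<Longrightarrow> uo_converges UNIV (\<le>) xs x \<Longrightarrow>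
        \<rho> x \<le> liminf (\<lambda>n. \<rho> (xs n))"
    and conv: "convex_functional \<rho>" and proper: "\<And>x. \<rho> x \<noteq> - \<infinity>" "proper \<rho>"
  shows "\<rho> x = (SUP y. ereal (pairing x y) - conjugate \<rho> y)"
proof (rule antisym)
  show "(SUP y. ereal (pairing x y) - conjugate \<rho> y) \<le> \<rho> x"
  proof (rule SUP_least)
    fix y
    have *: "ereal (pairing x y) - \<rho> x \<le> conjugate \<rho> y"
      unfolding conjugate_def by (rule SUP_upper) simp
    show "ereal (pairing x y) - conjugate \<rho> y \<le> \<rho> x"
      using * proper(1)[of x] by (cases "\<rho> x"; cases "conjugate \<rho> y") auto
  qed
  show "\<rho> x \<le> (SUP y. ereal (pairing x y) - conjugate \<rho> y)"
  proof (rule dense_le)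
    fix a assume less: "a < \<rho> x"
    show "a \<le> (SUP y. ereal (pairing x y) - conjugate \<rho> y)"
    proof (cases a)
      case (real \<alpha>)
      with less have "ereal \<alpha> < \<rho> x" by simp
      from affine_minorant[OF oc e lsc conv proper this] obtain y \<beta> where
      y: "\<And>z. ereal (pairing z y + \<beta>) \<le> \<rho> z" "\<alpha> \<le> pairing x y + \<beta>" by blast
    \<comment> \<open>Being an affine minorant with slope \<open>y\<close> and constant \<beta>
      amounts to this bound.\<close>
    have "conjugate \<rho> y \<le> ereal (- \<beta>)"
      unfolding conjugate_def
    proof (rule SUP_least)
      fix z
      show "ereal (pairing z y) - \<rho> z \<le> ereal (- \<beta>)"
        using y(1)[of z] by (cases "\<rho> z") auto
    qed
    then have "ereal \<alpha> \<le> ereal (pairing x y) - conjugate \<rho> y"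
      using y(2) by (cases "conjugate \<rho> y") auto
    also have "\<dots> \<le> (SUP y. ereal (pairing x y) - conjugate \<rho> y)" by (rule SUP_upper) simp
    finally show ?thesis by (simp only: real)
    qed (use less in simp_all)
  qed
qed

text \<open>A supremum of functions that are continuous along bounded uo-convergent nets is lower
  semicontinuous along them.\<close>

lemma dual_representation_lsc:
  fixes e :: "'a::banach_lattice" and \<rho> :: "'a dual \<Rightarrow> ereal" and A :: "'i set"
  assumes oc: "order_continuous_norm TYPE('a)" and e: "weak_unit e"
    and proper: "\<And>x. \<rho> x \<noteq> - \<infinity>" "proper \<rho>"
    and rep: "\<rho> x = (SUP y. ereal (pairing x y) - conjugate \<rho> y)"
    and bd: "bounded (xs ` A)" and uo: "uo_converges A r xs x"
  shows "\<rho> x \<le> net_liminf A r (\<lambda>a. \<rho> (xs a))"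
  unfolding rep
proof (rule SUP_least)
  fix y
  have upper: "ereal (pairing z y) - \<rho> z \<le> conjugate \<rho> y" for z
    unfolding conjugate_def by (rule SUP_upper) simp
  obtain x1 q1 where x1: "\<rho> x1 = ereal q1"
    using proper by (metis ereal_cases proper_def)
  show "ereal (pairing x y) - conjugate \<rho> y \<le> net_liminf A r (\<lambda>a. \<rho> (xs a))"
  proof (cases "conjugate \<rho> y")
    case (real k)
    show ?thesis
    proof (rule ereal_le_epsilon2)
      fix \<epsilon> :: real assume "0 < \<epsilon>"
      then obtain a where a: "a \<in> A" "\<And>b. b \<in> A \<Longrightarrow> r a b \<Longrightarrow> \<bar>pairing (xs b) y - pairing x y\<bar> < \<epsilon>"
        using bounded_uo_converges_weak_star[OF oc e bd uo, of \<epsilon> y] by blast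
      have "ereal (pairing x y - \<epsilon> - k) \<le> \<rho> (xs b)" if "b \<in> A" "r a b" for b
        using a(2)[OF that] upper[of "xs b"] proper(1)[of "xs b"] real by (cases "\<rho> (xs b)") auto
      then have "ereal (pairing x y - \<epsilon> - k) \<le> (INF b\<in>{b \<in> A. r a b}. \<rho> (xs b))"
        by (intro INF_greatest) simp
      also have "\<dots> \<le> net_liminf A r (\<lambda>a. \<rho> (xs a))"
        unfolding net_liminf_def by (rule SUP_upper[OF a(1)])
      finally have "ereal (pairing x y - \<epsilon> - k) + ereal \<epsilon> \<le> net_liminf A r (\<lambda>a. \<rho> (xs a)) + ereal \<epsilon>"
        by (rule add_right_mono)
      then show "ereal (pairing x y) - conjugate \<rho> y \<le> net_liminf A r (\<lambda>a. \<rho> (xs a)) + ereal \<epsilon>"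
        by (simp add: real)
    qed
  next
    case MInf
    \<comment> \<open>Impossible by properness: the finite value at \<open>x1\<close> bounds the
      conjugate from below.\<close>
    then show ?thesis using upper[of x1] by (simp add: x1)
  qed simp
qed

lemma net_liminf_sequence: "net_liminf (UNIV :: nat set) (\<le>) f = liminf f"
  unfolding net_liminf_def liminf_SUP_INF by (simp add: atLeast_def)

(* The index type 'i of the nets is an arbitrary infinite type, so the theorem covers nets over
   every index set; it must be infinite for the nets over 'i to include the sequences. *)
theorem theorem4p6:
  fixes \<rho> :: "'y::banach_lattice dual \<Rightarrow> ereal"
  assumes "order_continuous_norm TYPE('y)"
    and "\<exists>e :: 'y. weak_unit e"
    and "\<And>x. \<rho> x \<noteq> - \<infinity>"
    and "proper \<rho>"
    and "convex_functional \<rho>"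
    and "infinite (UNIV :: 'i set)"
  shows "((\<forall>x. \<rho> x = (SUP y. ereal (pairing x y) - conjugate \<rho> y)) \<longleftrightarrow>
      (\<forall>(A :: 'i set) r xs x. directed_by A r \<longrightarrow> bounded (xs ` A) \<longrightarrow> uo_converges A r xs x \<longrightarrow>
        \<rho> x \<le> net_liminf A r (\<lambda>a. \<rho> (xs a))))
    \<and> ((\<forall>x. \<rho> x = (SUP y. ereal (pairing x y) - conjugate \<rho> y)) \<longleftrightarrow>
      (\<forall>(xs :: nat \<Rightarrow> 'y dual) x. bounded (range xs) \<longrightarrow> uo_converges UNIV (\<le>) xs x \<longrightarrow>
        \<rho> x \<le> liminf (\<lambda>n. \<rho> (xs n))))"
proof -
  let ?rep = "\<forall>x. \<rho> x = (SUP y. ereal (pairing x y) - conjugate \<rho> y)"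
  let ?net = "\<forall>(A :: 'i set) r xs x. directed_by A r \<longrightarrow> bounded (xs ` A) \<longrightarrow>
    uo_converges A r xs x \<longrightarrow> \<rho> x \<le> net_liminf A r (\<lambda>a. \<rho> (xs a))"
  let ?seq = "\<forall>(xs :: nat \<Rightarrow> 'y dual) x. bounded (range xs) \<longrightarrow> uo_converges UNIV (\<le>) xs x \<longrightarrow>
    \<rho> x \<le> liminf (\<lambda>n. \<rho> (xs n))"
  obtain e :: 'y where e: "weak_unit e" using assms(2) by blast
  have rep_lsc: "\<rho> x \<le> net_liminf A r (\<lambda>a. \<rho> (xs a))"
    if ?rep "bounded (xs ` A)" "uo_converges A r xs x" for A :: "'i set" and r xs x
    by (rule dual_representation_lsc[OF assms(1) e assms(3,4) spec[OF that(1)] that(2,3)])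
  have rep_net: ?net if ?rep
    by (intro allI impI) (rule rep_lsc[OF that])
  have net_seq: ?seq if net: ?net
  proof (intro allI impI)
    fix xs :: "nat \<Rightarrow> 'y dual" and x
    assume bd: "bounded (range xs)" and uo: "uo_converges UNIV (\<le>) xs x"
    \<comment> \<open>\<open>range h\<close> is a copy of the naturals inside the index type,
      ordered through the inverse \<open>g\<close>, on which the sequence becomes a net.\<close>
    obtain h :: "nat \<Rightarrow> 'i" where h: "inj h"
      using infinite_countable_subset[OF assms(6)] by blast
    define g where "g = inv h"
    have g [simp]: "g (h n) = n" for n by (simp add: g_def h)
    have "directed_by (range h) (\<lambda>a b. g a \<le> g b)"
      unfolding directed_by_def
    proof (intro conjI ballI impI)
      fix a b assume "a \<in> range h" "b \<in> range h"
      show "\<exists>c\<in>range h. g a \<le> g c \<and> g b \<le> g c"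
        by (intro bexI[of _ "h (max (g a) (g b))"]) auto
    qed (auto intro: order_trans)
    moreover have "bounded ((\<lambda>a. xs (g a)) ` range h)"
      using bd by (simp add: image_image)
    moreover have "uo_converges (range h) (\<lambda>a b. g a \<le> g b) (\<lambda>a. xs (g a)) x"
      using uo unfolding uo_converges_def order_converges_def by simp
    ultimately have "\<rho> x \<le> net_liminf (range h) (\<lambda>a b. g a \<le> g b) (\<lambda>a. \<rho> (xs (g a)))"
      using net by blast
    also have "\<dots> = net_liminf UNIV (\<le>) (\<lambda>n. \<rho> (xs n))"
    proof -
      have "{b \<in> range h. n \<le> g b} = h ` {m. n \<le> m}" for n by auto
      then show ?thesis by (simp add: net_liminf_def image_image)
    qed
    finally show "\<rho> x \<le> liminf (\<lambda>n. \<rho> (xs n))" by (simp add: net_liminf_sequence)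
  qed
  have seq_rep: ?rep if seq: ?seq
  proof
    fix x
    show "\<rho> x = (SUP y. ereal (pairing x y) - conjugate \<rho> y)"
      by (rule dual_representation[OF assms(1) e _ assms(5,3,4)]) (use seq in blast)
  qed
  show ?thesis using rep_net net_seq seq_rep by blast
qed

end
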